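(* Let $A$ be a commutative ring, $\mathcal{C}$ an $A$-coalgebra, $B$ a ring, and $\Sigma\in{}_B\mathcal{M}^{\mathcal{C}}_{\rm fgp}$. Consider the Morita context $\mathbb{C}=(T,{}^*\mathcal{C},\Sigma,Q,\tau,\mu)$ associated to $\Sigma$ (see context). If $A$ is a (commutative) PF ring and $\mathcal{C}$ is left and right coFrobenius, then there exist a monomorphism of $(A,B)$-bimodules $J:\Sigma^*\to Q$ and an epimorphism of $(A,B)$-bimodules $J':\Sigma^*\to Q$. Conversely, suppose that $A$ is a commutative PF ring, $\mathcal{C}$ is locally projective as a left $A$-module, $({}^*\mathcal{C})^{\rm rat}$ is dense in ${}^*\mathcal{C}$ in the finite topology, $l:B\to T$, $l(b)(u)=bu$, is an isomorphism, $\tau$ is surjective, and the equivalent conditions (i)–(ix) listed in the context are satisfied. Then the existence of a monomorphism $J:\Sigma^*\to Q$ and an epimorphism $J':\Sigma^*\to Q$ of $(A,B)$-bimodules implies that $\mathcal{C}$ is left and right coFrobenius.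
   Context: A ring $A$ is a PF (Pseudo-Frobenius) ring if $A$ is an injective cogenerator of $\mathcal{M}_A$ (right $A$-modules). An $A$-coalgebra over a commutative ring $A$ is an $A$-coring on which the left and right $A$-actions coincide, i.e. an $A$-module $\mathcal{C}$ with coassociative $\Delta:\mathcal{C}\to\mathcal{C}\otimes_A\mathcal{C}$, $\Delta(c)=c_{(1)}\otimes_A c_{(2)}$, and counit $\varepsilon:\mathcal{C}\to A$. Right $\mathcal{C}$-comodules are (right) $A$-modules with an $A$-linear, coassociative, counital coaction $m\mapsto m_{[0]}\otimes_A m_{[1]}$; morphisms are $A$-linear maps commuting with coactions; category $\mathcal{M}^{\mathcal{C}}$, with $\mathrm{Hom}^{\mathcal{C}}$, $\mathrm{End}^{\mathcal{C}}$; left comodules and ${}^{\mathcal{C}}\mathrm{Hom}$ symmetrically. $\Sigma\in{}_B\mathcal{M}^{\mathcal{C}}_{\rm fgp}$ means: $\Sigma$ is a $(B,A)$-bimodule, finitely generated projective as a right $A$-module, and a right $\mathcal{C}$-comodule with left $B$-linear coaction. $\Sigma^*=\mathrm{Hom}_A(\Sigma,A)$ is an $(A,B)$-bimodule via $(afb)(u)=af(bu)$. ${}^*\mathcal{C}={}_A\mathrm{Hom}(\mathcal{C},A)$ is a ring with $(f\#g)(c)=g(c_{(1)}f(c_{(2)}))$; $\mathcal{C}^*=\mathrm{Hom}_A(\mathcal{C},A)$ is a ring with $(f\#g)(c)=f(g(c_{(1)})c_{(2)})$ (for a coalgebra these coincide). $\mathcal{C}$ is a right ${}^*\mathcal{C}$-module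 via $c\cdot f=c_{(1)}f(c_{(2)})$ and a left $\mathcal{C}^*$-module via $f\cdot c=f(c_{(1)})c_{(2)}$. $\mathcal{C}$ is locally projective as an $A$-module if for every finite $D\subset\mathcal{C}$ there are finitely many $c_i^*\in{}^*\mathcal{C}$, $c_i\in\mathcal{C}$ with $d=\sum_i c_i^*(d)c_i$ for all $d\in D$. $\mathcal{C}$ is right coFrobenius if it is locally projective and there is an injective $(A,{}^*\mathcal{C})$-bimodule map $\mathcal{C}\to{}^*\mathcal{C}$; left coFrobenius if it is locally projective and there is an injective $(\mathcal{C}^*,A)$-bimodule map $\mathcal{C}\to\mathcal{C}^*$. With dual basis $\sum_i e_i\otimes_A f_i$ of $\Sigma$, $\Sigma^*$ is a left $\mathcal{C}$-comodule via $f\mapsto\sum_i f(e_{i[0]})e_{i[1]}\otimes_A f_i$. The context $\mathbb{C}$: $T=\mathrm{End}^{\mathcal{C}}(\Sigma)$; $Q={}^{\mathcal{C}}\mathrm{Hom}(\mathcal{C},\Sigma^* )$ is a $({}^*\mathcal{C},T)$-bimodule via $(f\cdot q)(c)=q(c_{(1)}f(c_{(2)}))$, $(q\cdot t)(c)=q(c)\circ t$; $\Sigma$ is a $(T,{}^*\mathcal{C})$-bimodule via $t\cdot u=t(u)$, $u\cdot f=u_{[0]}f(u_{[1]})$; connecting maps $\mu:Q\otimes_T\Sigma\to{}^*\mathcal{C}$, $\mu(q\otimes u)(c)=q(c)(u)$, $\tau:\Sigma\otimes_{{}^*\mathcal{C}}Q\to T$, $\tau(u\otimes q)(v)=u_{[0]}(q(u_{[1]})(v))$.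 The $(A,B)$-bimodule structure on $Q$ is $(aqb)(c)(u)=q(ca)(bu)$. $f\in{}^*\mathcal{C}$ is rational if there are finitely many $f_i\in{}^*\mathcal{C}$, $c_i\in\mathcal{C}$ with $f\#g=\sum_i f_i\,g(c_i)$ for all $g\in{}^*\mathcal{C}$; $({}^*\mathcal{C})^{\rm rat}$ is the set of rational elements. It is dense in the finite topology if for every $f\in{}^*\mathcal{C}$ and finite $D\subset\mathcal{C}$ there is $g\in({}^*\mathcal{C})^{\rm rat}$ with $g|_D=f|_D$; then it is a ring with local units. The image of $\mu$ lies in $({}^*\mathcal{C})^{\rm rat}$ (for $\mathcal{C}$ locally projective), and $\mathbb{C}'=(T,({}^*\mathcal{C})^{\rm rat},\Sigma,Q,\tau,\mu)$ is the restricted Morita context. The conditions (equivalent under the hypotheses of the converse): (i) $\mathrm{can}:\Sigma^*\otimes_B\Sigma\to\mathcal{C}$, $g\otimes u\mapsto g(u_{[0]})u_{[1]}$, is an isomorphism and ${}_B\Sigma$ is faithfully flat; (ii) $\mathrm{can}$ is an isomorphism and ${}_B\Sigma$ is flat; (iii) $\Sigma$ is a generator in $\mathcal{M}^{\mathcal{C}}$; (iv) $\Sigma$ is a projective generator in $\mathcal{M}^{\mathcal{C}}$; (v) $\Sigma$ is a progenerator in the category of right $({}^*\mathcal{C})^{\rm rat}$-modules $M$ with $M\otimes_{({}^*\mathcal{C})^{\rm rat}}({}^*\mathcal{C})^{\rm rat}\to M$ an isomorphism; (vi) $\mu$ is surjective onto $({}^*\mathcal{C})^{\rm rat}$; (vii)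 $\mathbb{C}'$ is strict (both connecting maps bijective); (viii) $-\otimes_B\Sigma:\mathcal{M}_B\to\mathcal{M}^{\mathcal{C}}$ and its right adjoint $\mathrm{Hom}^{\mathcal{C}}(\Sigma,-)$ are inverse equivalences; (ix) for all $N\in\mathcal{M}^{\mathcal{C}}$, the evaluation map $\mathrm{Hom}^{\mathcal{C}}(\Sigma,N)\otimes_B\Sigma\to N$ is an isomorphism. *)

theory Defs
  imports "HOL-Algebra.Module" "HOL-Algebra.QuotRing" "HOL-Algebra.Free_Abelian_Groups"
begin

section \<open>Modules over arbitrary rings\<close>

text \<open>Left and right modules both use the record \<open>module\<close> of HOL-Algebra, whose scalar
  multiplication takes the scalar first. For a right module \<open>r \<odot>\<^bsub>M\<^esub> m\<close> therefore stands for
  the product of \<open>m\<close> and \<open>r\<close> in that order, which shows only in the associativity law.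
  The field \<open>mult\<close> of a module record is ignored unless the record also serves as a ring.
  Modules over the commutative ring \<open>A\<close> are given by the library locale \<open>module\<close>.\<close>

locale right_rng_module = R?: abelian_group R + M?: abelian_group M
  for R :: "('r, 'x) ring_scheme" (structure) and M :: "('r, 'm, 'y) module_scheme" (structure) +
  assumes act_closed: "\<lbrakk>r \<in> carrier R; m \<in> carrier M\<rbrakk> \<Longrightarrow> r \<odot>\<^bsub>M\<^esub> m \<in> carrier M"
    and act_l_distr: "\<lbrakk>r \<in> carrier R; s \<in> carrier R; m \<in> carrier M\<rbrakk> \<Longrightarrow>
      (r \<oplus>\<^bsub>R\<^esub> s) \<odot>\<^bsub>M\<^esub> m = r \<odot>\<^bsub>M\<^esub> m \<oplus>\<^bsub>M\<^esub> s \<odot>\<^bsub>M\<^esub> m"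
    and act_r_distr: "\<lbrakk>r \<in> carrier R; m \<in> carrier M; n \<in> carrier M\<rbrakk> \<Longrightarrow>
      r \<odot>\<^bsub>M\<^esub> (m \<oplus>\<^bsub>M\<^esub> n) = r \<odot>\<^bsub>M\<^esub> m \<oplus>\<^bsub>M\<^esub> r \<odot>\<^bsub>M\<^esub> n"
    and act_assoc: "\<lbrakk>r \<in> carrier R; s \<in> carrier R; m \<in> carrier M\<rbrakk> \<Longrightarrow>
      (r \<otimes>\<^bsub>R\<^esub> s) \<odot>\<^bsub>M\<^esub> m = s \<odot>\<^bsub>M\<^esub> (r \<odot>\<^bsub>M\<^esub> m)"

locale right_module = R?: ring R + right_rng_module R M
  for R :: "('r, 'x) ring_scheme" (structure) and M :: "('r, 'm, 'y) module_scheme" (structure) +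
  assumes act_one: "m \<in> carrier M \<Longrightarrow> \<one>\<^bsub>R\<^esub> \<odot>\<^bsub>M\<^esub> m = m"

locale left_module = R?: ring R + M?: abelian_group M
  for R :: "('r, 'x) ring_scheme" (structure) and M :: "('r, 'm, 'y) module_scheme" (structure) +
  assumes act_closed: "\<lbrakk>r \<in> carrier R; m \<in> carrier M\<rbrakk> \<Longrightarrow> r \<odot>\<^bsub>M\<^esub> m \<in> carrier M"
    and act_l_distr: "\<lbrakk>r \<in> carrier R; s \<in> carrier R; m \<in> carrier M\<rbrakk> \<Longrightarrow>
      (r \<oplus>\<^bsub>R\<^esub> s) \<odot>\<^bsub>M\<^esub> m = r \<odot>\<^bsub>M\<^esub> m \<oplus>\<^bsub>M\<^esub> s \<odot>\<^bsub>M\<^esub> m"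
    and act_r_distr: "\<lbrakk>r \<in> carrier R; m \<in> carrier M; n \<in> carrier M\<rbrakk> \<Longrightarrow>
      r \<odot>\<^bsub>M\<^esub> (m \<oplus>\<^bsub>M\<^esub> n) = r \<odot>\<^bsub>M\<^esub> m \<oplus>\<^bsub>M\<^esub> r \<odot>\<^bsub>M\<^esub> n"
    and act_assoc: "\<lbrakk>r \<in> carrier R; s \<in> carrier R; m \<in> carrier M\<rbrakk> \<Longrightarrow>
      (r \<otimes>\<^bsub>R\<^esub> s) \<odot>\<^bsub>M\<^esub> m = r \<odot>\<^bsub>M\<^esub> (s \<odot>\<^bsub>M\<^esub> m)"
    and act_one: "m \<in> carrier M \<Longrightarrow> \<one>\<^bsub>R\<^esub> \<odot>\<^bsub>M\<^esub> m = m"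

definition with_action :: "('m, 'x) ring_scheme \<Rightarrow> ('r \<Rightarrow> 'm \<Rightarrow> 'm) \<Rightarrow> ('r, 'm) module" where
  "with_action M act =
    \<lparr>carrier = carrier M, monoid.mult = monoid.mult M, monoid.one = monoid.one M,
     ring.zero = ring.zero M, ring.add = ring.add M, smult = act\<rparr>"

definition reg_left :: "('r, 'x) ring_scheme \<Rightarrow> ('r, 'r) module" where
  "reg_left R = with_action R (\<lambda>r x. r \<otimes>\<^bsub>R\<^esub> x)"

definition reg_right :: "('r, 'x) ring_scheme \<Rightarrow> ('r, 'r) module" where
  "reg_right R = with_action R (\<lambda>r x. x \<otimes>\<^bsub>R\<^esub> r)"

definition mod_hom ::
  "('r, 'x) ring_scheme \<Rightarrow> ('r, 'm, 'y) module_scheme \<Rightarrow> ('r, 'n, 'z) module_scheme \<Rightarrow> ('m \<Rightarrow> 'n) set"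
  where "mod_hom R M N = {f \<in> carrier M \<rightarrow> carrier N.
    (\<forall>x\<in>carrier M. \<forall>y\<in>carrier M. f (x \<oplus>\<^bsub>M\<^esub> y) = f x \<oplus>\<^bsub>N\<^esub> f y) \<and>
    (\<forall>r\<in>carrier R. \<forall>x\<in>carrier M. f (r \<odot>\<^bsub>M\<^esub> x) = r \<odot>\<^bsub>N\<^esub> f x)}"

text \<open>Hom-sets that are carriers of structures consist of functions that are \<open>undefined\<close> off the
  carrier of their domain, so that equality of elements is equality of maps.\<close>

definition Hom ::
  "('r, 'x) ring_scheme \<Rightarrow> ('r, 'm, 'y) module_scheme \<Rightarrow> ('r, 'n, 'z) module_scheme \<Rightarrow> ('m \<Rightarrow> 'n) set"
  where "Hom R M N = mod_hom R M N \<inter> extensional (carrier M)"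

definition fun_group :: "('d \<Rightarrow> 'n) set \<Rightarrow> 'd set \<Rightarrow> ('n, 'z) ring_scheme \<Rightarrow> ('d \<Rightarrow> 'n) ring" where
  "fun_group E D N =
    \<lparr>carrier = E, monoid.mult = undefined, monoid.one = undefined,
     ring.zero = (\<lambda>x\<in>D. \<zero>\<^bsub>N\<^esub>), ring.add = (\<lambda>f g. \<lambda>x\<in>D. f x \<oplus>\<^bsub>N\<^esub> g x)\<rparr>"

definition exact_at ::
  "('m, 'x) ring_scheme \<Rightarrow> ('m \<Rightarrow> 'n) \<Rightarrow> ('n, 'y) ring_scheme \<Rightarrow> ('n \<Rightarrow> 'p) \<Rightarrow> ('p, 'z) ring_scheme \<Rightarrow> bool"
  where "exact_at M f N g P \<longleftrightarrow> f ` carrier M = {x \<in> carrier N. g x = \<zero>\<^bsub>P\<^esub>}"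

definition finitely_generated :: "('r, 'x) ring_scheme \<Rightarrow> ('r, 'm, 'y) module_scheme \<Rightarrow> bool" where
  "finitely_generated R M \<longleftrightarrow> (\<exists>E. finite E \<and> E \<subseteq> carrier M \<and>
    (\<forall>N. E \<subseteq> N \<and> subgroup N (add_monoid M) \<and> (\<forall>r\<in>carrier R. \<forall>x\<in>N. r \<odot>\<^bsub>M\<^esub> x \<in> N)
      \<longrightarrow> N = carrier M))"

definition free_mod :: "('r, 'x) ring_scheme \<Rightarrow> nat \<Rightarrow> ('r, nat \<Rightarrow> 'r) module" where
  "free_mod R n = with_action (fun_group ({..<n} \<rightarrow>\<^sub>E carrier R) {..<n} R)
    (\<lambda>r x. \<lambda>i\<in>{..<n}. r \<otimes>\<^bsub>R\<^esub> x i)"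

text \<open>Finitely generated projective: a direct summand of a finitely generated free module.\<close>

definition fg_projective :: "('r, 'x) ring_scheme \<Rightarrow> ('r, 'm, 'y) module_scheme \<Rightarrow> bool" where
  "fg_projective R M \<longleftrightarrow> (\<exists>n. \<exists>i\<in>mod_hom R M (free_mod R n). \<exists>p\<in>mod_hom R (free_mod R n) M.
    \<forall>x\<in>carrier M. p (i x) = x)"

text \<open>A definition that quantifies over all modules or all comodules takes the type that their
  carriers live in as an explicit parameter.\<close>

definition injective_mod ::
  "'u itself \<Rightarrow> ('r, 'x) ring_scheme \<Rightarrow> ('r, 'e, 'y) module_scheme \<Rightarrow> bool" where
  "injective_mod U R E \<longleftrightarrow> (\<forall>(M :: ('r, 'u) module) (N :: ('r, 'u) module).
    right_module R M \<and> right_module R N \<longrightarrow>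
    (\<forall>i\<in>mod_hom R M N. inj_on i (carrier M) \<longrightarrow>
      (\<forall>f\<in>mod_hom R M E. \<exists>g\<in>mod_hom R N E. \<forall>x\<in>carrier M. g (i x) = f x)))"

definition cogenerator_mod ::
  "'u itself \<Rightarrow> ('r, 'x) ring_scheme \<Rightarrow> ('r, 'e, 'y) module_scheme \<Rightarrow> bool" where
  "cogenerator_mod U R E \<longleftrightarrow> (\<forall>(M :: ('r, 'u) module) (N :: ('r, 'u) module).
    right_module R M \<and> right_module R N \<longrightarrow>
    (\<forall>f\<in>mod_hom R M N. \<forall>g\<in>mod_hom R M N. (\<exists>x\<in>carrier M. f x \<noteq> g x) \<longrightarrow>
      (\<exists>h\<in>mod_hom R N E. \<exists>x\<in>carrier M. h (f x) \<noteq> h (g x))))"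

definition PF_ring :: "'u itself \<Rightarrow> ('r, 'x) ring_scheme \<Rightarrow> bool" where
  "PF_ring U R \<longleftrightarrow> ring R \<and> injective_mod U R (reg_right R) \<and> cogenerator_mod U R (reg_right R)"


section \<open>Tensor products\<close>

text \<open>For a right \<open>R\<close>-module \<open>M\<close> and a left \<open>R\<close>-module \<open>N\<close>, the tensor product over \<open>R\<close> is the free
  abelian group on pairs modulo the usual relations; its elements are cosets.\<close>

type_synonym ('m, 'n) tens = "('m \<times> 'n \<Rightarrow>\<^sub>0 int) set"

definition tensor_rels ::
  "('r, 'x) ring_scheme \<Rightarrow> ('r, 'm, 'y) module_scheme \<Rightarrow> ('r, 'n, 'z) module_scheme \<Rightarrow>
    ('m \<times> 'n \<Rightarrow>\<^sub>0 int) set" where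
  "tensor_rels R M N =
    {frag_of (m \<oplus>\<^bsub>M\<^esub> m', n) - frag_of (m, n) - frag_of (m', n) | m m' n.
      m \<in> carrier M \<and> m' \<in> carrier M \<and> n \<in> carrier N} \<union>
    {frag_of (m, n \<oplus>\<^bsub>N\<^esub> n') - frag_of (m, n) - frag_of (m, n') | m n n'.
      m \<in> carrier M \<and> n \<in> carrier N \<and> n' \<in> carrier N} \<union>
    {frag_of (r \<odot>\<^bsub>M\<^esub> m, n) - frag_of (m, r \<odot>\<^bsub>N\<^esub> n) | r m n.
      r \<in> carrier R \<and> m \<in> carrier M \<and> n \<in> carrier N}"

definition tensor_kernel ::
  "('r, 'x) ring_scheme \<Rightarrow> ('r, 'm, 'y) module_scheme \<Rightarrow> ('r, 'n, 'z) module_scheme \<Rightarrow> ('m, 'n) tens"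
  where "tensor_kernel R M N =
    generate (free_Abelian_group (carrier M \<times> carrier N)) (tensor_rels R M N)"

definition tensor_quot ::
  "('r, 'x) ring_scheme \<Rightarrow> ('r, 'm, 'y) module_scheme \<Rightarrow> ('r, 'n, 'z) module_scheme \<Rightarrow>
    ('m, 'n) tens monoid" where
  "tensor_quot R M N = free_Abelian_group (carrier M \<times> carrier N) Mod tensor_kernel R M N"

definition tensor_ab ::
  "('r, 'x) ring_scheme \<Rightarrow> ('r, 'm, 'y) module_scheme \<Rightarrow> ('r, 'n, 'z) module_scheme \<Rightarrow>
    ('m, 'n) tens ring" where
  "tensor_ab R M N =
    \<lparr>carrier = carrier (tensor_quot R M N), monoid.mult = undefined, monoid.one = undefined,
     ring.zero = monoid.one (tensor_quot R M N), ring.add = monoid.mult (tensor_quot R M N)\<rparr>"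

definition pure ::
  "('r, 'x) ring_scheme \<Rightarrow> ('r, 'm, 'y) module_scheme \<Rightarrow> ('r, 'n, 'z) module_scheme \<Rightarrow>
    'm \<Rightarrow> 'n \<Rightarrow> ('m, 'n) tens" where
  "pure R M N m n = tensor_kernel R M N #>\<^bsub>free_Abelian_group (carrier M \<times> carrier N)\<^esub> frag_of (m, n)"

text \<open>The additive map to \<open>P\<close> with \<open>m \<otimes> n \<mapsto> \<phi> m n\<close>, for an \<open>R\<close>-balanced biadditive \<open>\<phi>\<close>:
  \<open>\<phi>\<close> is extended to formal sums, and the extension is constant on cosets. An expression such as
  \<open>c\<^sub>(\<^sub>1\<^sub>) f(c\<^sub>(\<^sub>2\<^sub>))\<close> in Sweedler notation is the value of such a map at \<open>\<Delta>(c)\<close>.\<close>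

definition tensor_lift ::
  "('r, 'x) ring_scheme \<Rightarrow> ('r, 'm, 'y) module_scheme \<Rightarrow> ('r, 'n, 'z) module_scheme \<Rightarrow>
    ('p, 'w) ring_scheme \<Rightarrow> ('m \<Rightarrow> 'n \<Rightarrow> 'p) \<Rightarrow> ('m, 'n) tens \<Rightarrow> 'p" where
  "tensor_lift R M N P \<phi> E = the_elem
    ((\<lambda>x. \<Oplus>\<^bsub>P\<^esub>p\<in>Poly_Mapping.keys x. [Poly_Mapping.lookup x p] \<cdot>\<^bsub>P\<^esub> \<phi> (fst p) (snd p)) ` E)"

definition tensor_map ::
  "('r, 'x) ring_scheme \<Rightarrow> ('r, 'm, 'y) module_scheme \<Rightarrow> ('r, 'n, 'z) module_scheme \<Rightarrow>
    ('r, 'p, 'v) module_scheme \<Rightarrow> ('r, 'q, 'w) module_scheme \<Rightarrow>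
    ('m \<Rightarrow> 'p) \<Rightarrow> ('n \<Rightarrow> 'q) \<Rightarrow> ('m, 'n) tens \<Rightarrow> ('p, 'q) tens" where
  "tensor_map R M N M' N' f g =
    tensor_lift R M N (tensor_ab R M' N') (\<lambda>m n. pure R M' N' (f m) (g n))"

text \<open>For commutative \<open>A\<close> the tensor product is again an \<open>A\<close>-module.\<close>

definition tensor ::
  "('a, 'x) ring_scheme \<Rightarrow> ('a, 'm, 'y) module_scheme \<Rightarrow> ('a, 'n, 'z) module_scheme \<Rightarrow>
    ('a, ('m, 'n) tens) module" where
  "tensor A M N = with_action (tensor_ab A M N)
    (\<lambda>a. tensor_map A M N M N (\<lambda>m. a \<odot>\<^bsub>M\<^esub> m) (\<lambda>n. n))"

definition tensor_assoc ::
  "('a, 'x) ring_scheme \<Rightarrow> ('a, 'm, 'y) module_scheme \<Rightarrow> ('a, 'n, 'z) module_scheme \<Rightarrow>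
    ('a, 'p, 'w) module_scheme \<Rightarrow> (('m, 'n) tens, 'p) tens \<Rightarrow> ('m, ('n, 'p) tens) tens" where
  "tensor_assoc A M N P =
    tensor_lift A (tensor A M N) P (tensor A M (tensor A N P))
      (\<lambda>t p. tensor_lift A M N (tensor A M (tensor A N P))
        (\<lambda>m n. pure A M (tensor A N P) m (pure A N P n p)) t)"

definition flat ::
  "'u itself \<Rightarrow> ('r, 'x) ring_scheme \<Rightarrow> ('r, 'f, 'y) module_scheme \<Rightarrow> bool" where
  "flat U R F \<longleftrightarrow> left_module R F \<and> (\<forall>(M :: ('r, 'u) module) (N :: ('r, 'u) module).
    right_module R M \<and> right_module R N \<longrightarrow>
    (\<forall>i\<in>mod_hom R M N. inj_on i (carrier M) \<longrightarrow>
      inj_on (tensor_map R M F N F i (\<lambda>x. x)) (carrier (tensor_ab R M F))))"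

definition faithfully_flat ::
  "'u itself \<Rightarrow> ('r, 'x) ring_scheme \<Rightarrow> ('r, 'f, 'y) module_scheme \<Rightarrow> bool" where
  "faithfully_flat U R F \<longleftrightarrow> left_module R F \<and>
    (\<forall>(M :: ('r, 'u) module) (N :: ('r, 'u) module) (P :: ('r, 'u) module).
    right_module R M \<and> right_module R N \<and> right_module R P \<longrightarrow>
    (\<forall>f\<in>mod_hom R M N. \<forall>g\<in>mod_hom R N P.
      exact_at M f N g P \<longleftrightarrow>
      exact_at (tensor_ab R M F) (tensor_map R M F N F f (\<lambda>x. x)) (tensor_ab R N F)
        (tensor_map R N F P F g (\<lambda>x. x)) (tensor_ab R P F)))"

text \<open>Modules \<open>M\<close> over a possibly non-unital ring \<open>R\<close> for which \<open>M \<otimes>\<^sub>R R \<rightarrow> M\<close> is an isomorphism.\<close>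

definition firm :: "('r, 'x) ring_scheme \<Rightarrow> ('r, 'm, 'y) module_scheme \<Rightarrow> bool" where
  "firm R M \<longleftrightarrow> right_rng_module R M \<and>
    bij_betw (tensor_lift R M (reg_left R) M (\<lambda>m r. r \<odot>\<^bsub>M\<^esub> m))
      (carrier (tensor_ab R M (reg_left R))) (carrier M)"

definition firm_generator ::
  "'u itself \<Rightarrow> ('r, 'x) ring_scheme \<Rightarrow> ('r, 'p, 'y) module_scheme \<Rightarrow> bool" where
  "firm_generator U R P \<longleftrightarrow> (\<forall>(M :: ('r, 'u) module) (N :: ('r, 'u) module).
    firm R M \<and> firm R N \<longrightarrow>
    (\<forall>f\<in>mod_hom R M N. \<forall>g\<in>mod_hom R M N. (\<exists>x\<in>carrier M. f x \<noteq> g x) \<longrightarrow>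
      (\<exists>h\<in>mod_hom R P M. \<exists>x\<in>carrier P. f (h x) \<noteq> g (h x))))"

definition firm_projective ::
  "'u itself \<Rightarrow> ('r, 'x) ring_scheme \<Rightarrow> ('r, 'p, 'y) module_scheme \<Rightarrow> bool" where
  "firm_projective U R P \<longleftrightarrow> (\<forall>(M :: ('r, 'u) module) (N :: ('r, 'u) module).
    firm R M \<and> firm R N \<longrightarrow>
    (\<forall>p\<in>mod_hom R M N. p ` carrier M = carrier N \<longrightarrow>
      (\<forall>f\<in>mod_hom R P N. \<exists>g\<in>mod_hom R P M. \<forall>x\<in>carrier P. p (g x) = f x)))"

definition firm_progenerator ::
  "'u itself \<Rightarrow> ('r, 'x) ring_scheme \<Rightarrow> ('r, 'p, 'y) module_scheme \<Rightarrow> bool" where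
  "firm_progenerator U R P \<longleftrightarrow>
    firm R P \<and> finitely_generated R P \<and> firm_projective U R P \<and> firm_generator U R P"


section \<open>Coalgebras and comodules\<close>

record ('a, 'c) coalgebra = "('a, 'c) module" +
  comult :: "'c \<Rightarrow> ('c, 'c) tens"
  counit :: "'c \<Rightarrow> 'a"

record ('a, 'c, 'm) comodule = "('a, 'm) module" +
  coact :: "'m \<Rightarrow> ('m, 'c) tens"

record ('a, 'b, 'c, 's) bicomodule = "('a, 'c, 's) comodule" +
  lact :: "'b \<Rightarrow> 's \<Rightarrow> 's"

definition is_coalgebra :: "('a, 'x) ring_scheme \<Rightarrow> ('a, 'c) coalgebra \<Rightarrow> bool" where
  "is_coalgebra A C \<longleftrightarrow>
    module A C \<and>
    comult C \<in> mod_hom A C (tensor A C C) \<and>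
    counit C \<in> mod_hom A C (reg_left A) \<and>
    (\<forall>c\<in>carrier C.
      tensor_assoc A C C C (tensor_map A C C (tensor A C C) C (comult C) (\<lambda>x. x) (comult C c)) =
        tensor_map A C C C (tensor A C C) (\<lambda>x. x) (comult C) (comult C c) \<and>
      tensor_lift A C C C (\<lambda>x y. counit C x \<odot>\<^bsub>C\<^esub> y) (comult C c) = c \<and>
      tensor_lift A C C C (\<lambda>x y. counit C y \<odot>\<^bsub>C\<^esub> x) (comult C c) = c)"

definition is_comodule ::
  "('a, 'x) ring_scheme \<Rightarrow> ('a, 'c) coalgebra \<Rightarrow> ('a, 'c, 'm, 'y) comodule_scheme \<Rightarrow> bool" where
  "is_comodule A C M \<longleftrightarrow>
    module A M \<and>
    coact M \<in> mod_hom A M (tensor A M C) \<and>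
    (\<forall>m\<in>carrier M.
      tensor_assoc A M C C (tensor_map A M C (tensor A M C) C (coact M) (\<lambda>x. x) (coact M m)) =
        tensor_map A M C M (tensor A C C) (\<lambda>x. x) (comult C) (coact M m) \<and>
      tensor_lift A M C M (\<lambda>x y. counit C y \<odot>\<^bsub>M\<^esub> x) (coact M m) = m)"

definition comod_hom ::
  "('a, 'x) ring_scheme \<Rightarrow> ('a, 'c) coalgebra \<Rightarrow>
    ('a, 'c, 'm, 'y) comodule_scheme \<Rightarrow> ('a, 'c, 'n, 'z) comodule_scheme \<Rightarrow> ('m \<Rightarrow> 'n) set" where
  "comod_hom A C M N = {f \<in> mod_hom A M N. \<forall>m\<in>carrier M.
    tensor_map A M C N C f (\<lambda>x. x) (coact M m) = coact N (f m)}"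

definition Hom_C ::
  "('a, 'x) ring_scheme \<Rightarrow> ('a, 'c) coalgebra \<Rightarrow>
    ('a, 'c, 'm, 'y) comodule_scheme \<Rightarrow> ('a, 'c, 'n, 'z) comodule_scheme \<Rightarrow> ('m \<Rightarrow> 'n) set" where
  "Hom_C A C M N = comod_hom A C M N \<inter> extensional (carrier M)"

text \<open>\<open>S\<close> as a left \<open>B\<close>-module.\<close>

definition B_mod :: "('a, 'b, 'c, 's) bicomodule \<Rightarrow> ('b, 's) module" where
  "B_mod S = with_action S (lact S)"

text \<open>Comodules \<open>S\<close> that are \<open>(B, A)\<close>-bimodules with left \<open>B\<close>-linear coaction and are finitely
  generated projective over \<open>A\<close>.\<close>

definition is_fgp_bicomodule ::
  "('a, 'x) ring_scheme \<Rightarrow> ('b, 'y) ring_scheme \<Rightarrow> ('a, 'c) coalgebra \<Rightarrow>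
    ('a, 'b, 'c, 's) bicomodule \<Rightarrow> bool" where
  "is_fgp_bicomodule A B C S \<longleftrightarrow>
    is_comodule A C S \<and> left_module B (B_mod S) \<and> fg_projective A S \<and>
    (\<forall>b\<in>carrier B. \<forall>u\<in>carrier S.
      (\<forall>a\<in>carrier A. lact S b (a \<odot>\<^bsub>S\<^esub> u) = a \<odot>\<^bsub>S\<^esub> lact S b u) \<and>
      coact S (lact S b u) = tensor_map A S C S C (lact S b) (\<lambda>x. x) (coact S u))"


section \<open>Dual rings, rational elements, coFrobenius coalgebras\<close>

definition dual :: "('a, 'x) ring_scheme \<Rightarrow> ('a, 'm, 'y) module_scheme \<Rightarrow> ('a, 'm \<Rightarrow> 'a) module" where
  "dual A M = with_action (fun_group (Hom A M (reg_left A)) (carrier M) A)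
    (\<lambda>a f. \<lambda>x\<in>carrier M. a \<otimes>\<^bsub>A\<^esub> f x)"

text \<open>The actions of \<open>\<^sup>*C\<close> on the right and of \<open>C\<^sup>*\<close> on the left of \<open>C\<close>:
  \<open>c \<cdot> f = c\<^sub>(\<^sub>1\<^sub>) f(c\<^sub>(\<^sub>2\<^sub>))\<close> and \<open>f \<cdot> c = f(c\<^sub>(\<^sub>1\<^sub>)) c\<^sub>(\<^sub>2\<^sub>)\<close>.\<close>

definition ract_C :: "('a, 'x) ring_scheme \<Rightarrow> ('a, 'c) coalgebra \<Rightarrow> ('c \<Rightarrow> 'a) \<Rightarrow> 'c \<Rightarrow> 'c" where
  "ract_C A C f c = tensor_lift A C C C (\<lambda>x y. f y \<odot>\<^bsub>C\<^esub> x) (comult C c)"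

definition lact_C :: "('a, 'x) ring_scheme \<Rightarrow> ('a, 'c) coalgebra \<Rightarrow> ('c \<Rightarrow> 'a) \<Rightarrow> 'c \<Rightarrow> 'c" where
  "lact_C A C f c = tensor_lift A C C C (\<lambda>x y. f x \<odot>\<^bsub>C\<^esub> y) (comult C c)"

text \<open>The rings \<open>\<^sup>*C\<close>, with \<open>(f # g)(c) = g(c\<^sub>(\<^sub>1\<^sub>) f(c\<^sub>(\<^sub>2\<^sub>)))\<close>, and \<open>C\<^sup>*\<close>, with
  \<open>(f # g)(c) = f(g(c\<^sub>(\<^sub>1\<^sub>)) c\<^sub>(\<^sub>2\<^sub>))\<close>. The records also carry the \<open>A\<close>-module structure; since \<open>C\<close>
  has coinciding left and right \<open>A\<close>-actions, so do the duals.\<close>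

definition ldual :: "('a, 'x) ring_scheme \<Rightarrow> ('a, 'c) coalgebra \<Rightarrow> ('a, 'c \<Rightarrow> 'a) module" where
  "ldual A C = (dual A C)
    \<lparr>monoid.mult := (\<lambda>f g. \<lambda>c\<in>carrier C. g (ract_C A C f c)),
     monoid.one := (\<lambda>c\<in>carrier C. counit C c)\<rparr>"

definition rdual :: "('a, 'x) ring_scheme \<Rightarrow> ('a, 'c) coalgebra \<Rightarrow> ('a, 'c \<Rightarrow> 'a) module" where
  "rdual A C = (dual A C)
    \<lparr>monoid.mult := (\<lambda>f g. \<lambda>c\<in>carrier C. f (lact_C A C g c)),
     monoid.one := (\<lambda>c\<in>carrier C. counit C c)\<rparr>"

definition locally_projective :: "('a, 'x) ring_scheme \<Rightarrow> ('a, 'm, 'y) module_scheme \<Rightarrow> bool" where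
  "locally_projective A M \<longleftrightarrow> (\<forall>D. finite D \<and> D \<subseteq> carrier M \<longrightarrow>
    (\<exists>(n::nat) \<phi> c. (\<forall>i<n. \<phi> i \<in> carrier (dual A M) \<and> c i \<in> carrier M) \<and>
      (\<forall>d\<in>D. d = (\<Oplus>\<^bsub>M\<^esub>i\<in>{..<n}. \<phi> i d \<odot>\<^bsub>M\<^esub> c i))))"

definition right_coFrobenius :: "('a, 'x) ring_scheme \<Rightarrow> ('a, 'c) coalgebra \<Rightarrow> bool" where
  "right_coFrobenius A C \<longleftrightarrow> locally_projective A C \<and>
    (\<exists>j. j \<in> mod_hom A C (ldual A C) \<and>
      j \<in> mod_hom (ldual A C) (with_action C (ract_C A C)) (reg_right (ldual A C)) \<and>
      inj_on j (carrier C))"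

definition left_coFrobenius :: "('a, 'x) ring_scheme \<Rightarrow> ('a, 'c) coalgebra \<Rightarrow> bool" where
  "left_coFrobenius A C \<longleftrightarrow> locally_projective A C \<and>
    (\<exists>j. j \<in> mod_hom A C (rdual A C) \<and>
      j \<in> mod_hom (rdual A C) (with_action C (lact_C A C)) (reg_left (rdual A C)) \<and>
      inj_on j (carrier C))"

definition rational :: "('a, 'x) ring_scheme \<Rightarrow> ('a, 'c) coalgebra \<Rightarrow> ('c \<Rightarrow> 'a) set" where
  "rational A C = {f \<in> carrier (ldual A C).
    \<exists>(n::nat) \<phi> c. (\<forall>i<n. \<phi> i \<in> carrier (ldual A C) \<and> c i \<in> carrier C) \<and>
      (\<forall>g\<in>carrier (ldual A C).
        f \<otimes>\<^bsub>ldual A C\<^esub> g = (\<Oplus>\<^bsub>ldual A C\<^esub>i\<in>{..<n}. g (c i) \<odot>\<^bsub>ldual A C\<^esub> \<phi> i))}"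

text \<open>\<open>(\<^sup>*C)\<^sup>r\<^sup>a\<^sup>t\<close> as a ring without unit: the field \<open>one\<close> of the record has no meaning.\<close>

definition rat_rng :: "('a, 'x) ring_scheme \<Rightarrow> ('a, 'c) coalgebra \<Rightarrow> ('a, 'c \<Rightarrow> 'a) module" where
  "rat_rng A C = (ldual A C)\<lparr>carrier := rational A C\<rparr>"

definition rational_dense :: "('a, 'x) ring_scheme \<Rightarrow> ('a, 'c) coalgebra \<Rightarrow> bool" where
  "rational_dense A C \<longleftrightarrow> (\<forall>f\<in>carrier (ldual A C). \<forall>D. finite D \<and> D \<subseteq> carrier C \<longrightarrow>
    (\<exists>g\<in>rational A C. \<forall>d\<in>D. g d = f d))"


section \<open>The Morita context of \<open>\<Sigma>\<close>\<close>

text \<open>\<open>T = End\<^sup>C(\<Sigma>)\<close>, and the canonical map \<open>B \<rightarrow> T\<close>.\<close>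

definition End_ring ::
  "('a, 'x) ring_scheme \<Rightarrow> ('a, 'c) coalgebra \<Rightarrow> ('a, 'b, 'c, 's) bicomodule \<Rightarrow> ('s \<Rightarrow> 's) ring" where
  "End_ring A C S = (fun_group (Hom_C A C S S) (carrier S) S)
    \<lparr>monoid.mult := (\<lambda>t t'. compose (carrier S) t t'), monoid.one := (\<lambda>u\<in>carrier S. u)\<rparr>"

definition l_map :: "('a, 'b, 'c, 's) bicomodule \<Rightarrow> 'b \<Rightarrow> 's \<Rightarrow> 's" where
  "l_map S b = (\<lambda>u\<in>carrier S. lact S b u)"

text \<open>\<open>\<Sigma>\<close> as a left \<open>T\<close>-module and as a right \<open>\<^sup>*C\<close>-module.\<close>

definition S_T :: "('a, 'b, 'c, 's) bicomodule \<Rightarrow> ('s \<Rightarrow> 's, 's) module" where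
  "S_T S = with_action S (\<lambda>t u. t u)"

definition S_ldual ::
  "('a, 'x) ring_scheme \<Rightarrow> ('a, 'c) coalgebra \<Rightarrow> ('a, 'b, 'c, 's) bicomodule \<Rightarrow> ('c \<Rightarrow> 'a, 's) module"
  where "S_ldual A C S =
    with_action S (\<lambda>f u. tensor_lift A S C S (\<lambda>v c. f c \<odot>\<^bsub>S\<^esub> v) (coact S u))"

text \<open>\<open>\<Sigma>\<^sup>*\<close> as a right \<open>B\<close>-module; its \<open>A\<close>-module structure is \<open>dual A S\<close>.\<close>

definition dual_B ::
  "('a, 'x) ring_scheme \<Rightarrow> ('a, 'b, 'c, 's) bicomodule \<Rightarrow> ('b, 's \<Rightarrow> 'a) module" where
  "dual_B A S = with_action (dual A S) (\<lambda>b f. \<lambda>u\<in>carrier S. f (lact S b u))"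

definition is_dual_basis ::
  "('a, 'x) ring_scheme \<Rightarrow> ('a, 's, 'y) module_scheme \<Rightarrow> nat \<times> (nat \<Rightarrow> 's) \<times> (nat \<Rightarrow> 's \<Rightarrow> 'a) \<Rightarrow> bool"
  where "is_dual_basis A S = (\<lambda>(n, e, f).
    (\<forall>i<n. e i \<in> carrier S \<and> f i \<in> carrier (dual A S)) \<and>
    (\<forall>u\<in>carrier S. u = (\<Oplus>\<^bsub>S\<^esub>i\<in>{..<n}. f i u \<odot>\<^bsub>S\<^esub> e i)))"

text \<open>The left coaction \<open>\<phi> \<mapsto> \<Sum> \<phi>(e\<^sub>i\<^sub>[\<^sub>0\<^sub>]) e\<^sub>i\<^sub>[\<^sub>1\<^sub>] \<otimes> f\<^sub>i\<close> of \<open>\<Sigma>\<^sup>*\<close>. It does not depend on the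
  dual basis; an arbitrary one is chosen.\<close>

definition dual_coact ::
  "('a, 'x) ring_scheme \<Rightarrow> ('a, 'c) coalgebra \<Rightarrow> ('a, 'b, 'c, 's) bicomodule \<Rightarrow>
    ('s \<Rightarrow> 'a) \<Rightarrow> ('c, 's \<Rightarrow> 'a) tens" where
  "dual_coact A C S \<phi> = (case (SOME d. is_dual_basis A S d) of (n, e, f) \<Rightarrow>
    \<Oplus>\<^bsub>tensor A C (dual A S)\<^esub>i\<in>{..<n}.
      pure A C (dual A S) (tensor_lift A S C C (\<lambda>v c. \<phi> v \<odot>\<^bsub>C\<^esub> c) (coact S (e i))) (f i))"

text \<open>\<open>Q = \<^sup>CHom(C, \<Sigma>\<^sup>*)\<close> with its left actions of \<open>A\<close> and \<open>\<^sup>*C\<close> and its right actions of \<open>B\<close>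
  and \<open>T\<close>.\<close>

definition Q_set ::
  "('a, 'x) ring_scheme \<Rightarrow> ('a, 'c) coalgebra \<Rightarrow> ('a, 'b, 'c, 's) bicomodule \<Rightarrow> ('c \<Rightarrow> 's \<Rightarrow> 'a) set" where
  "Q_set A C S = {q \<in> Hom A C (dual A S). \<forall>c\<in>carrier C.
    tensor_map A C C C (dual A S) (\<lambda>x. x) q (comult C c) = dual_coact A C S (q c)}"

definition Q_ab ::
  "('a, 'x) ring_scheme \<Rightarrow> ('a, 'c) coalgebra \<Rightarrow> ('a, 'b, 'c, 's) bicomodule \<Rightarrow> ('c \<Rightarrow> 's \<Rightarrow> 'a) ring" where
  "Q_ab A C S = fun_group (Q_set A C S) (carrier C) (dual A S)"

definition Q_A ::
  "('a, 'x) ring_scheme \<Rightarrow> ('a, 'c) coalgebra \<Rightarrow> ('a, 'b, 'c, 's) bicomodule \<Rightarrow>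
    ('a, 'c \<Rightarrow> 's \<Rightarrow> 'a) module" where
  "Q_A A C S = with_action (Q_ab A C S) (\<lambda>a q. \<lambda>c\<in>carrier C. q (a \<odot>\<^bsub>C\<^esub> c))"

definition Q_B ::
  "('a, 'x) ring_scheme \<Rightarrow> ('a, 'c) coalgebra \<Rightarrow> ('a, 'b, 'c, 's) bicomodule \<Rightarrow>
    ('b, 'c \<Rightarrow> 's \<Rightarrow> 'a) module" where
  "Q_B A C S = with_action (Q_ab A C S)
    (\<lambda>b q. \<lambda>c\<in>carrier C. \<lambda>u\<in>carrier S. q c (lact S b u))"

definition Q_ldual ::
  "('a, 'x) ring_scheme \<Rightarrow> ('a, 'c) coalgebra \<Rightarrow> ('a, 'b, 'c, 's) bicomodule \<Rightarrow>
    ('c \<Rightarrow> 'a, 'c \<Rightarrow> 's \<Rightarrow> 'a) module" where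
  "Q_ldual A C S = with_action (Q_ab A C S) (\<lambda>f q. \<lambda>c\<in>carrier C. q (ract_C A C f c))"

definition Q_T ::
  "('a, 'x) ring_scheme \<Rightarrow> ('a, 'c) coalgebra \<Rightarrow> ('a, 'b, 'c, 's) bicomodule \<Rightarrow>
    ('s \<Rightarrow> 's, 'c \<Rightarrow> 's \<Rightarrow> 'a) module" where
  "Q_T A C S = with_action (Q_ab A C S) (\<lambda>t q. \<lambda>c\<in>carrier C. compose (carrier S) (q c) t)"

text \<open>The connecting maps; \<open>\<tau>\<close> is parametrized by the ring \<open>R\<close> over which the tensor product is
  formed, namely \<open>\<^sup>*C\<close> or \<open>(\<^sup>*C)\<^sup>r\<^sup>a\<^sup>t\<close>.\<close>

definition mu ::
  "('a, 'x) ring_scheme \<Rightarrow> ('a, 'c) coalgebra \<Rightarrow> ('a, 'b, 'c, 's) bicomodule \<Rightarrow>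
    ('c \<Rightarrow> 's \<Rightarrow> 'a, 's) tens \<Rightarrow> 'c \<Rightarrow> 'a" where
  "mu A C S = tensor_lift (End_ring A C S) (Q_T A C S) (S_T S) (ldual A C)
    (\<lambda>q u. \<lambda>c\<in>carrier C. q c u)"

definition tau ::
  "('a, 'x) ring_scheme \<Rightarrow> ('a, 'c) coalgebra \<Rightarrow> ('a, 'b, 'c, 's) bicomodule \<Rightarrow>
    ('c \<Rightarrow> 'a, 'z) ring_scheme \<Rightarrow> ('s, 'c \<Rightarrow> 's \<Rightarrow> 'a) tens \<Rightarrow> 's \<Rightarrow> 's" where
  "tau A C S R = tensor_lift R (S_ldual A C S) (Q_ldual A C S) (End_ring A C S)
    (\<lambda>u q. \<lambda>v\<in>carrier S. tensor_lift A S C S (\<lambda>w c. q c v \<odot>\<^bsub>S\<^esub> w) (coact S u))"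

definition tau_surjective ::
  "('a, 'x) ring_scheme \<Rightarrow> ('a, 'c) coalgebra \<Rightarrow> ('a, 'b, 'c, 's) bicomodule \<Rightarrow> bool" where
  "tau_surjective A C S \<longleftrightarrow>
    tau A C S (ldual A C) ` carrier (tensor_ab (ldual A C) (S_ldual A C S) (Q_ldual A C S)) =
      carrier (End_ring A C S)"


section \<open>The structure theorem\<close>

definition can_iso ::
  "('a, 'x) ring_scheme \<Rightarrow> ('b, 'y) ring_scheme \<Rightarrow> ('a, 'c) coalgebra \<Rightarrow>
    ('a, 'b, 'c, 's) bicomodule \<Rightarrow> bool" where
  "can_iso A B C S \<longleftrightarrow>
    bij_betw (tensor_lift B (dual_B A S) (B_mod S) C
        (\<lambda>g u. tensor_lift A S C C (\<lambda>v c. g v \<odot>\<^bsub>C\<^esub> c) (coact S u)))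
      (carrier (tensor_ab B (dual_B A S) (B_mod S))) (carrier C)"

definition comod_generator ::
  "'u itself \<Rightarrow> ('a, 'x) ring_scheme \<Rightarrow> ('a, 'c) coalgebra \<Rightarrow> ('a, 'b, 'c, 's) bicomodule \<Rightarrow> bool" where
  "comod_generator U A C S \<longleftrightarrow> (\<forall>(M :: ('a, 'c, 'u) comodule) (N :: ('a, 'c, 'u) comodule).
    is_comodule A C M \<and> is_comodule A C N \<longrightarrow>
    (\<forall>f\<in>comod_hom A C M N. \<forall>g\<in>comod_hom A C M N. (\<exists>x\<in>carrier M. f x \<noteq> g x) \<longrightarrow>
      (\<exists>h\<in>comod_hom A C S M. \<exists>u\<in>carrier S. f (h u) \<noteq> g (h u))))"

text \<open>Epimorphisms of comodules are the surjective ones.\<close>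

definition comod_projective ::
  "'u itself \<Rightarrow> ('a, 'x) ring_scheme \<Rightarrow> ('a, 'c) coalgebra \<Rightarrow> ('a, 'b, 'c, 's) bicomodule \<Rightarrow> bool" where
  "comod_projective U A C S \<longleftrightarrow> (\<forall>(M :: ('a, 'c, 'u) comodule) (N :: ('a, 'c, 'u) comodule).
    is_comodule A C M \<and> is_comodule A C N \<longrightarrow>
    (\<forall>p\<in>comod_hom A C M N. p ` carrier M = carrier N \<longrightarrow>
      (\<forall>f\<in>comod_hom A C S N. \<exists>g\<in>comod_hom A C S M. \<forall>u\<in>carrier S. p (g u) = f u)))"

text \<open>The functors \<open>- \<otimes>\<^sub>B \<Sigma>\<close> and \<open>Hom\<^sup>C(\<Sigma>, -)\<close> on objects; the coaction on \<open>N \<otimes>\<^sub>B \<Sigma>\<close> is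
  \<open>n \<otimes> u \<mapsto> (n \<otimes> u\<^sub>[\<^sub>0\<^sub>]) \<otimes> u\<^sub>[\<^sub>1\<^sub>]\<close>.\<close>

definition induced_A ::
  "('b, 'y) ring_scheme \<Rightarrow> ('a, 'b, 'c, 's) bicomodule \<Rightarrow> ('b, 'n) module \<Rightarrow>
    ('a, ('n, 's) tens) module" where
  "induced_A B S N = with_action (tensor_ab B N (B_mod S))
    (\<lambda>a. tensor_map B N (B_mod S) N (B_mod S) (\<lambda>n. n) (\<lambda>u. a \<odot>\<^bsub>S\<^esub> u))"

definition induced_comod ::
  "('a, 'x) ring_scheme \<Rightarrow> ('b, 'y) ring_scheme \<Rightarrow> ('a, 'c) coalgebra \<Rightarrow>
    ('a, 'b, 'c, 's) bicomodule \<Rightarrow> ('b, 'n) module \<Rightarrow> ('a, 'c, ('n, 's) tens) comodule" where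
  "induced_comod A B C S N = (let E = induced_A B S N in
    \<lparr>carrier = carrier E, monoid.mult = monoid.mult E, monoid.one = monoid.one E,
     ring.zero = ring.zero E, ring.add = ring.add E,
     smult = smult E,
     coact = tensor_lift B N (B_mod S) (tensor A E C)
       (\<lambda>n u. tensor_lift A S C (tensor A E C)
         (\<lambda>v c. pure A E C (pure B N (B_mod S) n v) c) (coact S u))\<rparr>)"

definition Hom_C_B ::
  "('a, 'x) ring_scheme \<Rightarrow> ('a, 'c) coalgebra \<Rightarrow> ('a, 'b, 'c, 's) bicomodule \<Rightarrow>
    ('a, 'c, 'm) comodule \<Rightarrow> ('b, 's \<Rightarrow> 'm) module" where
  "Hom_C_B A C S M = with_action (fun_group (Hom_C A C S M) (carrier S) M)
    (\<lambda>b h. \<lambda>u\<in>carrier S. h (lact S b u))"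

definition unit_iso ::
  "('a, 'x) ring_scheme \<Rightarrow> ('b, 'y) ring_scheme \<Rightarrow> ('a, 'c) coalgebra \<Rightarrow>
    ('a, 'b, 'c, 's) bicomodule \<Rightarrow> ('b, 'n) module \<Rightarrow> bool" where
  "unit_iso A B C S N \<longleftrightarrow>
    bij_betw (\<lambda>n. \<lambda>u\<in>carrier S. pure B N (B_mod S) n u)
      (carrier N) (carrier (Hom_C_B A C S (induced_comod A B C S N)))"

definition eval_iso ::
  "('a, 'x) ring_scheme \<Rightarrow> ('b, 'y) ring_scheme \<Rightarrow> ('a, 'c) coalgebra \<Rightarrow>
    ('a, 'b, 'c, 's) bicomodule \<Rightarrow> ('a, 'c, 'm) comodule \<Rightarrow> bool" where
  "eval_iso A B C S M \<longleftrightarrow>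
    bij_betw (tensor_lift B (Hom_C_B A C S M) (B_mod S) M (\<lambda>h u. h u))
      (carrier (tensor_ab B (Hom_C_B A C S M) (B_mod S))) (carrier M)"

definition cond_i where
  "cond_i (U :: 'u itself) A B C S \<longleftrightarrow> can_iso A B C S \<and> faithfully_flat U B (B_mod S)"

definition cond_ii where
  "cond_ii (U :: 'u itself) A B C S \<longleftrightarrow> can_iso A B C S \<and> flat U B (B_mod S)"

definition cond_iii where
  "cond_iii (U :: 'u itself) A C S \<longleftrightarrow> comod_generator U A C S"

definition cond_iv where
  "cond_iv (U :: 'u itself) A C S \<longleftrightarrow> comod_projective U A C S \<and> comod_generator U A C S"

definition cond_v where
  "cond_v (U :: 'u itself) A C S \<longleftrightarrow> firm_progenerator U (rat_rng A C) (S_ldual A C S)"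

definition cond_vi where
  "cond_vi A C S \<longleftrightarrow>
    mu A C S ` carrier (tensor_ab (End_ring A C S) (Q_T A C S) (S_T S)) = rational A C"

definition cond_vii where
  "cond_vii A C S \<longleftrightarrow>
    bij_betw (mu A C S) (carrier (tensor_ab (End_ring A C S) (Q_T A C S) (S_T S)))
      (carrier (rat_rng A C)) \<and>
    bij_betw (tau A C S (rat_rng A C))
      (carrier (tensor_ab (rat_rng A C) (S_ldual A C S) (Q_ldual A C S)))
      (carrier (End_ring A C S))"

text \<open>An adjunction consists of inverse equivalences iff its unit and counit are isomorphisms.\<close>

definition cond_viii where
  "cond_viii (U :: 'u itself) A B C S \<longleftrightarrow>
    (\<forall>N :: ('b, 'u) module. right_module B N \<longrightarrow> unit_iso A B C S N) \<and>
    (\<forall>M :: ('a, 'c, 'u) comodule. is_comodule A C M \<longrightarrow> eval_iso A B C S M)"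

definition cond_ix where
  "cond_ix (U :: 'u itself) A B C S \<longleftrightarrow>
    (\<forall>M :: ('a, 'c, 'u) comodule. is_comodule A C M \<longrightarrow> eval_iso A B C S M)"

text \<open>The type over which the module-theoretic notions of the theorem quantify. It is infinite
  and contains the functions \<open>C \<rightarrow> A\<close>, \<open>\<Sigma> \<rightarrow> A\<close> and \<open>C \<rightarrow> \<Sigma> \<rightarrow> A\<close>, hence up to bijection all ideals
  and finitely generated modules of \<open>A\<close>, \<open>B\<close> and \<open>(\<^sup>*C)\<^sup>r\<^sup>a\<^sup>t\<close> and, for locally projective \<open>C\<close>, all
  finitely generated comodules. The properties above can be tested on these (Baer's criterion for
  injectivity, ideals for flatness, cyclic modules for cogenerators and faithful flatness,
  finitely generated objects and their unions for the rest), so they have their usual meaning.\<close>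

type_synonym ('a, 'b, 'c, 's) univ = "(nat \<times> 'a \<times> 'b \<times> 'c \<times> 's) set"


section \<open>Morphisms \<open>\<Sigma>\<^sup>* \<rightarrow> Q\<close>\<close>

text \<open>Homomorphisms of \<open>(A, B)\<close>-bimodules. Their monomorphisms and epimorphisms are the injective
  and the surjective ones.\<close>

definition bimod_homs ::
  "('a, 'x) ring_scheme \<Rightarrow> ('b, 'y) ring_scheme \<Rightarrow> ('a, 'c) coalgebra \<Rightarrow>
    ('a, 'b, 'c, 's) bicomodule \<Rightarrow> (('s \<Rightarrow> 'a) \<Rightarrow> 'c \<Rightarrow> 's \<Rightarrow> 'a) set" where
  "bimod_homs A B C S =
    mod_hom A (dual A S) (Q_A A C S) \<inter> mod_hom B (dual_B A S) (Q_B A C S)"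

end

theory Submission
  imports Defs
begin

text \<open>Write \<open>w\<^sub>\<phi>(u) = \<phi>(u\<^sub>[\<^sub>0\<^sub>]) u\<^sub>[\<^sub>1\<^sub>]\<close> for the matrix coefficients of \<open>\<Sigma>\<close> (\<open>coeff\<close> below). Evaluated at the
  elements \<open>u\<close> of \<open>\<Sigma>\<close>, colinearity of \<open>q : C \<rightarrow> \<Sigma>\<^sup>*\<close> reads
  \<open>c\<^sub>(\<^sub>1\<^sub>) q(c\<^sub>(\<^sub>2\<^sub>))(u) = w\<^bsub>q(c)\<^esub>(u)\<close> (\<open>Q_set_iff\<close>), because \<open>\<Sigma>\<close> has a dual basis. An \<open>A\<close>-linear map
  \<open>p : C \<rightarrow> \<^sup>*C\<close> is a bilinear form \<open>p(c)(d)\<close>, and exchanging the arguments turns right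
  \<open>\<^sup>*C\<close>-linear maps into left \<open>C\<^sup>*\<close>-linear ones and back (\<open>right_to_left_linear\<close>,
  \<open>left_to_right_linear\<close>). So being right or left coFrobenius means, for locally projective \<open>C\<close>, to
  have a right \<open>\<^sup>*C\<close>-linear \<open>p\<close> that is nondegenerate in its first or in its second argument.

  Each right \<open>\<^sup>*C\<close>-linear \<open>p\<close> gives the bimodule map \<open>\<phi> \<mapsto> (c \<mapsto> (u \<mapsto> p(w\<^sub>\<phi>(u))(c)))\<close> from
  \<open>\<Sigma>\<^sup>*\<close> to \<open>Q\<close> (\<open>coeff_map_bimod_hom\<close>). It is injective if \<open>p\<close> is, since \<open>\<phi>\<close> is the composite of
  \<open>w\<^sub>\<phi>\<close> and the counit. Suppose that \<open>p\<close> is nondegenerate in its second argument. As \<open>A\<close> is a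
  cogenerator, the functionals \<open>p(d)\<close> take the values of the counit on any finite set
  (\<open>counit_interpolation\<close>), so that \<open>c \<cdot> p(d) = c\<close> for all \<open>c\<close> in a given finite set, for some \<open>d\<close>
  (\<open>local_unit\<close>). For such \<open>c\<close> and \<open>d\<close>, linearity of \<open>p\<close> and colinearity of \<open>q \<in> Q\<close> show that the
  image of \<open>q(d)\<close> agrees with \<open>q\<close> at \<open>c\<close>. The values that a preimage of \<open>q\<close> must take on a
  submodule of \<open>\<Sigma>\<close> are therefore consistent, and injectivity of \<open>A\<close> extends them to an element of
  \<open>\<Sigma>\<^sup>*\<close> (\<open>coeff_map_surj\<close>).

  Conversely let \<open>can\<close> be an isomorphism and \<open>\<mu>\<close> surjective onto the rational functionals. A bimodule map \<open>J : \<Sigma>\<^sup>* \<rightarrow> Q\<close> yields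
  \<open>C \<cong> \<Sigma>\<^sup>* \<otimes>\<^sub>B \<Sigma> \<rightarrow> \<^sup>*C\<close>, a right \<open>\<^sup>*C\<close>-linear map \<open>p\<close> with \<open>p(w\<^sub>g(u))(c) = J(g)(c)(u)\<close>
  (\<open>bimod_hom_form\<close>). The elements of \<open>Q\<close> separate the points of \<open>C\<close>, because by
  the surjectivity of \<open>\<mu>\<close> they determine all rational functionals, which are dense (\<open>Q_separates\<close>). If \<open>J\<close> is onto, \<open>p\<close> is therefore nondegenerate in
  its second argument. If \<open>J\<close> is injective, so is \<open>p\<close>, by the identity
  \<open>J(q(c))(d) = q(d \<cdot> p(c))\<close> for \<open>q \<in> Q\<close>; it holds since \<open>J\<close> commutes with the endomorphisms
  \<open>\<tau>(u \<otimes> q)\<close> of \<open>\<Sigma>\<close>, which come from \<open>B\<close>.\<close>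

section \<open>Additive maps\<close>

text \<open>Additive maps between the carriers of two additively written groups.\<close>

definition add_homs :: "('m, 'x) ring_scheme \<Rightarrow> ('n, 'y) ring_scheme \<Rightarrow> ('m \<Rightarrow> 'n) set" where
  "add_homs M N = {h \<in> carrier M \<rightarrow> carrier N.
    \<forall>x\<in>carrier M. \<forall>y\<in>carrier M. h (x \<oplus>\<^bsub>M\<^esub> y) = h x \<oplus>\<^bsub>N\<^esub> h y}"

lemma add_homsI:
  assumes "\<And>x. x \<in> carrier M \<Longrightarrow> h x \<in> carrier N"
    and "\<And>x y. \<lbrakk>x \<in> carrier M; y \<in> carrier M\<rbrakk> \<Longrightarrow> h (x \<oplus>\<^bsub>M\<^esub> y) = h x \<oplus>\<^bsub>N\<^esub> h y"
  shows "h \<in> add_homs M N"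
  using assms by (auto simp: add_homs_def)

lemma add_homs_closed: "h \<in> add_homs M N \<Longrightarrow> x \<in> carrier M \<Longrightarrow> h x \<in> carrier N"
  by (auto simp: add_homs_def)

lemma add_homs_add:
  "\<lbrakk>h \<in> add_homs M N; x \<in> carrier M; y \<in> carrier M\<rbrakk> \<Longrightarrow> h (x \<oplus>\<^bsub>M\<^esub> y) = h x \<oplus>\<^bsub>N\<^esub> h y"
  by (auto simp: add_homs_def)

lemma mod_hom_add_homs: "f \<in> mod_hom R M N \<Longrightarrow> f \<in> add_homs M N"
  by (auto simp: mod_hom_def add_homs_def)

lemma mod_homI:
  assumes "\<And>x. x \<in> carrier M \<Longrightarrow> f x \<in> carrier N"
    and "\<And>x y. \<lbrakk>x \<in> carrier M; y \<in> carrier M\<rbrakk> \<Longrightarrow> f (x \<oplus>\<^bsub>M\<^esub> y) = f x \<oplus>\<^bsub>N\<^esub> f y"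
    and "\<And>r x. \<lbrakk>r \<in> carrier R; x \<in> carrier M\<rbrakk> \<Longrightarrow> f (r \<odot>\<^bsub>M\<^esub> x) = r \<odot>\<^bsub>N\<^esub> f x"
  shows "f \<in> mod_hom R M N"
  using assms by (auto simp: mod_hom_def)

lemma mod_homD:
  assumes "f \<in> mod_hom R M N"
  shows "x \<in> carrier M \<Longrightarrow> f x \<in> carrier N"
    and "\<lbrakk>x \<in> carrier M; y \<in> carrier M\<rbrakk> \<Longrightarrow> f (x \<oplus>\<^bsub>M\<^esub> y) = f x \<oplus>\<^bsub>N\<^esub> f y"
    and "\<lbrakk>r \<in> carrier R; x \<in> carrier M\<rbrakk> \<Longrightarrow> f (r \<odot>\<^bsub>M\<^esub> x) = r \<odot>\<^bsub>N\<^esub> f x"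
  using assms by (auto simp: mod_hom_def)

lemma add_homs_zero:
  assumes "abelian_group M" "abelian_group N" "h \<in> add_homs M N"
  shows "h \<zero>\<^bsub>M\<^esub> = \<zero>\<^bsub>N\<^esub>"
proof -
  interpret M: abelian_group M by fact
  interpret N: abelian_group N by fact
  have "h \<zero>\<^bsub>M\<^esub> \<oplus>\<^bsub>N\<^esub> h \<zero>\<^bsub>M\<^esub> = h \<zero>\<^bsub>M\<^esub>"
    using add_homs_add[OF assms(3) M.zero_closed M.zero_closed] by simp
  then show ?thesis
    using add_homs_closed[OF assms(3) M.zero_closed] by (simp add: N.add.r_cancel_one')
qed

lemma add_homs_neg:
  assumes "abelian_group M" "abelian_group N" "h \<in> add_homs M N" "x \<in> carrier M"
  shows "h (\<ominus>\<^bsub>M\<^esub> x) = \<ominus>\<^bsub>N\<^esub> h x"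
proof -
  interpret M: abelian_group M by fact
  interpret N: abelian_group N by fact
  have "h (\<ominus>\<^bsub>M\<^esub> x) \<oplus>\<^bsub>N\<^esub> h x = \<zero>\<^bsub>N\<^esub>"
    using add_homs_add[OF assms(3) M.a_inv_closed[OF assms(4)] assms(4)] add_homs_zero[OF assms(1-3)]
      M.l_neg[OF assms(4)] by simp
  then show ?thesis
    using N.minus_equality add_homs_closed[OF assms(3)] assms(4) M.a_inv_closed by metis
qed

lemma add_homs_compose:
  "\<lbrakk>h \<in> add_homs M N; k \<in> add_homs N P\<rbrakk> \<Longrightarrow> (\<lambda>x. k (h x)) \<in> add_homs M P"
  by (auto simp: add_homs_def Pi_def)

lemma add_homs_plus:
  assumes "abelian_group N" "h \<in> add_homs M N" "k \<in> add_homs M N"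
  shows "(\<lambda>x. h x \<oplus>\<^bsub>N\<^esub> k x) \<in> add_homs M N"
proof -
  interpret N: abelian_group N by fact
  show ?thesis
    using assms(2,3) by (intro add_homsI) (auto simp: add_homs_add add_homs_closed N.a_ac)
qed

lemma abelian_group_add_monoid: "abelian_group M \<longleftrightarrow> comm_group (add_monoid M)"
  using abelian_group.a_comm_group comm_group_abelian_groupI by blast

lemma with_action_simps [simp]:
  "carrier (with_action M act) = carrier M" "ring.add (with_action M act) = ring.add M"
  "ring.zero (with_action M act) = ring.zero M" "smult (with_action M act) = act"
  by (simp_all add: with_action_def)

lemma abelian_group_cong:
  assumes "abelian_group M" "carrier N = carrier M" "ring.add N = ring.add M" "ring.zero N = ring.zero M"
  shows "abelian_group N"
proof -
  interpret M: abelian_group M by fact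
  show ?thesis
  proof (rule abelian_groupI)
    fix x assume "x \<in> carrier N"
    then show "\<exists>y\<in>carrier N. y \<oplus>\<^bsub>N\<^esub> x = \<zero>\<^bsub>N\<^esub>"
      using M.l_neg[of x] M.a_inv_closed[of x] unfolding assms(2-4) by blast
  qed (simp_all add: assms(2-4) M.a_ac)
qed

lemma abelian_group_with_action [simp]: "abelian_group (with_action M act) = abelian_group M"
  by (auto intro: abelian_group_cong)

lemma a_inv_with_action [simp]: "a_inv (with_action M act) = a_inv M"
  by (rule ext) (simp add: a_inv_def m_inv_def)

lemma finsum_with_action [simp]: "finsum (with_action M act) = finsum M"
  by (intro ext) (simp add: finsum_def finprod_def)

lemma add_homs_with_action [simp]:
  "add_homs (with_action M act) N = add_homs M N" "add_homs M (with_action N act') = add_homs M N"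
  by (simp_all add: add_homs_def)


section \<open>Tensor products\<close>

text \<open>The additive extension of \<open>\<phi>\<close> to formal sums of pairs.\<close>

definition linear_ext :: "('p, 'w) ring_scheme \<Rightarrow> ('m \<Rightarrow> 'n \<Rightarrow> 'p) \<Rightarrow> ('m \<times> 'n \<Rightarrow>\<^sub>0 int) \<Rightarrow> 'p" where
  "linear_ext P \<phi> x =
    (\<Oplus>\<^bsub>P\<^esub>p\<in>Poly_Mapping.keys x. [Poly_Mapping.lookup x p] \<cdot>\<^bsub>P\<^esub> \<phi> (fst p) (snd p))"

text \<open>Biadditive maps \<open>\<phi>\<close> with \<open>\<phi>(mr, n) = \<phi>(m, rn)\<close>.\<close>

definition balanced ::
  "('r, 'x) ring_scheme \<Rightarrow> ('r, 'm, 'y) module_scheme \<Rightarrow> ('r, 'n, 'z) module_scheme \<Rightarrow>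
    ('p, 'w) ring_scheme \<Rightarrow> ('m \<Rightarrow> 'n \<Rightarrow> 'p) \<Rightarrow> bool" where
  "balanced R M N P \<phi> \<longleftrightarrow>
    (\<forall>n\<in>carrier N. (\<lambda>m. \<phi> m n) \<in> add_homs M P) \<and>
    (\<forall>m\<in>carrier M. \<phi> m \<in> add_homs N P) \<and>
    (\<forall>r\<in>carrier R. \<forall>m\<in>carrier M. \<forall>n\<in>carrier N. \<phi> (r \<odot>\<^bsub>M\<^esub> m) n = \<phi> m (r \<odot>\<^bsub>N\<^esub> n))"

lemma balancedI:
  assumes "\<And>m n. \<lbrakk>m \<in> carrier M; n \<in> carrier N\<rbrakk> \<Longrightarrow> \<phi> m n \<in> carrier P"
    and "\<And>m m' n. \<lbrakk>m \<in> carrier M; m' \<in> carrier M; n \<in> carrier N\<rbrakk> \<Longrightarrow>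
      \<phi> (m \<oplus>\<^bsub>M\<^esub> m') n = \<phi> m n \<oplus>\<^bsub>P\<^esub> \<phi> m' n"
    and "\<And>m n n'. \<lbrakk>m \<in> carrier M; n \<in> carrier N; n' \<in> carrier N\<rbrakk> \<Longrightarrow>
      \<phi> m (n \<oplus>\<^bsub>N\<^esub> n') = \<phi> m n \<oplus>\<^bsub>P\<^esub> \<phi> m n'"
    and "\<And>r m n. \<lbrakk>r \<in> carrier R; m \<in> carrier M; n \<in> carrier N\<rbrakk> \<Longrightarrow>
      \<phi> (r \<odot>\<^bsub>M\<^esub> m) n = \<phi> m (r \<odot>\<^bsub>N\<^esub> n)"
  shows "balanced R M N P \<phi>"
  using assms by (auto simp: balanced_def intro!: add_homsI)

lemma balancedD:
  assumes "balanced R M N P \<phi>"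
  shows "\<lbrakk>m \<in> carrier M; n \<in> carrier N\<rbrakk> \<Longrightarrow> \<phi> m n \<in> carrier P"
    and "\<lbrakk>m \<in> carrier M; m' \<in> carrier M; n \<in> carrier N\<rbrakk> \<Longrightarrow>
      \<phi> (m \<oplus>\<^bsub>M\<^esub> m') n = \<phi> m n \<oplus>\<^bsub>P\<^esub> \<phi> m' n"
    and "\<lbrakk>m \<in> carrier M; n \<in> carrier N; n' \<in> carrier N\<rbrakk> \<Longrightarrow>
      \<phi> m (n \<oplus>\<^bsub>N\<^esub> n') = \<phi> m n \<oplus>\<^bsub>P\<^esub> \<phi> m n'"
    and "\<lbrakk>r \<in> carrier R; m \<in> carrier M; n \<in> carrier N\<rbrakk> \<Longrightarrow>
      \<phi> (r \<odot>\<^bsub>M\<^esub> m) n = \<phi> m (r \<odot>\<^bsub>N\<^esub> n)"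
  using assms by (auto simp: balanced_def add_homs_def)

lemma linear_ext_superset:
  assumes "abelian_group P" "finite T" "Poly_Mapping.keys x \<subseteq> T"
    and "\<And>m n. (m, n) \<in> T \<Longrightarrow> \<phi> m n \<in> carrier P"
  shows "linear_ext P \<phi> x = (\<Oplus>\<^bsub>P\<^esub>p\<in>T. [Poly_Mapping.lookup x p] \<cdot>\<^bsub>P\<^esub> \<phi> (fst p) (snd p))"
proof -
  interpret P: abelian_group P by fact
  have "[Poly_Mapping.lookup x p] \<cdot>\<^bsub>P\<^esub> \<phi> (fst p) (snd p) = \<zero>\<^bsub>P\<^esub>" if "p \<in> T - Poly_Mapping.keys x" for p
    using that by (auto simp: in_keys_iff add_pow_def)
  then show ?thesis
    unfolding linear_ext_def using assms
    by (intro P.add.finprod_mono_neutral_cong_left) auto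
qed

lemma linear_ext_add:
  assumes "abelian_group P" and "\<And>m n. (m, n) \<in> S \<Longrightarrow> \<phi> m n \<in> carrier P"
    and "Poly_Mapping.keys x \<subseteq> S" "Poly_Mapping.keys y \<subseteq> S"
  shows "linear_ext P \<phi> (x + y) = linear_ext P \<phi> x \<oplus>\<^bsub>P\<^esub> linear_ext P \<phi> y"
proof -
  interpret P: abelian_group P by fact
  define T where "T = Poly_Mapping.keys x \<union> Poly_Mapping.keys y"
  have T: "finite T" "T \<subseteq> S" "Poly_Mapping.keys (x + y) \<subseteq> T"
    using assms keys_add[of x y] by (auto simp: T_def)
  have cl: "\<And>m n. (m, n) \<in> T \<Longrightarrow> \<phi> m n \<in> carrier P" using T assms by auto
  then have cl': "\<And>p. p \<in> T \<Longrightarrow> \<phi> (fst p) (snd p) \<in> carrier P" by auto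
  have "linear_ext P \<phi> (x + y) =
      (\<Oplus>\<^bsub>P\<^esub>p\<in>T. [(Poly_Mapping.lookup x p + Poly_Mapping.lookup y p)] \<cdot>\<^bsub>P\<^esub> \<phi> (fst p) (snd p))"
    using linear_ext_superset[OF assms(1) T(1,3), of \<phi>] cl by (simp add: lookup_add)
  also have "\<dots> = (\<Oplus>\<^bsub>P\<^esub>p\<in>T. ([Poly_Mapping.lookup x p] \<cdot>\<^bsub>P\<^esub> \<phi> (fst p) (snd p)) \<oplus>\<^bsub>P\<^esub>
      ([Poly_Mapping.lookup y p] \<cdot>\<^bsub>P\<^esub> \<phi> (fst p) (snd p)))"
    using cl' by (intro P.finsum_cong') (auto simp: P.add.int_pow_mult)
  also have "\<dots> = linear_ext P \<phi> x \<oplus>\<^bsub>P\<^esub> linear_ext P \<phi> y"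
    using linear_ext_superset[OF assms(1) T(1), of _ \<phi>] cl' cl
    by (subst P.finsum_addf) (auto simp: T_def)
  finally show ?thesis .
qed

lemma linear_ext_of:
  assumes "abelian_group P" "\<phi> m n \<in> carrier P"
  shows "linear_ext P \<phi> (frag_of (m, n)) = \<phi> m n"
proof -
  interpret P: abelian_group P by fact
  show ?thesis
    using P.finsum_singleton[of "(m, n)" "{(m, n)}" "\<lambda>p. \<phi> m n"] assms
    by (simp add: linear_ext_def)
qed

lemma linear_ext_closed:
  assumes "abelian_group P" and "\<And>m n. (m, n) \<in> S \<Longrightarrow> \<phi> m n \<in> carrier P"
    and "Poly_Mapping.keys x \<subseteq> S"
  shows "linear_ext P \<phi> x \<in> carrier P"
proof -
  interpret P: abelian_group P by fact
  have cl: "\<And>p. p \<in> Poly_Mapping.keys x \<Longrightarrow> \<phi> (fst p) (snd p) \<in> carrier P" using assms by auto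
  then show ?thesis unfolding linear_ext_def
    by (intro P.finsum_closed) auto
qed

lemma linear_ext_diff:
  assumes "abelian_group P" and "\<And>m n. (m, n) \<in> S \<Longrightarrow> \<phi> m n \<in> carrier P"
    and "Poly_Mapping.keys x \<subseteq> S" "Poly_Mapping.keys y \<subseteq> S"
  shows "linear_ext P \<phi> (x - y) = linear_ext P \<phi> x \<ominus>\<^bsub>P\<^esub> linear_ext P \<phi> y"
proof -
  interpret P: abelian_group P by fact
  have k: "Poly_Mapping.keys (x - y) \<subseteq> S" using assms keys_diff[of x y] by auto
  have "linear_ext P \<phi> x = linear_ext P \<phi> (x - y) \<oplus>\<^bsub>P\<^esub> linear_ext P \<phi> y"
    using linear_ext_add[OF assms(1,2) k assms(4)] by simp
  then show ?thesis
    using linear_ext_closed[OF assms(1,2) k] linear_ext_closed[OF assms(1,2) assms(4)]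
    by (simp add: P.minus_eq P.a_assoc P.r_neg)
qed

lemma linear_ext_neg:
  assumes "abelian_group P" and "\<And>m n. (m, n) \<in> S \<Longrightarrow> \<phi> m n \<in> carrier P"
    and "Poly_Mapping.keys y \<subseteq> S"
  shows "linear_ext P \<phi> (- y) = \<ominus>\<^bsub>P\<^esub> linear_ext P \<phi> y"
proof -
  interpret P: abelian_group P by fact
  have "linear_ext P \<phi> 0 = \<zero>\<^bsub>P\<^esub>" by (simp add: linear_ext_def)
  then show ?thesis
    using linear_ext_diff[OF assms(1,2), where ?x = 0 and ?y = y] assms(3)
      linear_ext_closed[OF assms(1,2,3)] by (simp add: P.minus_eq)
qed

text \<open>The construction of the tensor product only needs sums and multiples to stay in the
  carriers.\<close>

locale tensor_pair =
  fixes R :: "('r, 'x) ring_scheme" and M :: "('r, 'm, 'y) module_scheme"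
    and N :: "('r, 'n, 'z) module_scheme"
  assumes add_M: "\<lbrakk>m \<in> carrier M; m' \<in> carrier M\<rbrakk> \<Longrightarrow> m \<oplus>\<^bsub>M\<^esub> m' \<in> carrier M"
    and add_N: "\<lbrakk>n \<in> carrier N; n' \<in> carrier N\<rbrakk> \<Longrightarrow> n \<oplus>\<^bsub>N\<^esub> n' \<in> carrier N"
    and act_M: "\<lbrakk>r \<in> carrier R; m \<in> carrier M\<rbrakk> \<Longrightarrow> r \<odot>\<^bsub>M\<^esub> m \<in> carrier M"
    and act_N: "\<lbrakk>r \<in> carrier R; n \<in> carrier N\<rbrakk> \<Longrightarrow> r \<odot>\<^bsub>N\<^esub> n \<in> carrier N"
begin

abbreviation "G \<equiv> free_Abelian_group (carrier M \<times> carrier N)"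
abbreviation "K \<equiv> tensor_kernel R M N"

lemma tensor_rels_cases:
  assumes "x \<in> tensor_rels R M N"
  obtains
    (left) m m' n where "x = frag_of (m \<oplus>\<^bsub>M\<^esub> m', n) - frag_of (m, n) - frag_of (m', n)"
      "m \<in> carrier M" "m' \<in> carrier M" "n \<in> carrier N"
  | (right) m n n' where "x = frag_of (m, n \<oplus>\<^bsub>N\<^esub> n') - frag_of (m, n) - frag_of (m, n')"
      "m \<in> carrier M" "n \<in> carrier N" "n' \<in> carrier N"
  | (act) r m n where "x = frag_of (r \<odot>\<^bsub>M\<^esub> m, n) - frag_of (m, r \<odot>\<^bsub>N\<^esub> n)"
      "r \<in> carrier R" "m \<in> carrier M" "n \<in> carrier N"
  using assms unfolding tensor_rels_def by blast

lemma keys_diff_subset: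
  fixes x y :: "'k \<Rightarrow>\<^sub>0 int"
  shows "\<lbrakk>Poly_Mapping.keys x \<subseteq> X; Poly_Mapping.keys y \<subseteq> X\<rbrakk> \<Longrightarrow> Poly_Mapping.keys (x - y) \<subseteq> X"
  using keys_diff[of x y] by blast

lemma tensor_rels_carrier: "tensor_rels R M N \<subseteq> carrier G"
proof
  fix x assume "x \<in> tensor_rels R M N"
  then have "Poly_Mapping.keys x \<subseteq> carrier M \<times> carrier N"
  proof (cases rule: tensor_rels_cases)
    case left
    then show ?thesis using add_M by (simp add: keys_diff_subset)
  next
    case right
    then show ?thesis using add_N by (simp add: keys_diff_subset)
  next
    case act
    then show ?thesis using act_M act_N by (simp add: keys_diff_subset)
  qed
  then show "x \<in> carrier G" by simp
qed

lemma comm_group_G: "comm_group G"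
  by (rule abelian_free_Abelian_group)

lemma subgroup_K: "subgroup K G"
  unfolding tensor_kernel_def using tensor_rels_carrier
  by (intro group.generate_is_subgroup) auto

lemma normal_K: "K \<lhd> G"
  using comm_group.subgroup_imp_normal[OF comm_group_G subgroup_K] .

lemma carrier_tensor_ab: "carrier (tensor_ab R M N) = (\<lambda>x. K #>\<^bsub>G\<^esub> x) ` carrier G"
  by (simp add: tensor_ab_def tensor_quot_def carrier_FactGroup)

lemma abelian_group_tensor_ab: "abelian_group (tensor_ab R M N)"
proof -
  have "add_monoid (tensor_ab R M N) = tensor_quot R M N"
    by (simp add: tensor_ab_def)
  then show ?thesis
    using comm_group.abelian_FactGroup[OF comm_group_G subgroup_K]
    by (simp add: abelian_group_add_monoid tensor_quot_def)
qed

lemma coset_add: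
  "\<lbrakk>x \<in> carrier G; y \<in> carrier G\<rbrakk> \<Longrightarrow>
    (K #>\<^bsub>G\<^esub> x) \<oplus>\<^bsub>tensor_ab R M N\<^esub> (K #>\<^bsub>G\<^esub> y) = K #>\<^bsub>G\<^esub> (x + y)"
  using normal.rcos_sum[OF normal_K, of x y] by (simp add: tensor_ab_def tensor_quot_def)

lemma coset_eq:
  assumes "x \<in> carrier G" "y \<in> carrier G" "x - y \<in> K"
  shows "K #>\<^bsub>G\<^esub> x = K #>\<^bsub>G\<^esub> y"
proof -
  have "x \<in> K #>\<^bsub>G\<^esub> y"
    using assms(3) by (force simp: r_coset_def)
  then show ?thesis
    using group.repr_independence[OF group_free_Abelian_group _ assms(2) subgroup_K] by metis
qed

lemma pure_closed: "\<lbrakk>m \<in> carrier M; n \<in> carrier N\<rbrakk> \<Longrightarrow> pure R M N m n \<in> carrier (tensor_ab R M N)"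
  by (auto simp: carrier_tensor_ab pure_def)

lemma balanced_pure: "balanced R M N (tensor_ab R M N) (pure R M N)"
proof -
  have incl: "x \<in> K" if "x \<in> tensor_rels R M N" for x
    unfolding tensor_kernel_def by (rule generate.incl[OF that])
  have add: "Poly_Mapping.keys (frag_of p + frag_of q) \<subseteq> X" if "p \<in> X" "q \<in> X"
    for p q :: "'m \<times> 'n" and X
    using keys_add[of "frag_of p" "frag_of q"] that by auto
  show ?thesis
  proof (rule balancedI)
    fix m m' n assume *: "m \<in> carrier M" "m' \<in> carrier M" "n \<in> carrier N"
    have "K #>\<^bsub>G\<^esub> frag_of (m \<oplus>\<^bsub>M\<^esub> m', n) = K #>\<^bsub>G\<^esub> (frag_of (m, n) + frag_of (m', n))"
      using * add_M by (intro coset_eq incl) (auto simp: tensor_rels_def algebra_simps intro!: add del: subsetI)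
    then show "pure R M N (m \<oplus>\<^bsub>M\<^esub> m') n = pure R M N m n \<oplus>\<^bsub>tensor_ab R M N\<^esub> pure R M N m' n"
      using * coset_add by (simp add: pure_def)
  next
    fix m n n' assume *: "m \<in> carrier M" "n \<in> carrier N" "n' \<in> carrier N"
    have "K #>\<^bsub>G\<^esub> frag_of (m, n \<oplus>\<^bsub>N\<^esub> n') = K #>\<^bsub>G\<^esub> (frag_of (m, n) + frag_of (m, n'))"
      using * add_N by (intro coset_eq incl) (auto simp: tensor_rels_def algebra_simps intro!: add del: subsetI)
    then show "pure R M N m (n \<oplus>\<^bsub>N\<^esub> n') = pure R M N m n \<oplus>\<^bsub>tensor_ab R M N\<^esub> pure R M N m n'"
      using * coset_add by (simp add: pure_def)
  next
    fix r m n assume *: "r \<in> carrier R" "m \<in> carrier M" "n \<in> carrier N"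
    show "pure R M N (r \<odot>\<^bsub>M\<^esub> m) n = pure R M N m (r \<odot>\<^bsub>N\<^esub> n)"
      unfolding pure_def using * act_M act_N
      by (intro coset_eq incl) (auto simp: tensor_rels_def)
  qed (rule pure_closed)
qed

lemmas pure_add_l = balancedD(2)[OF balanced_pure]
  and pure_add_r = balancedD(3)[OF balanced_pure]
  and pure_act = balancedD(4)[OF balanced_pure]

lemma tensor_induct [consumes 1, case_names pure zero neg add]:
  assumes "t \<in> carrier (tensor_ab R M N)"
    and pure: "\<And>m n. \<lbrakk>m \<in> carrier M; n \<in> carrier N\<rbrakk> \<Longrightarrow> P (pure R M N m n)"
    and zero: "P \<zero>\<^bsub>tensor_ab R M N\<^esub>"
    and neg: "\<And>t. \<lbrakk>t \<in> carrier (tensor_ab R M N); P t\<rbrakk> \<Longrightarrow> P (\<ominus>\<^bsub>tensor_ab R M N\<^esub> t)"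
    and add: "\<And>s t. \<lbrakk>s \<in> carrier (tensor_ab R M N); t \<in> carrier (tensor_ab R M N); P s; P t\<rbrakk> \<Longrightarrow>
      P (s \<oplus>\<^bsub>tensor_ab R M N\<^esub> t)"
  shows "P t"
proof -
  interpret T: abelian_group "tensor_ab R M N" by (rule abelian_group_tensor_ab)
  have q_in: "K #>\<^bsub>G\<^esub> x \<in> carrier (tensor_ab R M N)" if "Poly_Mapping.keys x \<subseteq> carrier M \<times> carrier N" for x
    using that by (auto simp: carrier_tensor_ab)
  have zero_eq: "K #>\<^bsub>G\<^esub> 0 = \<zero>\<^bsub>tensor_ab R M N\<^esub>"
    using group.coset_mult_one[OF group_free_Abelian_group, of K "carrier M \<times> carrier N"]
      subgroup.subset[OF subgroup_K]
    by (simp add: tensor_ab_def tensor_quot_def)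
  have "P (K #>\<^bsub>G\<^esub> x)" if "Poly_Mapping.keys x \<subseteq> carrier M \<times> carrier N" for x
    using that
  proof (induction x rule: free_Abelian_group_induct[where S = "carrier M \<times> carrier N"])
    case 1
    then show ?case using that by simp
  next
    case 2
    then show ?case using zero zero_eq by simp
  next
    case (3 x y)
    have y': "Poly_Mapping.keys (- y) \<subseteq> carrier M \<times> carrier N" using 3 by simp
    have "(K #>\<^bsub>G\<^esub> (- y)) \<oplus>\<^bsub>tensor_ab R M N\<^esub> (K #>\<^bsub>G\<^esub> y) = \<zero>\<^bsub>tensor_ab R M N\<^esub>"
      using coset_add[of "- y" y] 3 y' zero_eq by simp
    then have "K #>\<^bsub>G\<^esub> (- y) = \<ominus>\<^bsub>tensor_ab R M N\<^esub> (K #>\<^bsub>G\<^esub> y)"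
      using T.minus_equality q_in 3 y' by metis
    then have "P (K #>\<^bsub>G\<^esub> (- y))" using neg q_in 3 by simp
    then have "P ((K #>\<^bsub>G\<^esub> x) \<oplus>\<^bsub>tensor_ab R M N\<^esub> (K #>\<^bsub>G\<^esub> (- y)))"
      using add q_in 3 y' by simp
    then show ?case using coset_add[of x "- y"] 3 y' by simp
  next
    case (4 a)
    then show ?case using pure by (auto simp: pure_def)
  qed
  then show ?thesis using assms(1) by (auto simp: carrier_tensor_ab)
qed

lemma linear_ext_kernel:
  assumes P: "abelian_group P" and \<phi>: "balanced R M N P \<phi>" and x: "x \<in> K"
  shows "linear_ext P \<phi> x = \<zero>\<^bsub>P\<^esub>"
proof -
  interpret P: abelian_group P by fact
  have cl: "\<phi> m n \<in> carrier P" if "(m, n) \<in> carrier M \<times> carrier N" for m n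
    using balancedD(1)[OF \<phi>, of m n] that by simp
  have sub: "Poly_Mapping.keys y \<subseteq> carrier M \<times> carrier N" if "y \<in> K" for y
    using subsetD[OF subgroup.subset[OF subgroup_K] that] by simp
  have sub_eq: "linear_ext P \<phi> (y - z) = linear_ext P \<phi> y \<ominus>\<^bsub>P\<^esub> linear_ext P \<phi> z"
    if "Poly_Mapping.keys y \<subseteq> carrier M \<times> carrier N" "Poly_Mapping.keys z \<subseteq> carrier M \<times> carrier N" for y z
    by (rule linear_ext_diff[where S = "carrier M \<times> carrier N" and \<phi> = \<phi>, OF P cl that])
  have rel: "linear_ext P \<phi> y = \<zero>\<^bsub>P\<^esub>" if "y \<in> tensor_rels R M N" for y
  proof -
    from that show ?thesis
    proof (cases rule: tensor_rels_cases)
      case (left m m' n)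
      have "linear_ext P \<phi> y = \<phi> (m \<oplus>\<^bsub>M\<^esub> m') n \<ominus>\<^bsub>P\<^esub> \<phi> m n \<ominus>\<^bsub>P\<^esub> \<phi> m' n"
        unfolding left(1) using left(2-) cl add_M
        by (simp add: sub_eq keys_diff_subset linear_ext_of[OF P])
      then show ?thesis using left(2-) balancedD(1,2)[OF \<phi>]
        by (simp add: P.minus_eq P.a_ac P.r_neg P.r_neg1 P.r_neg2)
    next
      case (right m n n')
      have "linear_ext P \<phi> y = \<phi> m (n \<oplus>\<^bsub>N\<^esub> n') \<ominus>\<^bsub>P\<^esub> \<phi> m n \<ominus>\<^bsub>P\<^esub> \<phi> m n'"
        unfolding right(1) using right(2-) cl add_N
        by (simp add: sub_eq keys_diff_subset linear_ext_of[OF P])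
      then show ?thesis using right(2-) balancedD(1,3)[OF \<phi>]
        by (simp add: P.minus_eq P.a_ac P.r_neg P.r_neg1 P.r_neg2)
    next
      case (act r m n)
      have "linear_ext P \<phi> y = \<phi> (r \<odot>\<^bsub>M\<^esub> m) n \<ominus>\<^bsub>P\<^esub> \<phi> m (r \<odot>\<^bsub>N\<^esub> n)"
        unfolding act(1) using act(2-) cl act_M act_N
        by (simp add: sub_eq keys_diff_subset linear_ext_of[OF P])
      then show ?thesis using act(2-) balancedD(1,4)[OF \<phi>] act_N
        by (simp add: P.minus_eq P.r_neg)
    qed
  qed
  have "x \<in> K \<and> linear_ext P \<phi> x = \<zero>\<^bsub>P\<^esub>"
    using x unfolding tensor_kernel_def
  proof (induction rule: generate.induct)
    case one
    then show ?case by (auto simp: linear_ext_def intro: generate.one[of G, simplified])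
  next
    case (incl h)
    then show ?case using rel generate.incl by metis
  next
    case (inv h)
    have "h \<in> K" unfolding tensor_kernel_def using inv by (rule generate.incl)
    then show ?case
      using rel[OF inv] linear_ext_neg[where S = "carrier M \<times> carrier N" and \<phi> = \<phi>, OF P cl, of h] sub[of h] generate.inv[OF inv, of G] by simp
  next
    case (eng h1 h2)
    then show ?case
      using linear_ext_add[where S = "carrier M \<times> carrier N" and \<phi> = \<phi>, OF P cl, of h1 h2] sub[of h1] sub[of h2]
        generate.eng[of h1 G "tensor_rels R M N" h2]
      by (simp add: tensor_kernel_def)
  qed
  then show ?thesis ..
qed

lemma tensor_lift_coset:
  assumes P: "abelian_group P" and \<phi>: "balanced R M N P \<phi>" and x: "x \<in> carrier G"
  shows "tensor_lift R M N P \<phi> (K #>\<^bsub>G\<^esub> x) = linear_ext P \<phi> x"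
proof -
  interpret P: abelian_group P by fact
  have cl: "\<phi> m n \<in> carrier P" if "(m, n) \<in> carrier M \<times> carrier N" for m n
    using balancedD(1)[OF \<phi>, of m n] that by simp
  have k0: "linear_ext P \<phi> (k + x) = linear_ext P \<phi> x" if "k \<in> K" for k
    using linear_ext_add[where S = "carrier M \<times> carrier N" and \<phi> = \<phi>, OF P cl, of k x] linear_ext_kernel[OF P \<phi> that] x that
      subgroup.subset[OF subgroup_K] linear_ext_closed[where S = "carrier M \<times> carrier N" and \<phi> = \<phi>, OF P cl, of x]
    by auto
  have "linear_ext P \<phi> ` (K #>\<^bsub>G\<^esub> x) = {linear_ext P \<phi> x}"
    using k0 subgroup.one_closed[OF subgroup_K] by (force simp: r_coset_def)
  moreover have "tensor_lift R M N P \<phi> (K #>\<^bsub>G\<^esub> x) = the_elem (linear_ext P \<phi> ` (K #>\<^bsub>G\<^esub> x))"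
    unfolding tensor_lift_def linear_ext_def ..
  ultimately show ?thesis by simp
qed

lemma tensor_lift_pure:
  assumes "abelian_group P" "balanced R M N P \<phi>" "m \<in> carrier M" "n \<in> carrier N"
  shows "tensor_lift R M N P \<phi> (pure R M N m n) = \<phi> m n"
  using tensor_lift_coset[OF assms(1,2), of "frag_of (m, n)"] assms(3,4)
    linear_ext_of[where \<phi> = \<phi>, OF assms(1) balancedD(1)[OF assms(2-4)]]
  by (simp add: pure_def)

lemma tensor_lift_hom:
  assumes P: "abelian_group P" and \<phi>: "balanced R M N P \<phi>"
  shows "tensor_lift R M N P \<phi> \<in> add_homs (tensor_ab R M N) P"
proof (rule add_homsI)
  have cl: "\<phi> m n \<in> carrier P" if "(m, n) \<in> carrier M \<times> carrier N" for m n
    using balancedD(1)[OF \<phi>, of m n] that by simp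
  fix s assume s: "s \<in> carrier (tensor_ab R M N)"
  then obtain x where x: "x \<in> carrier G" "s = K #>\<^bsub>G\<^esub> x" by (auto simp: carrier_tensor_ab)
  then show "tensor_lift R M N P \<phi> s \<in> carrier P"
    using tensor_lift_coset[OF P \<phi>] linear_ext_closed[where S = "carrier M \<times> carrier N" and \<phi> = \<phi>, OF P cl, of x] by auto
  fix t assume t: "t \<in> carrier (tensor_ab R M N)"
  then obtain y where y: "y \<in> carrier G" "t = K #>\<^bsub>G\<^esub> y" by (auto simp: carrier_tensor_ab)
  have xy: "x + y \<in> carrier G" using x y keys_add[of x y] by auto
  show "tensor_lift R M N P \<phi> (s \<oplus>\<^bsub>tensor_ab R M N\<^esub> t) =
      tensor_lift R M N P \<phi> s \<oplus>\<^bsub>P\<^esub> tensor_lift R M N P \<phi> t"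
    using x y xy tensor_lift_coset[OF P \<phi>] linear_ext_add[where S = "carrier M \<times> carrier N" and \<phi> = \<phi>, OF P cl, of x y] coset_add[of x y] by auto
qed

text \<open>Additive maps on a tensor product that agree on the pure tensors are equal.\<close>

lemma add_homs_eqI:
  assumes P: "abelian_group P"
    and h: "h \<in> add_homs (tensor_ab R M N) P" "k \<in> add_homs (tensor_ab R M N) P"
    and eq: "\<And>m n. \<lbrakk>m \<in> carrier M; n \<in> carrier N\<rbrakk> \<Longrightarrow> h (pure R M N m n) = k (pure R M N m n)"
    and t: "t \<in> carrier (tensor_ab R M N)"
  shows "h t = k t"
proof -
  note T = abelian_group_tensor_ab
  from t show ?thesis
    by (induction rule: tensor_induct)
      (simp_all add: eq add_homs_zero[OF T P] add_homs_neg[OF T P] h add_homs_add[OF h(1)] add_homs_add[OF h(2)])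
qed

end

text \<open>Carriers that are closed under sums and multiples.\<close>

definition closed_mod :: "('r, 'x) ring_scheme \<Rightarrow> ('r, 'm, 'y) module_scheme \<Rightarrow> bool" where
  "closed_mod R M \<longleftrightarrow> (\<forall>m\<in>carrier M. \<forall>m'\<in>carrier M. m \<oplus>\<^bsub>M\<^esub> m' \<in> carrier M) \<and>
    (\<forall>r\<in>carrier R. \<forall>m\<in>carrier M. r \<odot>\<^bsub>M\<^esub> m \<in> carrier M)"

lemma tensor_pairI: "\<lbrakk>closed_mod R M; closed_mod R N\<rbrakk> \<Longrightarrow> tensor_pair R M N"
  by (simp add: closed_mod_def tensor_pair_def)

lemma closed_mod_module: "module A M \<Longrightarrow> closed_mod A M"
  by (simp add: closed_mod_def module.smult_closed module.axioms(2) abelian_group.axioms(1)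
      abelian_monoid.a_closed)

lemma module_abelian_group: "module A M \<Longrightarrow> abelian_group M"
  by (rule module.axioms(2))

lemma balanced_cong:
  assumes "closed_mod R M" "closed_mod R N"
    and "\<And>m n. \<lbrakk>m \<in> carrier M; n \<in> carrier N\<rbrakk> \<Longrightarrow> \<phi> m n = \<psi> m n"
  shows "balanced R M N P \<phi> \<longleftrightarrow> balanced R M N P \<psi>"
  using assms by (simp add: balanced_def add_homs_def closed_mod_def Pi_def)

lemma tensor_lift_cong:
  assumes cl: "closed_mod R M" "closed_mod R N" and P: "abelian_group P"
    and \<phi>: "balanced R M N P \<phi>"
    and eq: "\<And>m n. \<lbrakk>m \<in> carrier M; n \<in> carrier N\<rbrakk> \<Longrightarrow> \<phi> m n = \<psi> m n"
    and t: "t \<in> carrier (tensor_ab R M N)"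
  shows "tensor_lift R M N P \<phi> t = tensor_lift R M N P \<psi> t"
proof -
  interpret T: tensor_pair R M N using tensor_pairI[OF cl] .
  have \<psi>: "balanced R M N P \<psi>" using balanced_cong[where \<phi> = \<phi> and \<psi> = \<psi>, OF cl eq] \<phi> by blast
  show ?thesis
    using T.tensor_lift_pure[OF P] \<phi> \<psi> eq
    by (intro T.add_homs_eqI[OF P T.tensor_lift_hom[OF P \<phi>] T.tensor_lift_hom[OF P \<psi>] _ t]) simp
qed

lemma balanced_compose:
  assumes "balanced R M N P \<phi>" "h \<in> add_homs P P'"
  shows "balanced R M N P' (\<lambda>m n. h (\<phi> m n))"
  using balancedD[OF assms(1)] assms(2)
  by (intro balancedI) (auto simp: add_homs_closed add_homs_add)

lemma add_homs_tensor_lift: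
  assumes cl: "closed_mod R M" "closed_mod R N" and P: "abelian_group P" "abelian_group P'"
    and \<phi>: "balanced R M N P \<phi>" and h: "h \<in> add_homs P P'"
    and t: "t \<in> carrier (tensor_ab R M N)"
  shows "h (tensor_lift R M N P \<phi> t) = tensor_lift R M N P' (\<lambda>m n. h (\<phi> m n)) t"
proof -
  interpret T: tensor_pair R M N using tensor_pairI[OF cl] .
  note \<psi> = balanced_compose[OF \<phi> h]
  show ?thesis
    using T.tensor_lift_pure[OF P(1) \<phi>] T.tensor_lift_pure[OF P(2) \<psi>]
    by (intro T.add_homs_eqI[OF P(2) add_homs_compose[OF T.tensor_lift_hom[OF P(1) \<phi>] h]
          T.tensor_lift_hom[OF P(2) \<psi>] _ t]) simp
qed

lemma balanced_plus:
  assumes P: "abelian_group P" and "balanced R M N P \<phi>" "balanced R M N P \<psi>"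
  shows "balanced R M N P (\<lambda>m n. \<phi> m n \<oplus>\<^bsub>P\<^esub> \<psi> m n)"
proof -
  interpret P: abelian_group P by fact
  show ?thesis
    using balancedD[OF assms(2)] balancedD[OF assms(3)]
    by (intro balancedI) (auto simp: P.a_ac)
qed

lemma tensor_lift_plus:
  assumes cl: "closed_mod R M" "closed_mod R N" and P: "abelian_group P"
    and \<phi>: "balanced R M N P \<phi>" and \<psi>: "balanced R M N P \<psi>"
    and t: "t \<in> carrier (tensor_ab R M N)"
  shows "tensor_lift R M N P (\<lambda>m n. \<phi> m n \<oplus>\<^bsub>P\<^esub> \<psi> m n) t =
    tensor_lift R M N P \<phi> t \<oplus>\<^bsub>P\<^esub> tensor_lift R M N P \<psi> t"
proof -
  interpret T: tensor_pair R M N using tensor_pairI[OF cl] .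
  note \<chi> = balanced_plus[OF P \<phi> \<psi>]
  show ?thesis
    using T.tensor_lift_pure[OF P \<phi>] T.tensor_lift_pure[OF P \<psi>] T.tensor_lift_pure[OF P \<chi>]
    by (intro T.add_homs_eqI[OF P T.tensor_lift_hom[OF P \<chi>]
          add_homs_plus[OF P T.tensor_lift_hom[OF P \<phi>] T.tensor_lift_hom[OF P \<psi>]] _ t]) simp
qed

lemma balanced_map:
  assumes "closed_mod R M'" "closed_mod R N'"
    and f: "f \<in> mod_hom R M M'" and g: "g \<in> mod_hom R N N'" and \<phi>: "balanced R M' N' P \<phi>"
  shows "balanced R M N P (\<lambda>m n. \<phi> (f m) (g n))"
  using balancedD[OF \<phi>] mod_homD[OF f] mod_homD[OF g] by (intro balancedI) auto

lemma tensor_map_hom: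
  assumes cl: "closed_mod R M" "closed_mod R N" "closed_mod R M'" "closed_mod R N'"
    and f: "f \<in> mod_hom R M M'" and g: "g \<in> mod_hom R N N'"
  shows "tensor_map R M N M' N' f g \<in> add_homs (tensor_ab R M N) (tensor_ab R M' N')"
proof -
  interpret T: tensor_pair R M N using tensor_pairI[OF cl(1,2)] .
  interpret T': tensor_pair R M' N' using tensor_pairI[OF cl(3,4)] .
  show ?thesis
    unfolding tensor_map_def
    using T.tensor_lift_hom[OF T'.abelian_group_tensor_ab balanced_map[OF cl(3,4) f g T'.balanced_pure]] .
qed

lemma tensor_map_pure:
  assumes cl: "closed_mod R M" "closed_mod R N" "closed_mod R M'" "closed_mod R N'"
    and f: "f \<in> mod_hom R M M'" and g: "g \<in> mod_hom R N N'"
    and mn: "m \<in> carrier M" "n \<in> carrier N"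
  shows "tensor_map R M N M' N' f g (pure R M N m n) = pure R M' N' (f m) (g n)"
proof -
  interpret T: tensor_pair R M N using tensor_pairI[OF cl(1,2)] .
  interpret T': tensor_pair R M' N' using tensor_pairI[OF cl(3,4)] .
  show ?thesis
    unfolding tensor_map_def
    using T.tensor_lift_pure[OF T'.abelian_group_tensor_ab
        balanced_map[OF cl(3,4) f g T'.balanced_pure] mn] .
qed

lemma tensor_lift_map:
  assumes cl: "closed_mod R M" "closed_mod R N" "closed_mod R M'" "closed_mod R N'"
    and f: "f \<in> mod_hom R M M'" and g: "g \<in> mod_hom R N N'"
    and P: "abelian_group P" and \<phi>: "balanced R M' N' P \<phi>"
    and t: "t \<in> carrier (tensor_ab R M N)"
  shows "tensor_lift R M' N' P \<phi> (tensor_map R M N M' N' f g t) =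
    tensor_lift R M N P (\<lambda>m n. \<phi> (f m) (g n)) t"
proof -
  interpret T: tensor_pair R M N using tensor_pairI[OF cl(1,2)] .
  interpret T': tensor_pair R M' N' using tensor_pairI[OF cl(3,4)] .
  note \<psi> = balanced_map[OF cl(3,4) f g \<phi>]
  show ?thesis
    using T'.tensor_lift_pure[OF P \<phi>] T.tensor_lift_pure[OF P \<psi>] tensor_map_pure[OF cl f g]
      mod_homD(1)[OF f] mod_homD(1)[OF g]
    by (intro T.add_homs_eqI[OF P add_homs_compose[OF tensor_map_hom[OF cl f g]
            T'.tensor_lift_hom[OF P \<phi>]] T.tensor_lift_hom[OF P \<psi>] _ t]) simp
qed

lemma carrier_tensor [simp]: "carrier (tensor A M N) = carrier (tensor_ab A M N)"
  and add_tensor [simp]: "ring.add (tensor A M N) = ring.add (tensor_ab A M N)"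
  and zero_tensor [simp]: "ring.zero (tensor A M N) = ring.zero (tensor_ab A M N)"
  and finsum_tensor [simp]: "finsum (tensor A M N) = finsum (tensor_ab A M N)"
  and add_homs_tensor [simp]: "add_homs (tensor A M N) P = add_homs (tensor_ab A M N) P"
    "add_homs P (tensor A M N) = add_homs P (tensor_ab A M N)"
  and abelian_group_tensor [simp]: "abelian_group (tensor A M N) = abelian_group (tensor_ab A M N)"
  by (simp_all add: tensor_def)

lemma id_mod_hom [simp]: "(\<lambda>x. x) \<in> mod_hom R M M"
  by (simp add: mod_hom_def)

lemma smult_mod_hom:
  assumes "module A M" "a \<in> carrier A"
  shows "(\<lambda>m. a \<odot>\<^bsub>M\<^esub> m) \<in> mod_hom A M M"
proof -
  interpret module A M by fact
  show ?thesis
    using assms(2)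
    by (intro mod_homI) (auto simp: smult_r_distr smult_assoc1[symmetric] R.m_comm)
qed

context
  fixes A :: "('a, 'x) ring_scheme" and M :: "('a, 'm, 'y) module_scheme"
    and N :: "('a, 'n, 'z) module_scheme"
  assumes M: "module A M" and N: "closed_mod A N"
begin

lemma tensor_smult_pure:
  assumes "a \<in> carrier A" "m \<in> carrier M" "n \<in> carrier N"
  shows "a \<odot>\<^bsub>tensor A M N\<^esub> pure A M N m n = pure A M N (a \<odot>\<^bsub>M\<^esub> m) n"
  unfolding tensor_def using assms
  by (simp add: tensor_map_pure[OF closed_mod_module[OF M] N closed_mod_module[OF M] N smult_mod_hom[OF M] id_mod_hom])

lemma tensor_smult_hom:
  assumes "a \<in> carrier A"
  shows "(\<lambda>t. a \<odot>\<^bsub>tensor A M N\<^esub> t) \<in> add_homs (tensor_ab A M N) (tensor_ab A M N)"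
  unfolding tensor_def using assms
  by (simp add: tensor_map_hom[OF closed_mod_module[OF M] N closed_mod_module[OF M] N smult_mod_hom[OF M] id_mod_hom])

text \<open>Maps out of the tensor product that come from maps that are linear in the first argument.\<close>

lemma tensor_lift_mod_hom:
  assumes P: "module A P" and \<phi>: "balanced A M N P \<phi>"
    and lin: "\<And>a m n. \<lbrakk>a \<in> carrier A; m \<in> carrier M; n \<in> carrier N\<rbrakk> \<Longrightarrow>
      \<phi> (a \<odot>\<^bsub>M\<^esub> m) n = a \<odot>\<^bsub>P\<^esub> \<phi> m n"
  shows "tensor_lift A M N P \<phi> \<in> mod_hom A (tensor A M N) P"
proof -
  interpret T: tensor_pair A M N using tensor_pairI[OF closed_mod_module[OF M] N] .
  note P' = module_abelian_group[OF P]
  note h = T.tensor_lift_hom[OF P' \<phi>]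
  have "tensor_lift A M N P \<phi> (a \<odot>\<^bsub>tensor A M N\<^esub> t) = a \<odot>\<^bsub>P\<^esub> tensor_lift A M N P \<phi> t"
    if a: "a \<in> carrier A" and t: "t \<in> carrier (tensor_ab A M N)" for a t
  proof (rule T.add_homs_eqI[where h = "\<lambda>t. tensor_lift A M N P \<phi> (a \<odot>\<^bsub>tensor A M N\<^esub> t)"
        and k = "\<lambda>t. a \<odot>\<^bsub>P\<^esub> tensor_lift A M N P \<phi> t", OF P' _ _ _ t])
    show "(\<lambda>t. tensor_lift A M N P \<phi> (a \<odot>\<^bsub>tensor A M N\<^esub> t)) \<in> add_homs (tensor_ab A M N) P"
      by (rule add_homs_compose[OF tensor_smult_hom[OF a] h])
    show "(\<lambda>t. a \<odot>\<^bsub>P\<^esub> tensor_lift A M N P \<phi> t) \<in> add_homs (tensor_ab A M N) P"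
      by (rule add_homs_compose[OF h mod_hom_add_homs[OF smult_mod_hom[OF P a]]])
    show "tensor_lift A M N P \<phi> (a \<odot>\<^bsub>tensor A M N\<^esub> pure A M N m n) =
        a \<odot>\<^bsub>P\<^esub> tensor_lift A M N P \<phi> (pure A M N m n)" if "m \<in> carrier M" "n \<in> carrier N" for m n
      using that a by (simp add: tensor_smult_pure T.tensor_lift_pure[OF P' \<phi>] module.smult_closed[OF M] lin)
  qed
  then show ?thesis
    using h by (intro mod_homI) (simp_all add: add_homs_closed add_homs_add)
qed

end


section \<open>Groups of functions and duals\<close>

lemma fun_group_simps [simp]:
  "carrier (fun_group E D N) = E" "ring.zero (fun_group E D N) = (\<lambda>x\<in>D. \<zero>\<^bsub>N\<^esub>)"
  "ring.add (fun_group E D N) = (\<lambda>f g. \<lambda>x\<in>D. f x \<oplus>\<^bsub>N\<^esub> g x)"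
  by (simp_all add: fun_group_def)

lemma fun_group_abelian:
  assumes N: "abelian_group N" and E: "E \<subseteq> D \<rightarrow>\<^sub>E carrier N"
    and zero: "(\<lambda>x\<in>D. \<zero>\<^bsub>N\<^esub>) \<in> E"
    and add: "\<And>f g. \<lbrakk>f \<in> E; g \<in> E\<rbrakk> \<Longrightarrow> (\<lambda>x\<in>D. f x \<oplus>\<^bsub>N\<^esub> g x) \<in> E"
    and neg: "\<And>f. f \<in> E \<Longrightarrow> (\<lambda>x\<in>D. \<ominus>\<^bsub>N\<^esub> f x) \<in> E"
  shows "abelian_group (fun_group E D N)"
proof -
  interpret N: abelian_group N by fact
  have cl: "f x \<in> carrier N" if "f \<in> E" "x \<in> D" for f x using E that by auto
  have r: "(\<lambda>x\<in>D. f x) = f" if "f \<in> E" for f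
    using E that by (auto simp: PiE_def extensional_restrict)
  have r': "restrict f D = restrict g D" if "\<And>x. x \<in> D \<Longrightarrow> f x = g x" for f g
    using that by (rule restrict_ext)
  show ?thesis
  proof (rule abelian_groupI)
    fix f assume f: "f \<in> carrier (fun_group E D N)"
    then have fE: "f \<in> E" by simp
    show "\<zero>\<^bsub>fun_group E D N\<^esub> \<oplus>\<^bsub>fun_group E D N\<^esub> f = f"
      using r'[of "\<lambda>x. \<zero>\<^bsub>N\<^esub> \<oplus>\<^bsub>N\<^esub> f x" f] cl fE r[OF fE] by (simp cong: restrict_cong)
    show "\<exists>g\<in>carrier (fun_group E D N). g \<oplus>\<^bsub>fun_group E D N\<^esub> f = \<zero>\<^bsub>fun_group E D N\<^esub>"
      using neg[OF fE] cl[OF fE]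
      by (intro bexI[of _ "\<lambda>x\<in>D. \<ominus>\<^bsub>N\<^esub> f x"]) (auto simp: N.l_neg cong: restrict_cong)
  qed (use add zero cl in \<open>auto simp: N.a_ac cong: restrict_cong\<close>)
qed

lemma reg_left_simps [simp]:
  "carrier (reg_left R) = carrier R" "ring.add (reg_left R) = ring.add R"
  "ring.zero (reg_left R) = ring.zero R" "smult (reg_left R) = monoid.mult R"
  "a_inv (reg_left R) = a_inv R" "abelian_group (reg_left R) = abelian_group R"
  "finsum (reg_left R) = finsum R" "add_homs M (reg_left R) = add_homs M R"
  by (simp_all add: reg_left_def)

lemma reg_right_simps [simp]:
  "carrier (reg_right R) = carrier R" "ring.add (reg_right R) = ring.add R"
  "ring.zero (reg_right R) = ring.zero R" "smult (reg_right R) = (\<lambda>r x. x \<otimes>\<^bsub>R\<^esub> r)"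
  by (simp_all add: reg_right_def)

lemma module_reg_left:
  assumes "cring A"
  shows "module A (reg_left A)"
proof -
  interpret cring A by fact
  show ?thesis
    by (rule moduleI) (simp_all add: assms is_abelian_group l_distr r_distr m_assoc)
qed

lemma dual_simps [simp]:
  "carrier (dual A M) = Hom A M (reg_left A)"
  "ring.add (dual A M) = (\<lambda>f g. \<lambda>x\<in>carrier M. f x \<oplus>\<^bsub>A\<^esub> g x)"
  "ring.zero (dual A M) = (\<lambda>x\<in>carrier M. \<zero>\<^bsub>A\<^esub>)"
  "smult (dual A M) = (\<lambda>a f. \<lambda>x\<in>carrier M. a \<otimes>\<^bsub>A\<^esub> f x)"
  by (simp_all add: dual_def)

lemma HomI:
  assumes "\<And>x. x \<in> carrier M \<Longrightarrow> f x \<in> carrier N"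
    and "\<And>x y. \<lbrakk>x \<in> carrier M; y \<in> carrier M\<rbrakk> \<Longrightarrow> f (x \<oplus>\<^bsub>M\<^esub> y) = f x \<oplus>\<^bsub>N\<^esub> f y"
    and "\<And>r x. \<lbrakk>r \<in> carrier R; x \<in> carrier M\<rbrakk> \<Longrightarrow> f (r \<odot>\<^bsub>M\<^esub> x) = r \<odot>\<^bsub>N\<^esub> f x"
    and "f \<in> extensional (carrier M)"
  shows "f \<in> Hom R M N"
  using assms by (auto simp: Hom_def intro!: mod_homI)

lemma Hom_restrictI:
  assumes "closed_mod R M" "f \<in> mod_hom R M N"
  shows "(\<lambda>x\<in>carrier M. f x) \<in> Hom R M N"
  using assms mod_homD[OF assms(2)] by (intro HomI) (auto simp: closed_mod_def)

lemma HomD: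
  assumes "f \<in> Hom R M N"
  shows "x \<in> carrier M \<Longrightarrow> f x \<in> carrier N"
    and "\<lbrakk>x \<in> carrier M; y \<in> carrier M\<rbrakk> \<Longrightarrow> f (x \<oplus>\<^bsub>M\<^esub> y) = f x \<oplus>\<^bsub>N\<^esub> f y"
    and "\<lbrakk>r \<in> carrier R; x \<in> carrier M\<rbrakk> \<Longrightarrow> f (r \<odot>\<^bsub>M\<^esub> x) = r \<odot>\<^bsub>N\<^esub> f x"
    and "f \<in> extensional (carrier M)" and "f \<in> mod_hom R M N"
  using assms by (auto simp: Hom_def mod_hom_def)

lemma Hom_eqI:
  assumes "f \<in> Hom R M N" "g \<in> Hom R M N" "\<And>x. x \<in> carrier M \<Longrightarrow> f x = g x"
  shows "f = g"
  using assms by (auto simp: Hom_def intro: extensionalityI)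

lemma module_dual:
  assumes M: "module A M"
  shows "module A (dual A M)"
proof -
  interpret module A M by fact
  note cM = closed_mod_module[OF M]
  have ab: "abelian_group (dual A M)"
    unfolding dual_def abelian_group_with_action
  proof (rule fun_group_abelian)
    show "abelian_group A" by (rule R.is_abelian_group)
    show "Hom A M (reg_left A) \<subseteq> carrier M \<rightarrow>\<^sub>E carrier A"
      by (auto simp: Hom_def mod_hom_def PiE_def)
    show "(\<lambda>x\<in>carrier M. \<zero>\<^bsub>A\<^esub>) \<in> Hom A M (reg_left A)"
      by (rule HomI) auto
    show "(\<lambda>x\<in>carrier M. f x \<oplus>\<^bsub>A\<^esub> g x) \<in> Hom A M (reg_left A)"
      if "f \<in> Hom A M (reg_left A)" "g \<in> Hom A M (reg_left A)" for f g
      using HomD[OF that(1)] HomD[OF that(2)]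
      by (intro HomI) (auto simp: R.a_ac R.r_distr)
    show "(\<lambda>x\<in>carrier M. \<ominus>\<^bsub>A\<^esub> f x) \<in> Hom A M (reg_left A)"
      if "f \<in> Hom A M (reg_left A)" for f
      using HomD[OF that]
      by (intro HomI) (auto simp: R.minus_add R.r_minus)
  qed
  show ?thesis
  proof (rule moduleI[OF R.is_cring ab])
    fix a f assume af: "a \<in> carrier A" "f \<in> carrier (dual A M)"
    then show "a \<odot>\<^bsub>dual A M\<^esub> f \<in> carrier (dual A M)"
      using HomD[of f A M "reg_left A"]
      by (auto intro!: HomI simp: R.r_distr R.m_lcomm)
  next
    fix f assume f: "f \<in> carrier (dual A M)"
    then have "(\<lambda>x\<in>carrier M. f x) = f" by (auto simp: Hom_def extensional_restrict)
    then show "\<one>\<^bsub>A\<^esub> \<odot>\<^bsub>dual A M\<^esub> f = f"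
      using HomD(1)[of f A M "reg_left A"] f by (simp cong: restrict_cong)
  qed (auto simp: R.l_distr R.r_distr R.m_assoc HomD(1)[where N = "reg_left A", simplified] intro!: restrict_ext)
qed

lemma eval_add_homs: "x \<in> carrier M \<Longrightarrow> (\<lambda>f. f x) \<in> add_homs (dual A M) A"
  by (intro add_homsI) (auto dest: HomD(1))

lemma add_homs_finsum:
  assumes "abelian_group M" "abelian_group N" "h \<in> add_homs M N"
    and "finite I" "\<And>i. i \<in> I \<Longrightarrow> f i \<in> carrier M"
  shows "h (finsum M f I) = finsum N (\<lambda>i. h (f i)) I"
proof -
  interpret M: abelian_group M by fact
  interpret N: abelian_group N by fact
  show ?thesis
    using assms(4,5)
  proof (induction I rule: finite_induct)
    case empty
    then show ?case using add_homs_zero[OF assms(1-3)] by simp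
  next
    case (insert i I)
    then have "h (f i) \<in> carrier N" "(\<lambda>i. h (f i)) \<in> I \<rightarrow> carrier N" "f \<in> I \<rightarrow> carrier M"
      using add_homs_closed[OF assms(3)] by auto
    then show ?case
      using insert add_homs_add[OF assms(3)] by simp
  qed
qed

lemma add_homs_sum:
  assumes N: "abelian_group N" and "finite I" "\<And>i. i \<in> I \<Longrightarrow> h i \<in> add_homs M N"
  shows "(\<lambda>x. finsum N (\<lambda>i. h i x) I) \<in> add_homs M N"
proof -
  interpret N: abelian_group N by fact
  have cl: "(\<lambda>i. h i x) \<in> I \<rightarrow> carrier N" if "x \<in> carrier M" for x
    using add_homs_closed[OF assms(3) that] by blast
  show ?thesis
  proof (rule add_homsI)
    fix x y assume xy: "x \<in> carrier M" "y \<in> carrier M"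
    have "finsum N (\<lambda>i. h i (x \<oplus>\<^bsub>M\<^esub> y)) I = finsum N (\<lambda>i. h i x \<oplus>\<^bsub>N\<^esub> h i y) I"
      using cl[OF xy(1)] cl[OF xy(2)] assms(3) xy
      by (intro N.finsum_cong') (auto simp: add_homs_add Pi_def)
    then show "finsum N (\<lambda>i. h i (x \<oplus>\<^bsub>M\<^esub> y)) I = finsum N (\<lambda>i. h i x) I \<oplus>\<^bsub>N\<^esub> finsum N (\<lambda>i. h i y) I"
      using N.finsum_addf[OF cl[OF xy(1)] cl[OF xy(2)]] by simp
  qed (use cl in \<open>auto intro!: N.finsum_closed\<close>)
qed

section \<open>Injectivity and the cogenerator property\<close>

text \<open>The image of a module under a map \<open>K\<close> that need not be a homomorphism, but that is
  compatible with sums and multiples. For injective \<open>K\<close> this moves the module to another type; if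
  \<open>K\<close> identifies elements modulo a submodule, the image is the quotient.\<close>

definition image_module :: "('r, 'm, 'y) module_scheme \<Rightarrow> ('m \<Rightarrow> 'u) \<Rightarrow> ('r, 'u) module" where
  "image_module M K = \<lparr>carrier = K ` carrier M, monoid.mult = undefined, monoid.one = undefined,
     ring.zero = K \<zero>\<^bsub>M\<^esub>,
     ring.add = (\<lambda>X Y. K (inv_into (carrier M) K X \<oplus>\<^bsub>M\<^esub> inv_into (carrier M) K Y)),
     smult = (\<lambda>r X. K (r \<odot>\<^bsub>M\<^esub> inv_into (carrier M) K X))\<rparr>"

lemma image_module:
  assumes M: "module A M"
    and add: "\<And>x x' y y'. \<lbrakk>x \<in> carrier M; x' \<in> carrier M; y \<in> carrier M; y' \<in> carrier M;
      K x = K x'; K y = K y'\<rbrakk> \<Longrightarrow> K (x \<oplus>\<^bsub>M\<^esub> y) = K (x' \<oplus>\<^bsub>M\<^esub> y')"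
    and act: "\<And>a x x'. \<lbrakk>a \<in> carrier A; x \<in> carrier M; x' \<in> carrier M; K x = K x'\<rbrakk> \<Longrightarrow>
      K (a \<odot>\<^bsub>M\<^esub> x) = K (a \<odot>\<^bsub>M\<^esub> x')"
  shows "module A (image_module M K)" and "K \<in> mod_hom A M (image_module M K)"
proof -
  interpret module A M by fact
  let ?N = "image_module M K"
  have inv: "inv_into (carrier M) K (K x) \<in> carrier M" "K (inv_into (carrier M) K (K x)) = K x"
    if "x \<in> carrier M" for x
    using that by (auto intro: inv_into_into f_inv_into_f)
  have N_carrier: "carrier ?N = K ` carrier M" and N_zero: "\<zero>\<^bsub>?N\<^esub> = K \<zero>\<^bsub>M\<^esub>"
    by (simp_all add: image_module_def)
  have N_add: "K x \<oplus>\<^bsub>?N\<^esub> K y = K (x \<oplus>\<^bsub>M\<^esub> y)" if "x \<in> carrier M" "y \<in> carrier M" for x y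
    using add[OF inv(1)[OF that(1)] that(1) inv(1)[OF that(2)] that(2) inv(2)[OF that(1)] inv(2)[OF that(2)]]
    by (simp add: image_module_def)
  have N_act: "a \<odot>\<^bsub>?N\<^esub> K x = K (a \<odot>\<^bsub>M\<^esub> x)" if "a \<in> carrier A" "x \<in> carrier M" for a x
    using act[OF that(1) inv(1)[OF that(2)] that(2) inv(2)[OF that(2)]] by (simp add: image_module_def)
  show "K \<in> mod_hom A M ?N"
    by (intro mod_homI) (simp_all add: N_carrier N_add N_act)
  have ab: "abelian_group ?N"
  proof (rule abelian_groupI)
    fix X assume "X \<in> carrier ?N"
    then obtain x where x: "x \<in> carrier M" "X = K x" by (auto simp: N_carrier)
    then show "\<exists>Y\<in>carrier ?N. Y \<oplus>\<^bsub>?N\<^esub> X = \<zero>\<^bsub>?N\<^esub>"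
      by (intro bexI[of _ "K (\<ominus>\<^bsub>M\<^esub> x)"]) (auto simp: N_carrier N_zero N_add M.l_neg)
  qed (auto simp: N_carrier N_zero N_add M.a_ac)
  show "module A ?N"
    by (rule moduleI[OF R.is_cring ab])
      (auto simp: N_carrier N_add N_act smult_l_distr smult_r_distr smult_assoc1)
qed

lemma module_right_module:
  assumes "module A M"
  shows "right_module A M"
proof -
  interpret module A M by fact
  show ?thesis
    by unfold_locales (auto simp: smult_l_distr smult_r_distr smult_assoc1[symmetric] R.m_comm)
qed

lemma mod_hom_reg_right:
  assumes "cring A"
  shows "mod_hom A M (reg_right A) = mod_hom A M (reg_left A)"
proof -
  interpret cring A by fact
  have "(\<forall>r\<in>carrier A. \<forall>x\<in>carrier M. f (r \<odot>\<^bsub>M\<^esub> x) = f x \<otimes>\<^bsub>A\<^esub> r) \<longleftrightarrow>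
      (\<forall>r\<in>carrier A. \<forall>x\<in>carrier M. f (r \<odot>\<^bsub>M\<^esub> x) = r \<otimes>\<^bsub>A\<^esub> f x)"
    if "f \<in> carrier M \<rightarrow> carrier A" for f
    using that by (auto simp: m_comm Pi_def)
  then show ?thesis by (auto simp: mod_hom_def)
qed

lemma mod_hom_compose:
  assumes "f \<in> mod_hom R M N" "g \<in> mod_hom R N P"
  shows "(\<lambda>x. g (f x)) \<in> mod_hom R M P"
  using mod_homD[OF assms(1)] mod_homD[OF assms(2)] by (intro mod_homI) auto

lemma mod_hom_zero:
  assumes "module A M" "module A N" "f \<in> mod_hom A M N"
  shows "f \<zero>\<^bsub>M\<^esub> = \<zero>\<^bsub>N\<^esub>"
  using add_homs_zero[OF module_abelian_group[OF assms(1)] module_abelian_group[OF assms(2)]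
      mod_hom_add_homs[OF assms(3)]] .

lemma submodule_image:
  assumes M: "module A M" and N: "module A N" and f: "f \<in> mod_hom A M N"
  shows "submodule (f ` carrier M) A N"
proof -
  interpret M: module A M by fact
  interpret N: module A N by fact
  note fD = mod_homD[OF f]
  show ?thesis
  proof (rule N.submoduleI)
    show "\<zero>\<^bsub>N\<^esub> \<in> f ` carrier M"
      by (rule image_eqI[of _ _ "\<zero>\<^bsub>M\<^esub>"]) (simp_all add: mod_hom_zero[OF M N f])
  next
    fix y assume "y \<in> f ` carrier M"
    then obtain x where x: "x \<in> carrier M" "y = f x" by blast
    show "\<ominus>\<^bsub>N\<^esub> y \<in> f ` carrier M"
      by (rule image_eqI[of _ _ "\<ominus>\<^bsub>M\<^esub> x"])
        (use x add_homs_neg[OF M.M.abelian_group_axioms N.M.abelian_group_axioms mod_hom_add_homs[OF f] x(1)] in simp_all)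
    show "a \<odot>\<^bsub>N\<^esub> y \<in> f ` carrier M" if "a \<in> carrier A" for a
      by (rule image_eqI[of _ _ "a \<odot>\<^bsub>M\<^esub> x"]) (use x that fD(3) in simp_all)
    fix y' assume "y' \<in> f ` carrier M"
    then obtain x' where x': "x' \<in> carrier M" "y' = f x'" by blast
    show "y \<oplus>\<^bsub>N\<^esub> y' \<in> f ` carrier M"
      by (rule image_eqI[of _ _ "x \<oplus>\<^bsub>M\<^esub> x'"]) (use x x' fD(2) in simp_all)
  qed (use fD(1) in auto)
qed

text \<open>The map \<open>e\<close> embeds \<open>M\<close> in the type over which injectivity quantifies.\<close>

lemma injective_extend:
  fixes e :: "'m \<Rightarrow> 'u"
  assumes inj: "injective_mod TYPE('u) A (reg_right A)" and M: "module A M"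
    and e: "inj_on e (carrier M)" and L: "submodule L A M"
    and h: "h \<in> mod_hom A (M\<lparr>carrier := L\<rparr>) (reg_left A)"
  shows "\<exists>g\<in>mod_hom A M (reg_left A). \<forall>x\<in>L. g x = h x"
proof -
  interpret module A M by fact
  note cr = R.is_cring
  note LM = submodule.submodule_is_module[OF L M]
  have sub: "L \<subseteq> carrier M" using submoduleE(1)[OF L] .
  have e': "inj_on e (carrier (M\<lparr>carrier := L\<rparr>))" using e sub by (simp add: inj_on_subset)
  define M' L' where "M' = image_module M e" and "L' = image_module (M\<lparr>carrier := L\<rparr>) e"
  have M': "module A M'" "e \<in> mod_hom A M M'"
    unfolding M'_def using inj_onD[OF e] by (intro image_module[OF M]; metis)+
  have L': "module A L'" "e \<in> mod_hom A (M\<lparr>carrier := L\<rparr>) L'"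
    unfolding L'_def using inj_onD[OF e'] by (intro image_module[OF LM]; metis)+
  have cM': "carrier M' = e ` carrier M" and cL': "carrier L' = e ` L"
    by (simp_all add: M'_def L'_def image_module_def)
  have L'_add: "e x \<oplus>\<^bsub>L'\<^esub> e y = e (x \<oplus>\<^bsub>M\<^esub> y)" if "x \<in> L" "y \<in> L" for x y
    using mod_homD(2)[OF L'(2), of x y] that by simp
  have L'_act: "a \<odot>\<^bsub>L'\<^esub> e x = e (a \<odot>\<^bsub>M\<^esub> x)" if "a \<in> carrier A" "x \<in> L" for a x
    using mod_homD(3)[OF L'(2), of a x] that by simp
  have i: "(\<lambda>x. x) \<in> mod_hom A L' M'"
    using sub mod_homD(2,3)[OF M'(2)]
    by (intro mod_homI) (auto simp: cL' cM' L'_add L'_act subset_iff)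
  define f where "f = (\<lambda>X. h (inv_into L e X))"
  have f_e: "f (e x) = h x" if "x \<in> L" for x
    using e' that by (simp add: f_def)
  have "f \<in> mod_hom A L' (reg_left A)"
    using mod_homD[OF h] submoduleE(4,5)[OF L]
    by (intro mod_homI) (auto simp: cL' L'_add L'_act f_e)
  then obtain g where g: "g \<in> mod_hom A M' (reg_left A)" "\<And>X. X \<in> carrier L' \<Longrightarrow> g X = f X"
    using inj[unfolded injective_mod_def, rule_format, of L' M' "\<lambda>x. x" f] i
      module_right_module[OF M'(1)] module_right_module[OF L'(1)]
    by (auto simp: mod_hom_reg_right[OF cr])
  have "(\<lambda>x. g (e x)) \<in> mod_hom A M (reg_left A)"
    using mod_hom_compose[OF M'(2) g(1)] .
  then show ?thesis
    using g(2) f_e by (intro bexI) (auto simp: cL')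
qed

text \<open>Functionals separate a submodule from the elements outside.\<close>

lemma cogenerator_separate:
  fixes e :: "'m \<Rightarrow> 'u"
  assumes cog: "cogenerator_mod TYPE('u) A (reg_right A)" and M: "module A M"
    and e: "inj_on e (carrier M)" and L: "submodule L A M" and v: "v \<in> carrier M" "v \<notin> L"
  shows "\<exists>g\<in>mod_hom A M (reg_left A). (\<forall>x\<in>L. g x = \<zero>\<^bsub>A\<^esub>) \<and> g v \<noteq> \<zero>\<^bsub>A\<^esub>"
proof -
  interpret module A M by fact
  note cr = R.is_cring
  note LE = submoduleE[OF L]
  have L0: "\<zero>\<^bsub>M\<^esub> \<in> L" using submodule.axioms(1)[OF L] subgroup.one_closed by force
  have diff: "x \<ominus>\<^bsub>M\<^esub> y \<in> carrier M" if "x \<in> carrier M" "y \<in> carrier M" for x y using that by simp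
  have "\<ominus>\<^bsub>M\<^esub> \<zero>\<^bsub>M\<^esub> = \<zero>\<^bsub>M\<^esub>" by (rule M.minus_equality) auto
  then have diff0: "x \<ominus>\<^bsub>M\<^esub> \<zero>\<^bsub>M\<^esub> = x" if "x \<in> carrier M" for x
    using that by (simp add: M.minus_eq)
  define c where "c = (\<lambda>x. {y \<in> carrier M. x \<ominus>\<^bsub>M\<^esub> y \<in> L})"
  have c_eq: "c x = c y \<longleftrightarrow> x \<ominus>\<^bsub>M\<^esub> y \<in> L" if xy: "x \<in> carrier M" "y \<in> carrier M" for x y
  proof
    assume "c x = c y"
    moreover have "y \<in> c y" using xy L0 by (simp add: c_def M.minus_eq M.r_neg)
    ultimately show "x \<ominus>\<^bsub>M\<^esub> y \<in> L" by (auto simp: c_def)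
  next
    assume d: "x \<ominus>\<^bsub>M\<^esub> y \<in> L"
    have "x \<ominus>\<^bsub>M\<^esub> z \<in> L \<longleftrightarrow> y \<ominus>\<^bsub>M\<^esub> z \<in> L" if z: "z \<in> carrier M" for z
    proof
      assume "x \<ominus>\<^bsub>M\<^esub> z \<in> L"
      then have "\<ominus>\<^bsub>M\<^esub> (x \<ominus>\<^bsub>M\<^esub> y) \<oplus>\<^bsub>M\<^esub> (x \<ominus>\<^bsub>M\<^esub> z) \<in> L" using d LE by blast
      moreover have "\<ominus>\<^bsub>M\<^esub> (x \<ominus>\<^bsub>M\<^esub> y) \<oplus>\<^bsub>M\<^esub> (x \<ominus>\<^bsub>M\<^esub> z) = y \<ominus>\<^bsub>M\<^esub> z"
        using xy z by (simp add: M.minus_eq M.minus_add M.a_ac M.r_neg1 M.r_neg2)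
      ultimately show "y \<ominus>\<^bsub>M\<^esub> z \<in> L" by simp
    next
      assume "y \<ominus>\<^bsub>M\<^esub> z \<in> L"
      then have "(x \<ominus>\<^bsub>M\<^esub> y) \<oplus>\<^bsub>M\<^esub> (y \<ominus>\<^bsub>M\<^esub> z) \<in> L" using d LE by blast
      moreover have "(x \<ominus>\<^bsub>M\<^esub> y) \<oplus>\<^bsub>M\<^esub> (y \<ominus>\<^bsub>M\<^esub> z) = x \<ominus>\<^bsub>M\<^esub> z"
        using xy z by (simp add: M.minus_eq M.minus_add M.a_ac M.r_neg1 M.r_neg2)
      ultimately show "x \<ominus>\<^bsub>M\<^esub> z \<in> L" by simp
    qed
    then show "c x = c y" by (auto simp: c_def)
  qed
  have c_ne: "c x \<noteq> {}" "c x \<subseteq> carrier M" if "x \<in> carrier M" for x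
  proof -
    have "x \<in> c x" using that L0 by (simp add: c_def M.minus_eq M.r_neg)
    then show "c x \<noteq> {}" by blast
    show "c x \<subseteq> carrier M" by (auto simp: c_def)
  qed
  \<comment> \<open>The quotient by \<open>L\<close>: a coset is represented by the code of a chosen element.\<close>
  define K where "K = (\<lambda>x. e (SOME y. y \<in> c x))"
  have some_in: "(SOME y. y \<in> c x) \<in> c x" if "x \<in> carrier M" for x
    using c_ne(1)[OF that] by (simp add: some_in_eq)
  have K_eq: "K x = K y \<longleftrightarrow> x \<ominus>\<^bsub>M\<^esub> y \<in> L" if xy: "x \<in> carrier M" "y \<in> carrier M" for x y
  proof
    assume "K x = K y"
    then have s: "(SOME z. z \<in> c x) = (SOME z. z \<in> c y)"
      using e some_in[OF xy(1)] some_in[OF xy(2)] c_ne(2)[OF xy(1)] c_ne(2)[OF xy(2)]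
      unfolding K_def by (meson inj_onD subsetD)
    have "c x = c (SOME z. z \<in> c x)" if "x \<in> carrier M" for x
      using some_in[OF that] c_eq[OF that] by (auto simp: c_def)
    then show "x \<ominus>\<^bsub>M\<^esub> y \<in> L" using s xy c_eq[OF xy] by metis
  next
    assume "x \<ominus>\<^bsub>M\<^esub> y \<in> L"
    then show "K x = K y" using c_eq[OF xy] by (simp add: K_def)
  qed
  define N where "N = image_module M K"
  have K_add: "K (x \<oplus>\<^bsub>M\<^esub> y) = K (x' \<oplus>\<^bsub>M\<^esub> y')"
    if *: "x \<in> carrier M" "x' \<in> carrier M" "y \<in> carrier M" "y' \<in> carrier M" "K x = K x'" "K y = K y'"
    for x x' y y'
  proof -
    have "(x \<oplus>\<^bsub>M\<^esub> y) \<ominus>\<^bsub>M\<^esub> (x' \<oplus>\<^bsub>M\<^esub> y') = (x \<ominus>\<^bsub>M\<^esub> x') \<oplus>\<^bsub>M\<^esub> (y \<ominus>\<^bsub>M\<^esub> y')"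
      using *(1-4) by (simp add: M.minus_eq M.minus_add M.a_ac)
    then show ?thesis using * LE by (simp add: K_eq)
  qed
  have K_act: "K (a \<odot>\<^bsub>M\<^esub> x) = K (a \<odot>\<^bsub>M\<^esub> x')"
    if *: "a \<in> carrier A" "x \<in> carrier M" "x' \<in> carrier M" "K x = K x'" for a x x'
  proof -
    have "a \<odot>\<^bsub>M\<^esub> x \<ominus>\<^bsub>M\<^esub> a \<odot>\<^bsub>M\<^esub> x' = a \<odot>\<^bsub>M\<^esub> (x \<ominus>\<^bsub>M\<^esub> x')"
      using *(1-3) by (simp add: M.minus_eq smult_r_distr smult_r_minus)
    then show ?thesis using * LE by (simp add: K_eq)
  qed
  have N: "module A N" and K: "K \<in> mod_hom A M N"
    unfolding N_def using image_module[OF M, of K] K_add K_act by blast+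
  interpret N: module A N by fact
  note KD = mod_homD[OF K]
  have K0: "K \<zero>\<^bsub>M\<^esub> = \<zero>\<^bsub>N\<^esub>"
    using add_homs_zero[OF _ _ mod_hom_add_homs[OF K]] M.abelian_group_axioms N.M.abelian_group_axioms
    by blast
  \<comment> \<open>The cogenerator property only yields a functional that is nonzero somewhere. Applied to the
    inclusion of the cyclic submodule of \<open>v\<close>, it yields one that is nonzero at a multiple of \<open>v\<close>, hence
    at \<open>v\<close>.\<close>
  define V where "V = (\<lambda>a. K (a \<odot>\<^bsub>M\<^esub> v)) ` carrier A"
  have V: "submodule V A N"
  proof (rule N.submoduleI)
    show "V \<subseteq> carrier N" using v KD(1) by (auto simp: V_def)
    show "\<zero>\<^bsub>N\<^esub> \<in> V"
      using v K0 by (auto simp: V_def intro!: image_eqI[of _ _ "\<zero>\<^bsub>A\<^esub>"])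
    fix X assume "X \<in> V"
    then obtain a where a: "a \<in> carrier A" "X = K (a \<odot>\<^bsub>M\<^esub> v)" by (auto simp: V_def)
    show "\<ominus>\<^bsub>N\<^esub> X \<in> V"
    proof (unfold V_def, rule image_eqI)
      show "\<ominus>\<^bsub>N\<^esub> X = K ((\<ominus>\<^bsub>A\<^esub> a) \<odot>\<^bsub>M\<^esub> v)"
        using a v KD(3) N.smult_l_minus[of a "K v"] KD(1) by simp
    qed (use a in simp)
    show "b \<odot>\<^bsub>N\<^esub> X \<in> V" if "b \<in> carrier A" for b
    proof (unfold V_def, rule image_eqI)
      show "b \<odot>\<^bsub>N\<^esub> X = K ((b \<otimes>\<^bsub>A\<^esub> a) \<odot>\<^bsub>M\<^esub> v)"
        using a v that KD(3)[of b "a \<odot>\<^bsub>M\<^esub> v"] by (simp add: smult_assoc1)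
    qed (use a that in simp)
    fix Y assume "Y \<in> V"
    then obtain b where b: "b \<in> carrier A" "Y = K (b \<odot>\<^bsub>M\<^esub> v)" by (auto simp: V_def)
    show "X \<oplus>\<^bsub>N\<^esub> Y \<in> V"
    proof (unfold V_def, rule image_eqI)
      show "X \<oplus>\<^bsub>N\<^esub> Y = K ((a \<oplus>\<^bsub>A\<^esub> b) \<odot>\<^bsub>M\<^esub> v)"
        using a b v KD(2)[of "a \<odot>\<^bsub>M\<^esub> v" "b \<odot>\<^bsub>M\<^esub> v"] by (simp add: smult_l_distr)
    qed (use a b in simp)
  qed
  have id: "(\<lambda>x. x) \<in> mod_hom A (N\<lparr>carrier := V\<rparr>) N"
    using N.submoduleE(1)[OF V] by (intro mod_homI) auto
  have zero: "(\<lambda>x. \<zero>\<^bsub>N\<^esub>) \<in> mod_hom A (N\<lparr>carrier := V\<rparr>) N"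
    by (intro mod_homI) auto
  have "K v \<in> V"
    using v by (auto simp: V_def intro!: image_eqI[of _ _ "\<one>\<^bsub>A\<^esub>"])
  moreover have "K v \<noteq> \<zero>\<^bsub>N\<^esub>"
    using K_eq[OF v(1) M.zero_closed] v by (simp add: diff0 flip: K0)
  ultimately have "\<exists>h\<in>mod_hom A N (reg_right A). \<exists>x\<in>V. h x \<noteq> h \<zero>\<^bsub>N\<^esub>"
    using cog[unfolded cogenerator_mod_def, rule_format, of "N\<lparr>carrier := V\<rparr>" N "\<lambda>x. x" "\<lambda>x. \<zero>\<^bsub>N\<^esub>"]
      id zero module_right_module[OF N] module_right_module[OF submodule.submodule_is_module[OF V N]]
    by auto
  then obtain h X where h: "h \<in> mod_hom A N (reg_left A)" "X \<in> V" "h X \<noteq> h \<zero>\<^bsub>N\<^esub>"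
    by (auto simp: mod_hom_reg_right[OF cr])
  have h0: "h \<zero>\<^bsub>N\<^esub> = \<zero>\<^bsub>A\<^esub>"
    using add_homs_zero[OF _ _ mod_hom_add_homs[OF h(1)]] N.M.abelian_group_axioms R.is_abelian_group
    by simp
  obtain a where a: "a \<in> carrier A" "X = a \<odot>\<^bsub>N\<^esub> K v"
    using h(2) KD(3) v by (auto simp: V_def)
  have "h (K v) \<noteq> \<zero>\<^bsub>A\<^esub>"
    using h(3) h0 mod_homD(3)[OF h(1) a(1) KD(1)[OF v(1)]] a by auto
  moreover have "h (K x) = \<zero>\<^bsub>A\<^esub>" if "x \<in> L" for x
    using K_eq[of x "\<zero>\<^bsub>M\<^esub>"] K0 h0 that LE(1) diff0 by auto
  ultimately show ?thesis
    using mod_hom_compose[OF K h(1)] by (intro bexI[of _ "\<lambda>x. h (K x)"]) auto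
qed

lemma module_functions:
  assumes "cring A"
  shows "module A (with_action (fun_group (F \<rightarrow>\<^sub>E carrier A) F A) (\<lambda>r y. \<lambda>i\<in>F. r \<otimes>\<^bsub>A\<^esub> y i))"
proof -
  interpret cring A by fact
  have ab: "abelian_group (fun_group (F \<rightarrow>\<^sub>E carrier A) F A)"
    by (rule fun_group_abelian) (auto simp: is_abelian_group)
  show ?thesis
  proof (rule moduleI)
    fix f assume "f \<in> carrier (with_action (fun_group (F \<rightarrow>\<^sub>E carrier A) F A) (\<lambda>r y. \<lambda>i\<in>F. r \<otimes>\<^bsub>A\<^esub> y i))"
    then show "\<one>\<^bsub>A\<^esub> \<odot>\<^bsub>with_action (fun_group (F \<rightarrow>\<^sub>E carrier A) F A) (\<lambda>r y. \<lambda>i\<in>F. r \<otimes>\<^bsub>A\<^esub> y i)\<^esub> f = f"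
      by (auto simp: PiE_def extensional_def fun_eq_iff Pi_def)
  qed (use ab in \<open>auto simp: assms l_distr r_distr m_assoc PiE_def Pi_def intro!: restrict_ext\<close>)
qed

text \<open>Interpolation: if a submodule \<open>L\<close> of \<open>A\<^sup>F\<close>, for a finite set \<open>F\<close>, satisfies no linear
  relation that \<open>v\<close> violates, then \<open>v \<in> L\<close>.\<close>

lemma cogenerator_interpolate:
  fixes e :: "('i \<Rightarrow> 'a) \<Rightarrow> 'u" and A :: "('a, 'x) ring_scheme"
  defines "AF \<equiv> \<lambda>F. with_action (fun_group (F \<rightarrow>\<^sub>E carrier A) F A) (\<lambda>r y. \<lambda>i\<in>F. r \<otimes>\<^bsub>A\<^esub> y i)"
  assumes A: "cring A" and cog: "cogenerator_mod TYPE('u) A (reg_right A)" and F: "finite F"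
    and e: "inj_on e (F \<rightarrow>\<^sub>E carrier A)" and L: "submodule L A (AF F)"
    and v: "v \<in> F \<rightarrow>\<^sub>E carrier A"
    and rel: "\<And>a. \<lbrakk>a \<in> F \<rightarrow> carrier A; \<And>y. y \<in> L \<Longrightarrow> (\<Oplus>\<^bsub>A\<^esub>i\<in>F. y i \<otimes>\<^bsub>A\<^esub> a i) = \<zero>\<^bsub>A\<^esub>\<rbrakk> \<Longrightarrow>
      (\<Oplus>\<^bsub>A\<^esub>i\<in>F. v i \<otimes>\<^bsub>A\<^esub> a i) = \<zero>\<^bsub>A\<^esub>"
  shows "v \<in> L"
proof (rule ccontr)
  assume "v \<notin> L"
  interpret cring A by fact
  have M: "module A (AF F)" unfolding AF_def by (rule module_functions[OF A])
  interpret M: module A "AF F" by fact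
  have AF_simps: "carrier (AF F) = F \<rightarrow>\<^sub>E carrier A" "\<zero>\<^bsub>AF F\<^esub> = (\<lambda>i\<in>F. \<zero>\<^bsub>A\<^esub>)"
    "ring.add (AF F) = (\<lambda>f g. \<lambda>x\<in>F. f x \<oplus>\<^bsub>A\<^esub> g x)" "smult (AF F) = (\<lambda>r y. \<lambda>i\<in>F. r \<otimes>\<^bsub>A\<^esub> y i)"
    by (simp_all add: AF_def)
  obtain g where g: "g \<in> mod_hom A (AF F) (reg_left A)" "\<And>y. y \<in> L \<Longrightarrow> g y = \<zero>\<^bsub>A\<^esub>" "g v \<noteq> \<zero>\<^bsub>A\<^esub>"
    using cogenerator_separate[OF cog M _ L, of e v] e v \<open>v \<notin> L\<close> by (auto simp: AF_simps)
  define \<delta> where "\<delta> = (\<lambda>j. \<lambda>i\<in>F. if i = j then \<one>\<^bsub>A\<^esub> else \<zero>\<^bsub>A\<^esub>)"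
  have \<delta>: "\<delta> j \<in> F \<rightarrow>\<^sub>E carrier A" for j by (auto simp: \<delta>_def)
  define a where "a = (\<lambda>j. g (\<delta> j))"
  have a: "a \<in> F \<rightarrow> carrier A" using mod_homD(1)[OF g(1)] \<delta> by (auto simp: a_def AF_simps)
  have g_eq: "g y = (\<Oplus>\<^bsub>A\<^esub>i\<in>F. y i \<otimes>\<^bsub>A\<^esub> a i)" if y: "y \<in> F \<rightarrow>\<^sub>E carrier A" for y
  proof -
    define tr where "tr = (\<lambda>H. \<lambda>i\<in>F. if i \<in> H then y i else \<zero>\<^bsub>A\<^esub>)"
    have tr: "tr H \<in> carrier (AF F)" for H
      using y by (auto simp: AF_simps tr_def)
    have "g (tr H) = (\<Oplus>\<^bsub>A\<^esub>i\<in>H. y i \<otimes>\<^bsub>A\<^esub> a i)" if "finite H" "H \<subseteq> F" for H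
      using that
    proof (induction H rule: finite_induct)
      case empty
      have "tr {} = \<zero>\<^bsub>AF F\<^esub>" by (simp add: tr_def AF_simps)
      then show ?case
        using add_homs_zero[OF _ _ mod_hom_add_homs[OF g(1)]] M.M.abelian_group_axioms is_abelian_group
        by simp
    next
      case (insert j H)
      have j: "y j \<in> carrier A" "\<delta> j \<in> carrier (AF F)" using insert y \<delta> by (auto simp: AF_simps)
      have "tr (insert j H) = (y j \<odot>\<^bsub>AF F\<^esub> \<delta> j) \<oplus>\<^bsub>AF F\<^esub> tr H"
        using insert.hyps y j by (auto simp: AF_simps \<delta>_def tr_def PiE_def Pi_def intro!: restrict_ext)
      then have "g (tr (insert j H)) = y j \<otimes>\<^bsub>A\<^esub> a j \<oplus>\<^bsub>A\<^esub> (\<Oplus>\<^bsub>A\<^esub>i\<in>H. y i \<otimes>\<^bsub>A\<^esub> a i)"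
        using insert mod_homD[OF g(1)] tr j by (simp add: a_def)
      also have "\<dots> = (\<Oplus>\<^bsub>A\<^esub>i\<in>insert j H. y i \<otimes>\<^bsub>A\<^esub> a i)"
        using insert y a by (intro finsum_insert[symmetric]) (auto simp: PiE_def Pi_def subset_iff)
      finally show ?case .
    qed
    moreover have "tr F = y"
      using y by (auto simp: tr_def PiE_def extensional_def fun_eq_iff)
    ultimately show ?thesis using F by force
  qed
  have "L \<subseteq> F \<rightarrow>\<^sub>E carrier A" using M.submoduleE(1)[OF L] by (simp add: AF_simps)
  then show False using rel[OF a] g g_eq v by (metis subsetD)
qed

section \<open>Contractions of tensors\<close>

lemma abelian_group_tensor_ab:
  assumes "module A M" "module A N"
  shows "abelian_group (tensor_ab A M N)"
  using tensor_pair.abelian_group_tensor_ab[OF tensor_pairI[OF closed_mod_module closed_mod_module]]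
    assms by blast

lemma module_tensor:
  assumes M: "module A M" and N: "module A N"
  shows "module A (tensor A M N)"
proof -
  interpret M: module A M by fact
  interpret N: module A N by fact
  note cM = closed_mod_module[OF M] and cN = closed_mod_module[OF N]
  interpret T: tensor_pair A M N using tensor_pairI[OF cM cN] .
  let ?T = "tensor A M N"
  note ab = T.abelian_group_tensor_ab
  interpret AB: abelian_group "tensor_ab A M N" by (rule ab)
  note sp = tensor_smult_pure[OF M cN] and sh = tensor_smult_hom[OF M cN]
  have id: "(\<lambda>t. t) \<in> add_homs (tensor_ab A M N) (tensor_ab A M N)" by (auto simp: add_homs_def)
  show ?thesis
  proof (rule moduleI[OF M.R.is_cring])
    show "abelian_group ?T" using ab by simp
  next
    fix a t assume "a \<in> carrier A" "t \<in> carrier ?T"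
    then show "a \<odot>\<^bsub>?T\<^esub> t \<in> carrier ?T" using add_homs_closed[OF sh] by simp
  next
    fix a b t assume ab': "a \<in> carrier A" "b \<in> carrier A" and t: "t \<in> carrier ?T"
    show "(a \<oplus>\<^bsub>A\<^esub> b) \<odot>\<^bsub>?T\<^esub> t = a \<odot>\<^bsub>?T\<^esub> t \<oplus>\<^bsub>?T\<^esub> b \<odot>\<^bsub>?T\<^esub> t"
    proof (rule T.add_homs_eqI[where h = "\<lambda>t. (a \<oplus>\<^bsub>A\<^esub> b) \<odot>\<^bsub>?T\<^esub> t"
          and k = "\<lambda>t. a \<odot>\<^bsub>?T\<^esub> t \<oplus>\<^bsub>?T\<^esub> b \<odot>\<^bsub>?T\<^esub> t" and P = "tensor_ab A M N"])
      show "(\<lambda>t. (a \<oplus>\<^bsub>A\<^esub> b) \<odot>\<^bsub>?T\<^esub> t) \<in> add_homs (tensor_ab A M N) (tensor_ab A M N)"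
        using sh ab' by simp
      show "(\<lambda>t. a \<odot>\<^bsub>?T\<^esub> t \<oplus>\<^bsub>?T\<^esub> b \<odot>\<^bsub>?T\<^esub> t) \<in> add_homs (tensor_ab A M N) (tensor_ab A M N)"
        using add_homs_plus[OF ab sh sh] ab' by simp
    qed (use ab ab' t in \<open>simp_all add: sp M.smult_l_distr T.pure_add_l\<close>)
    show "(a \<otimes>\<^bsub>A\<^esub> b) \<odot>\<^bsub>?T\<^esub> t = a \<odot>\<^bsub>?T\<^esub> (b \<odot>\<^bsub>?T\<^esub> t)"
    proof (rule T.add_homs_eqI[where h = "\<lambda>t. (a \<otimes>\<^bsub>A\<^esub> b) \<odot>\<^bsub>?T\<^esub> t"
          and k = "\<lambda>t. a \<odot>\<^bsub>?T\<^esub> (b \<odot>\<^bsub>?T\<^esub> t)" and P = "tensor_ab A M N"])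
      show "(\<lambda>t. (a \<otimes>\<^bsub>A\<^esub> b) \<odot>\<^bsub>?T\<^esub> t) \<in> add_homs (tensor_ab A M N) (tensor_ab A M N)"
        using sh ab' by simp
      show "(\<lambda>t. a \<odot>\<^bsub>?T\<^esub> (b \<odot>\<^bsub>?T\<^esub> t)) \<in> add_homs (tensor_ab A M N) (tensor_ab A M N)"
        using add_homs_compose[OF sh sh] ab' by simp
    qed (use ab ab' t in \<open>simp_all add: sp M.smult_assoc1\<close>)
  next
    fix a s t assume "a \<in> carrier A" "s \<in> carrier ?T" "t \<in> carrier ?T"
    then show "a \<odot>\<^bsub>?T\<^esub> (s \<oplus>\<^bsub>?T\<^esub> t) = a \<odot>\<^bsub>?T\<^esub> s \<oplus>\<^bsub>?T\<^esub> a \<odot>\<^bsub>?T\<^esub> t"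
      using add_homs_add[OF sh] by simp
  next
    fix t assume t: "t \<in> carrier ?T"
    show "\<one>\<^bsub>A\<^esub> \<odot>\<^bsub>?T\<^esub> t = t"
      by (rule T.add_homs_eqI[where h = "\<lambda>t. \<one>\<^bsub>A\<^esub> \<odot>\<^bsub>?T\<^esub> t" and k = "\<lambda>t. t", OF ab sh id])
        (use t in \<open>simp_all add: sp\<close>)
  qed
qed

lemma tensor_lift_tensor [simp]:
  "tensor_lift R M N (tensor A M' N') = tensor_lift R M N (tensor_ab A M' N')"
proof -
  have "add_pow (tensor A M' N') k x = add_pow (tensor_ab A M' N') k x" for k :: int and x
    by (simp add: add_pow_def int_pow_def nat_pow_def Let_def m_inv_def)
  then show ?thesis by (intro ext) (simp add: tensor_lift_def)
qed

lemma tensor_map_compose: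
  assumes cl: "closed_mod R M" "closed_mod R N" "closed_mod R M'" "closed_mod R N'"
      "closed_mod R M''" "closed_mod R N''"
    and f: "f \<in> mod_hom R M M'" "f' \<in> mod_hom R M' M''"
    and g: "g \<in> mod_hom R N N'" "g' \<in> mod_hom R N' N''"
    and t: "t \<in> carrier (tensor_ab R M N)"
  shows "tensor_map R M' N' M'' N'' f' g' (tensor_map R M N M' N' f g t) =
    tensor_map R M N M'' N'' (\<lambda>x. f' (f x)) (\<lambda>x. g' (g x)) t"
proof -
  interpret T: tensor_pair R M'' N'' using tensor_pairI[OF cl(5,6)] .
  show ?thesis
    unfolding tensor_map_def[of R M' N' M'' N''] tensor_map_def[of R M N M'' N'']
    by (rule tensor_lift_map[OF cl(1-4) f(1) g(1) T.abelian_group_tensor_ab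
          balanced_map[OF cl(5,6) f(2) g(2) T.balanced_pure] t])
qed

text \<open>The contractions \<open>m \<otimes> n \<mapsto> \<phi>(m) n\<close> and \<open>m \<otimes> n \<mapsto> f(n) m\<close>.\<close>

definition contr_l ::
  "('a, 'x) ring_scheme \<Rightarrow> ('a, 'm, 'y) module_scheme \<Rightarrow> ('a, 'n, 'z) module_scheme \<Rightarrow>
    ('m \<Rightarrow> 'a) \<Rightarrow> ('m, 'n) tens \<Rightarrow> 'n" where
  "contr_l A M N \<phi> = tensor_lift A M N N (\<lambda>m n. \<phi> m \<odot>\<^bsub>N\<^esub> n)"

definition contr_r ::
  "('a, 'x) ring_scheme \<Rightarrow> ('a, 'm, 'y) module_scheme \<Rightarrow> ('a, 'n, 'z) module_scheme \<Rightarrow>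
    ('n \<Rightarrow> 'a) \<Rightarrow> ('m, 'n) tens \<Rightarrow> 'm" where
  "contr_r A M N f = tensor_lift A M N M (\<lambda>m n. f n \<odot>\<^bsub>M\<^esub> m)"

text \<open>\<open>A\<close>-linear maps \<open>M \<rightarrow> A\<close>; in contrast to the elements of \<open>dual A M\<close>, their values off the carrier
  of \<open>M\<close> are arbitrary.\<close>

abbreviation functionals ::
  "('a, 'x) ring_scheme \<Rightarrow> ('a, 'm, 'y) module_scheme \<Rightarrow> ('m \<Rightarrow> 'a) set" where
  "functionals A M \<equiv> mod_hom A M (reg_left A)"

lemma functionalD:
  assumes "f \<in> functionals A M"
  shows "x \<in> carrier M \<Longrightarrow> f x \<in> carrier A"
    and "\<lbrakk>x \<in> carrier M; y \<in> carrier M\<rbrakk> \<Longrightarrow> f (x \<oplus>\<^bsub>M\<^esub> y) = f x \<oplus>\<^bsub>A\<^esub> f y"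
    and "\<lbrakk>r \<in> carrier A; x \<in> carrier M\<rbrakk> \<Longrightarrow> f (r \<odot>\<^bsub>M\<^esub> x) = r \<otimes>\<^bsub>A\<^esub> f x"
  using mod_homD[OF assms] by auto

context
  fixes A :: "('a, 'x) ring_scheme" and M :: "('a, 'm, 'y) module_scheme"
    and N :: "('a, 'n, 'z) module_scheme"
  assumes M: "module A M" and N: "module A N"
begin

interpretation M: module A M by (rule M)
interpretation N: module A N by (rule N)

private lemma cl: "closed_mod A M" "closed_mod A N"
  using M N by (simp_all add: closed_mod_module)

interpretation T: tensor_pair A M N using tensor_pairI[OF cl] .

lemma balanced_l:
  assumes "\<phi> \<in> functionals A M"
  shows "balanced A M N N (\<lambda>m n. \<phi> m \<odot>\<^bsub>N\<^esub> n)"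
  using functionalD[OF assms]
  by (intro balancedI)
    (auto simp: N.smult_l_distr N.smult_r_distr N.smult_assoc1[symmetric] M.R.m_comm)

lemma balanced_r:
  assumes "f \<in> functionals A N"
  shows "balanced A M N M (\<lambda>m n. f n \<odot>\<^bsub>M\<^esub> m)"
  using functionalD[OF assms]
  by (intro balancedI)
    (auto simp: M.smult_l_distr M.smult_r_distr M.smult_assoc1[symmetric] M.R.m_comm)

lemma contr_l_hom:
  assumes "\<phi> \<in> functionals A M"
  shows "contr_l A M N \<phi> \<in> mod_hom A (tensor A M N) N"
  unfolding contr_l_def using functionalD[OF assms]
  by (intro tensor_lift_mod_hom[OF M cl(2) N balanced_l[OF assms]]) (simp add: N.smult_assoc1)

lemma contr_r_hom:
  assumes "f \<in> functionals A N"
  shows "contr_r A M N f \<in> mod_hom A (tensor A M N) M"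
  unfolding contr_r_def using functionalD[OF assms]
  by (intro tensor_lift_mod_hom[OF M cl(2) M balanced_r[OF assms]])
    (simp add: M.smult_assoc1[symmetric] M.R.m_comm)

lemma contr_l_pure:
  "\<lbrakk>\<phi> \<in> functionals A M; m \<in> carrier M; n \<in> carrier N\<rbrakk> \<Longrightarrow>
    contr_l A M N \<phi> (pure A M N m n) = \<phi> m \<odot>\<^bsub>N\<^esub> n"
  unfolding contr_l_def by (rule T.tensor_lift_pure[OF module_abelian_group[OF N] balanced_l])

lemma contr_r_pure:
  "\<lbrakk>f \<in> functionals A N; m \<in> carrier M; n \<in> carrier N\<rbrakk> \<Longrightarrow>
    contr_r A M N f (pure A M N m n) = f n \<odot>\<^bsub>M\<^esub> m"
  unfolding contr_r_def by (rule T.tensor_lift_pure[OF module_abelian_group[OF M] balanced_r])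

lemma contr_fubini:
  assumes \<phi>: "\<phi> \<in> functionals A M" and f: "f \<in> functionals A N"
    and t: "t \<in> carrier (tensor_ab A M N)"
  shows "f (contr_l A M N \<phi> t) = \<phi> (contr_r A M N f t)"
proof (rule T.add_homs_eqI[where h = "\<lambda>t. f (contr_l A M N \<phi> t)"
      and k = "\<lambda>t. \<phi> (contr_r A M N f t)" and P = A, OF _ _ _ _ t])
  show "abelian_group A" by (rule M.R.is_abelian_group)
  show "(\<lambda>t. f (contr_l A M N \<phi> t)) \<in> add_homs (tensor_ab A M N) A"
    using mod_hom_add_homs[OF mod_hom_compose[OF contr_l_hom[OF \<phi>] f]] by simp
  show "(\<lambda>t. \<phi> (contr_r A M N f t)) \<in> add_homs (tensor_ab A M N) A"
    using mod_hom_add_homs[OF mod_hom_compose[OF contr_r_hom[OF f] \<phi>]] by simp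
qed (simp add: contr_l_pure contr_r_pure \<phi> f functionalD[OF \<phi>] functionalD[OF f] M.R.m_comm)

lemma contr_l_cong:
  assumes "\<phi> \<in> functionals A M" "\<And>m. m \<in> carrier M \<Longrightarrow> \<phi> m = \<psi> m" "t \<in> carrier (tensor_ab A M N)"
  shows "contr_l A M N \<phi> t = contr_l A M N \<psi> t"
  unfolding contr_l_def
  by (rule tensor_lift_cong[OF cl module_abelian_group[OF N] balanced_l[OF assms(1)] _ assms(3)])
    (simp add: assms(2))

lemma contr_r_cong:
  assumes "f \<in> functionals A N" "\<And>n. n \<in> carrier N \<Longrightarrow> f n = g n" "t \<in> carrier (tensor_ab A M N)"
  shows "contr_r A M N f t = contr_r A M N g t"
  unfolding contr_r_def
  by (rule tensor_lift_cong[OF cl module_abelian_group[OF M] balanced_r[OF assms(1)] _ assms(3)])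
    (simp add: assms(2))

lemma contr_l_plus:
  assumes \<phi>: "\<phi> \<in> functionals A M" and \<psi>: "\<psi> \<in> functionals A M"
    and t: "t \<in> carrier (tensor_ab A M N)"
    and \<chi>: "\<And>m. m \<in> carrier M \<Longrightarrow> \<chi> m = \<phi> m \<oplus>\<^bsub>A\<^esub> \<psi> m"
  shows "contr_l A M N \<chi> t = contr_l A M N \<phi> t \<oplus>\<^bsub>N\<^esub> contr_l A M N \<psi> t"
proof -
  note ab = module_abelian_group[OF N]
  have "contr_l A M N \<phi> t \<oplus>\<^bsub>N\<^esub> contr_l A M N \<psi> t =
      tensor_lift A M N N (\<lambda>m n. \<phi> m \<odot>\<^bsub>N\<^esub> n \<oplus>\<^bsub>N\<^esub> \<psi> m \<odot>\<^bsub>N\<^esub> n) t"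
    unfolding contr_l_def
    by (rule tensor_lift_plus[OF cl ab balanced_l[OF \<phi>] balanced_l[OF \<psi>] t, symmetric])
  also have "\<dots> = contr_l A M N \<chi> t"
    unfolding contr_l_def
    by (rule tensor_lift_cong[OF cl ab balanced_plus[OF ab balanced_l[OF \<phi>] balanced_l[OF \<psi>]] _ t])
      (simp add: \<chi> N.smult_l_distr functionalD[OF \<phi>] functionalD[OF \<psi>])
  finally show ?thesis ..
qed

lemma contr_r_plus:
  assumes f: "f \<in> functionals A N" and g: "g \<in> functionals A N"
    and t: "t \<in> carrier (tensor_ab A M N)"
    and h: "\<And>n. n \<in> carrier N \<Longrightarrow> h n = f n \<oplus>\<^bsub>A\<^esub> g n"
  shows "contr_r A M N h t = contr_r A M N f t \<oplus>\<^bsub>M\<^esub> contr_r A M N g t"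
proof -
  note ab = module_abelian_group[OF M]
  have "contr_r A M N f t \<oplus>\<^bsub>M\<^esub> contr_r A M N g t =
      tensor_lift A M N M (\<lambda>m n. f n \<odot>\<^bsub>M\<^esub> m \<oplus>\<^bsub>M\<^esub> g n \<odot>\<^bsub>M\<^esub> m) t"
    unfolding contr_r_def
    by (rule tensor_lift_plus[OF cl ab balanced_r[OF f] balanced_r[OF g] t, symmetric])
  also have "\<dots> = contr_r A M N h t"
    unfolding contr_r_def
    by (rule tensor_lift_cong[OF cl ab balanced_plus[OF ab balanced_r[OF f] balanced_r[OF g]] _ t])
      (simp add: h M.smult_l_distr functionalD[OF f] functionalD[OF g])
  finally show ?thesis ..
qed

lemma contr_l_smult:
  assumes \<phi>: "\<phi> \<in> functionals A M" and a: "a \<in> carrier A"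
    and t: "t \<in> carrier (tensor_ab A M N)"
    and \<chi>: "\<And>m. m \<in> carrier M \<Longrightarrow> \<chi> m = a \<otimes>\<^bsub>A\<^esub> \<phi> m"
  shows "contr_l A M N \<chi> t = a \<odot>\<^bsub>N\<^esub> contr_l A M N \<phi> t"
proof -
  note ab = module_abelian_group[OF N]
  note sm = mod_hom_add_homs[OF smult_mod_hom[OF N a]]
  have "a \<odot>\<^bsub>N\<^esub> contr_l A M N \<phi> t = tensor_lift A M N N (\<lambda>m n. a \<odot>\<^bsub>N\<^esub> (\<phi> m \<odot>\<^bsub>N\<^esub> n)) t"
    unfolding contr_l_def by (rule add_homs_tensor_lift[OF cl ab ab balanced_l[OF \<phi>] sm t])
  also have "\<dots> = contr_l A M N \<chi> t"
    unfolding contr_l_def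
    by (rule tensor_lift_cong[OF cl ab balanced_compose[OF balanced_l[OF \<phi>] sm] _ t])
      (simp add: \<chi> N.smult_assoc1 functionalD[OF \<phi>] a)
  finally show ?thesis ..
qed

lemma contr_r_smult:
  assumes f: "f \<in> functionals A N" and a: "a \<in> carrier A"
    and t: "t \<in> carrier (tensor_ab A M N)"
    and h: "\<And>n. n \<in> carrier N \<Longrightarrow> h n = a \<otimes>\<^bsub>A\<^esub> f n"
  shows "contr_r A M N h t = a \<odot>\<^bsub>M\<^esub> contr_r A M N f t"
proof -
  note ab = module_abelian_group[OF M]
  note sm = mod_hom_add_homs[OF smult_mod_hom[OF M a]]
  have "a \<odot>\<^bsub>M\<^esub> contr_r A M N f t = tensor_lift A M N M (\<lambda>m n. a \<odot>\<^bsub>M\<^esub> (f n \<odot>\<^bsub>M\<^esub> m)) t"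
    unfolding contr_r_def by (rule add_homs_tensor_lift[OF cl ab ab balanced_r[OF f] sm t])
  also have "\<dots> = contr_r A M N h t"
    unfolding contr_r_def
    by (rule tensor_lift_cong[OF cl ab balanced_compose[OF balanced_r[OF f] sm] _ t])
      (simp add: h M.smult_assoc1 functionalD[OF f] a)
  finally show ?thesis ..
qed

text \<open>Functionals on \<open>N\<close> with equal values on a suitable finite set contract a given tensor to
  the same element.\<close>

lemma contr_r_finite_support:
  assumes "t \<in> carrier (tensor_ab A M N)"
  shows "\<exists>F. finite F \<and> F \<subseteq> carrier N \<and> (\<forall>f\<in>functionals A N. \<forall>g\<in>functionals A N.
    (\<forall>n\<in>F. f n = g n) \<longrightarrow> contr_r A M N f t = contr_r A M N g t)"
proof -
  define D where "D F t \<longleftrightarrow> (\<forall>f\<in>functionals A N. \<forall>g\<in>functionals A N.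
    (\<forall>n\<in>F. f n = g n) \<longrightarrow> contr_r A M N f t = contr_r A M N g t)" for F t
  have "\<exists>F. finite F \<and> F \<subseteq> carrier N \<and> D F t"
    using assms
  proof (induction rule: T.tensor_induct)
    case (pure m n)
    then show ?case by (intro exI[of _ "{n}"]) (auto simp: D_def contr_r_pure)
  next
    case zero
    then show ?case
      using mod_hom_zero[OF module_tensor[OF M N] M contr_r_hom] by (intro exI[of _ "{}"]) (auto simp: D_def)
  next
    case (neg t)
    then obtain F where F: "finite F" "F \<subseteq> carrier N" "D F t" by blast
    have "contr_r A M N f (\<ominus>\<^bsub>tensor_ab A M N\<^esub> t) = \<ominus>\<^bsub>M\<^esub> contr_r A M N f t" if "f \<in> functionals A N" for f
      using add_homs_neg[OF T.abelian_group_tensor_ab module_abelian_group[OF M], of "contr_r A M N f" t]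
        neg mod_hom_add_homs[OF contr_r_hom[OF that]] by simp
    then have "D F (\<ominus>\<^bsub>tensor_ab A M N\<^esub> t)" using F(3) unfolding D_def by metis
    then show ?case using F by blast
  next
    case (add s t)
    then obtain F F' where F: "finite F" "F \<subseteq> carrier N" "D F s" "finite F'" "F' \<subseteq> carrier N" "D F' t"
      by blast
    have "contr_r A M N f (s \<oplus>\<^bsub>tensor_ab A M N\<^esub> t) = contr_r A M N f s \<oplus>\<^bsub>M\<^esub> contr_r A M N f t"
      if "f \<in> functionals A N" for f
      using add mod_homD(2)[OF contr_r_hom[OF that], of s t] by simp
    then have "D (F \<union> F') (s \<oplus>\<^bsub>tensor_ab A M N\<^esub> t)"
      using F(3,6) unfolding D_def by (metis UnCI)
    then show ?case using F by (intro exI[of _ "F \<union> F'"]) auto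
  qed
  then show ?thesis unfolding D_def .
qed

end

text \<open>Reassociating \<open>(m \<otimes> n) \<otimes> p\<close> and contracting \<open>p\<close> against \<open>f\<close> gives \<open>f(p) (m \<otimes> n)\<close>.\<close>

lemma contr_tensor_assoc:
  assumes M: "module A M" and N: "module A N" and P: "module A P"
    and f: "f \<in> functionals A P" and X: "X \<in> carrier (tensor_ab A (tensor A M N) P)"
  shows "tensor_map A M (tensor A N P) M N (\<lambda>x. x) (contr_r A N P f) (tensor_assoc A M N P X) =
    contr_r A (tensor A M N) P f X"
proof -
  interpret M: module A M by fact
  interpret N: module A N by fact
  interpret P: module A P by fact
  note MN = module_tensor[OF M N] and NP = module_tensor[OF N P]
  note M_NP = module_tensor[OF M NP]
  note cl = closed_mod_module[OF M] closed_mod_module[OF N] closed_mod_module[OF P]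
    closed_mod_module[OF MN] closed_mod_module[OF NP] closed_mod_module[OF M_NP]
  interpret TMN: tensor_pair A M N using tensor_pairI[OF cl(1,2)] .
  interpret TNP: tensor_pair A N P using tensor_pairI[OF cl(2,3)] .
  interpret TM_NP: tensor_pair A M "tensor A N P" using tensor_pairI[OF cl(1,5)] .
  interpret TMN_P: tensor_pair A "tensor A M N" P using tensor_pairI[OF cl(4,3)] .
  let ?Q = "tensor A M (tensor A N P)"
  note Q = module_abelian_group[OF M_NP]
  define \<beta> where "\<beta> = (\<lambda>p m n. pure A M (tensor A N P) m (pure A N P n p))"
  have \<beta>: "balanced A M N ?Q (\<beta> p)" if p: "p \<in> carrier P" for p
  proof (rule balancedI)
    fix a m n assume *: "a \<in> carrier A" "m \<in> carrier M" "n \<in> carrier N"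
    have "\<beta> p (a \<odot>\<^bsub>M\<^esub> m) n = pure A M (tensor A N P) m (a \<odot>\<^bsub>tensor A N P\<^esub> pure A N P n p)"
      unfolding \<beta>_def using TM_NP.pure_act * TNP.pure_closed p by simp
    then show "\<beta> p (a \<odot>\<^bsub>M\<^esub> m) n = \<beta> p m (a \<odot>\<^bsub>N\<^esub> n)"
      using tensor_smult_pure[OF N cl(3)] * p by (simp add: \<beta>_def)
  qed (use p in \<open>simp_all add: \<beta>_def TM_NP.pure_closed TNP.pure_closed TM_NP.pure_add_l
        TNP.pure_add_l TM_NP.pure_add_r[simplified]\<close>)
  define \<Phi> where "\<Phi> = (\<lambda>t p. tensor_lift A M N ?Q (\<beta> p) t)"
  have \<Phi>_hom: "(\<lambda>t. \<Phi> t p) \<in> add_homs (tensor_ab A M N) ?Q" if "p \<in> carrier P" for p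
    unfolding \<Phi>_def by (rule TMN.tensor_lift_hom[OF Q \<beta>[OF that]])
  have \<Phi>_pure: "\<Phi> (pure A M N m n) p = \<beta> p m n"
    if "m \<in> carrier M" "n \<in> carrier N" "p \<in> carrier P" for m n p
    unfolding \<Phi>_def by (rule TMN.tensor_lift_pure[OF Q \<beta>]) (use that in auto)
  have \<Phi>: "balanced A (tensor A M N) P ?Q \<Phi>"
  proof (rule balancedI)
    fix t p p' assume t: "t \<in> carrier (tensor A M N)" and p: "p \<in> carrier P" "p' \<in> carrier P"
    show "\<Phi> t (p \<oplus>\<^bsub>P\<^esub> p') = \<Phi> t p \<oplus>\<^bsub>?Q\<^esub> \<Phi> t p'"
    proof (rule TMN.add_homs_eqI[where h = "\<lambda>t. \<Phi> t (p \<oplus>\<^bsub>P\<^esub> p')" and k = "\<lambda>t. \<Phi> t p \<oplus>\<^bsub>?Q\<^esub> \<Phi> t p'", OF Q])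
      show "(\<lambda>t. \<Phi> t (p \<oplus>\<^bsub>P\<^esub> p')) \<in> add_homs (tensor_ab A M N) ?Q" using \<Phi>_hom p by blast
      show "(\<lambda>t. \<Phi> t p \<oplus>\<^bsub>?Q\<^esub> \<Phi> t p') \<in> add_homs (tensor_ab A M N) ?Q"
        by (rule add_homs_plus[OF Q \<Phi>_hom \<Phi>_hom]) (use p in auto)
    qed (use t p in \<open>simp_all add: \<Phi>_pure \<beta>_def TNP.pure_add_r TM_NP.pure_add_r[simplified] TNP.pure_closed\<close>)
  next
    fix a t p assume a: "a \<in> carrier A" and t: "t \<in> carrier (tensor A M N)" and p: "p \<in> carrier P"
    show "\<Phi> (a \<odot>\<^bsub>tensor A M N\<^esub> t) p = \<Phi> t (a \<odot>\<^bsub>P\<^esub> p)"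
    proof (rule TMN.add_homs_eqI[where h = "\<lambda>t. \<Phi> (a \<odot>\<^bsub>tensor A M N\<^esub> t) p" and k = "\<lambda>t. \<Phi> t (a \<odot>\<^bsub>P\<^esub> p)", OF Q])
      show "(\<lambda>t. \<Phi> (a \<odot>\<^bsub>tensor A M N\<^esub> t) p) \<in> add_homs (tensor_ab A M N) ?Q"
        by (rule add_homs_compose[OF tensor_smult_hom[OF M cl(2) a] \<Phi>_hom[OF p]])
      show "(\<lambda>t. \<Phi> t (a \<odot>\<^bsub>P\<^esub> p)) \<in> add_homs (tensor_ab A M N) ?Q" using \<Phi>_hom a p by blast
      fix m n assume mn: "m \<in> carrier M" "n \<in> carrier N"
      have "\<Phi> (a \<odot>\<^bsub>tensor A M N\<^esub> pure A M N m n) p = \<beta> p (a \<odot>\<^bsub>M\<^esub> m) n"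
        using a p mn by (simp add: tensor_smult_pure[OF M cl(2)] \<Phi>_pure)
      also have "\<dots> = \<beta> p m (a \<odot>\<^bsub>N\<^esub> n)" using balancedD(4)[OF \<beta>] a p mn by blast
      also have "\<dots> = \<beta> (a \<odot>\<^bsub>P\<^esub> p) m n" using TNP.pure_act a p mn by (simp add: \<beta>_def)
      finally show "\<Phi> (a \<odot>\<^bsub>tensor A M N\<^esub> pure A M N m n) p = \<Phi> (pure A M N m n) (a \<odot>\<^bsub>P\<^esub> p)"
        using \<Phi>_pure mn a p by simp
    qed (use t in simp)
  qed (use \<Phi>_hom in \<open>auto simp: add_homs_def\<close>)
  have assoc: "tensor_assoc A M N P = tensor_lift A (tensor A M N) P ?Q \<Phi>"
    unfolding tensor_assoc_def \<Phi>_def \<beta>_def ..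
  note c_hom = contr_r_hom[OF N P f]
  let ?K = "tensor_map A M (tensor A N P) M N (\<lambda>x. x) (contr_r A N P f)"
  have K: "?K \<in> add_homs ?Q (tensor A M N)"
    using tensor_map_hom[OF cl(1,5,1,2) id_mod_hom c_hom] by simp
  have K_pure: "?K (\<beta> p m n) = f p \<odot>\<^bsub>tensor A M N\<^esub> pure A M N m n"
    if *: "m \<in> carrier M" "n \<in> carrier N" "p \<in> carrier P" for m n p
  proof -
    have "?K (\<beta> p m n) = pure A M N m (f p \<odot>\<^bsub>N\<^esub> n)"
      unfolding \<beta>_def using *
      by (subst tensor_map_pure[OF cl(1,5,1,2) id_mod_hom c_hom])
        (simp_all add: TNP.pure_closed contr_r_pure[OF N P f])
    then show ?thesis
      using * functionalD(1)[OF f] TMN.pure_act by (simp add: tensor_smult_pure[OF M cl(2)])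
  qed
  have K\<Phi>: "?K (\<Phi> t p) = f p \<odot>\<^bsub>tensor A M N\<^esub> t"
    if t: "t \<in> carrier (tensor_ab A M N)" and p: "p \<in> carrier P" for t p
  proof (rule TMN.add_homs_eqI[where h = "\<lambda>t. ?K (\<Phi> t p)" and k = "\<lambda>t. f p \<odot>\<^bsub>tensor A M N\<^esub> t" and P = "tensor A M N"])
    show "abelian_group (tensor A M N)" using module_abelian_group[OF MN] .
    show "(\<lambda>t. ?K (\<Phi> t p)) \<in> add_homs (tensor_ab A M N) (tensor A M N)"
      by (rule add_homs_compose[OF \<Phi>_hom[OF p] K])
    show "(\<lambda>t. f p \<odot>\<^bsub>tensor A M N\<^esub> t) \<in> add_homs (tensor_ab A M N) (tensor A M N)"
      using tensor_smult_hom[OF M cl(2)] functionalD(1)[OF f p] by simp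
  qed (use t p in \<open>simp_all add: \<Phi>_pure K_pure\<close>)
  have "?K (tensor_assoc A M N P X) = tensor_lift A (tensor A M N) P (tensor A M N) (\<lambda>t p. ?K (\<Phi> t p)) X"
    unfolding assoc by (rule add_homs_tensor_lift[OF cl(4,3) Q module_abelian_group[OF MN] \<Phi> K X])
  also have "\<dots> = contr_r A (tensor A M N) P f X"
    unfolding contr_r_def[of A "tensor A M N" P]
    by (rule tensor_lift_cong[OF cl(4,3) module_abelian_group[OF MN] balanced_compose[OF \<Phi> K] _ X])
      (simp add: K\<Phi>)
  finally show ?thesis .
qed

section \<open>Linear maps from a coalgebra to its dual\<close>

lemma ldual_simps [simp]:
  "carrier (ldual A C) = Hom A C (reg_left A)" "ring.add (ldual A C) = ring.add (dual A C)"
  "smult (ldual A C) = smult (dual A C)"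
  "monoid.mult (ldual A C) = (\<lambda>f g. \<lambda>c\<in>carrier C. g (ract_C A C f c))"
  by (simp_all add: ldual_def)

lemma rdual_simps [simp]:
  "carrier (rdual A C) = Hom A C (reg_left A)" "ring.add (rdual A C) = ring.add (dual A C)"
  "smult (rdual A C) = smult (dual A C)"
  "monoid.mult (rdual A C) = (\<lambda>f g. \<lambda>c\<in>carrier C. f (lact_C A C g c))"
  by (simp_all add: rdual_def)

text \<open>\<open>A\<close>-linear maps \<open>C \<rightarrow> \<^sup>*C\<close> that are right \<open>\<^sup>*C\<close>-linear, and \<open>A\<close>-linear maps \<open>C \<rightarrow> C\<^sup>*\<close> that
  are left \<open>C\<^sup>*\<close>-linear.\<close>

definition right_linear :: "('a, 'x) ring_scheme \<Rightarrow> ('a, 'c) coalgebra \<Rightarrow> ('c \<Rightarrow> 'c \<Rightarrow> 'a) \<Rightarrow> bool" where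
  "right_linear A C p \<longleftrightarrow> p \<in> mod_hom A C (dual A C) \<and>
    (\<forall>f\<in>Hom A C (reg_left A). \<forall>c\<in>carrier C. \<forall>d\<in>carrier C.
      p (ract_C A C f c) d = f (ract_C A C (p c) d))"

definition left_linear :: "('a, 'x) ring_scheme \<Rightarrow> ('a, 'c) coalgebra \<Rightarrow> ('c \<Rightarrow> 'c \<Rightarrow> 'a) \<Rightarrow> bool" where
  "left_linear A C j \<longleftrightarrow> j \<in> mod_hom A C (dual A C) \<and>
    (\<forall>f\<in>Hom A C (reg_left A). \<forall>c\<in>carrier C. \<forall>d\<in>carrier C.
      j (lact_C A C f c) d = f (lact_C A C (j c) d))"

lemma is_dual_basis_exists:
  assumes M: "module A M" and P: "fg_projective A M"
  shows "\<exists>d. is_dual_basis A M d"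
proof -
  interpret M: module A M by fact
  obtain n i p where i: "i \<in> mod_hom A M (free_mod A n)" and p: "p \<in> mod_hom A (free_mod A n) M"
    and pi: "\<And>x. x \<in> carrier M \<Longrightarrow> p (i x) = x"
    using P unfolding fg_projective_def by blast
  have F: "free_mod A n = with_action (fun_group ({..<n} \<rightarrow>\<^sub>E carrier A) {..<n} A) (\<lambda>r y. \<lambda>i\<in>{..<n}. r \<otimes>\<^bsub>A\<^esub> y i)"
    by (simp add: free_mod_def)
  have FM: "module A (free_mod A n)" unfolding F by (rule module_functions[OF M.R.is_cring])
  have F_simps: "carrier (free_mod A n) = {..<n} \<rightarrow>\<^sub>E carrier A"
    "\<zero>\<^bsub>free_mod A n\<^esub> = (\<lambda>i\<in>{..<n}. \<zero>\<^bsub>A\<^esub>)"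
    "ring.add (free_mod A n) = (\<lambda>f g. \<lambda>x\<in>{..<n}. f x \<oplus>\<^bsub>A\<^esub> g x)"
    "smult (free_mod A n) = (\<lambda>r y. \<lambda>i\<in>{..<n}. r \<otimes>\<^bsub>A\<^esub> y i)"
    by (simp_all add: F)
  have iD: "i x \<in> {..<n} \<rightarrow>\<^sub>E carrier A" if "x \<in> carrier M" for x
    using mod_homD(1)[OF i that] by (simp add: F_simps)
  define \<delta> where "\<delta> = (\<lambda>k. \<lambda>j\<in>{..<n}. if j = k then \<one>\<^bsub>A\<^esub> else \<zero>\<^bsub>A\<^esub>)"
  have \<delta>: "\<delta> k \<in> carrier (free_mod A n)" for k by (auto simp: \<delta>_def F_simps)
  define e where "e = (\<lambda>k. p (\<delta> k))"
  define f where "f = (\<lambda>k. \<lambda>x\<in>carrier M. i x k)"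
  have e: "e k \<in> carrier M" for k using mod_homD(1)[OF p \<delta>] by (simp add: e_def)
  have f: "f k \<in> Hom A M (reg_left A)" if k: "k < n" for k
  proof (rule HomI)
    fix x assume x: "x \<in> carrier M"
    show "f k x \<in> carrier (reg_left A)" using iD[OF x] k x by (auto simp: f_def)
    show "f k (r \<odot>\<^bsub>M\<^esub> x) = r \<odot>\<^bsub>reg_left A\<^esub> f k x" if "r \<in> carrier A" for r
      using mod_homD(3)[OF i that x] x k that by (simp add: f_def F_simps)
    show "f k (x \<oplus>\<^bsub>M\<^esub> y) = f k x \<oplus>\<^bsub>reg_left A\<^esub> f k y" if "y \<in> carrier M" for y
      using mod_homD(2)[OF i x that] x k that by (simp add: f_def F_simps)
  qed (simp add: f_def)
  have sum: "x = (\<Oplus>\<^bsub>M\<^esub>k\<in>{..<n}. f k x \<odot>\<^bsub>M\<^esub> e k)" if x: "x \<in> carrier M" for x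
  proof -
    define tr where "tr = (\<lambda>m. \<lambda>k\<in>{..<n}. if k < m then i x k else \<zero>\<^bsub>A\<^esub>)"
    have ix: "i x k \<in> carrier A" if "k < n" for k
      using PiE_mem[OF iD[OF x], of k] that by simp
    have ix_ext: "i x \<in> extensional {..<n}" using iD[OF x] by (simp add: PiE_def)
    have tr: "tr m \<in> carrier (free_mod A n)" for m
      unfolding tr_def F_simps using ix by simp
    have "p (tr m) = (\<Oplus>\<^bsub>M\<^esub>k\<in>{..<m}. f k x \<odot>\<^bsub>M\<^esub> e k)" if "m \<le> n" for m
      using that
    proof (induction m)
      case 0
      have "tr 0 = \<zero>\<^bsub>free_mod A n\<^esub>" by (simp add: tr_def F_simps)
      then show ?case using mod_hom_zero[OF FM M p] by simp
    next
      case (Suc m)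
      have m: "i x m \<in> carrier A" using ix Suc by simp
      have fk: "f k x \<in> carrier A" if "k \<le> m" for k
        using HomD(1)[OF f, of k x] Suc that x by simp
      have "tr (Suc m) = (i x m \<odot>\<^bsub>free_mod A n\<^esub> \<delta> m) \<oplus>\<^bsub>free_mod A n\<^esub> tr m"
        unfolding tr_def \<delta>_def F_simps by (rule restrict_ext) (use ix m in \<open>simp add: less_Suc_eq\<close>)
      then have "p (tr (Suc m)) = f m x \<odot>\<^bsub>M\<^esub> e m \<oplus>\<^bsub>M\<^esub> (\<Oplus>\<^bsub>M\<^esub>k\<in>{..<m}. f k x \<odot>\<^bsub>M\<^esub> e k)"
        using Suc mod_homD[OF p] tr \<delta> m module.smult_closed[OF FM] by (simp add: f_def e_def x)
      also have "\<dots> = (\<Oplus>\<^bsub>M\<^esub>k\<in>insert m {..<m}. f k x \<odot>\<^bsub>M\<^esub> e k)"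
        using fk e by (intro M.finsum_insert[symmetric]) auto
      finally show ?case by (simp add: lessThan_Suc)
    qed
    moreover have "tr n = i x"
      by (rule extensionalityI[OF _ ix_ext]) (simp_all add: tr_def)
    ultimately show ?thesis using pi[OF x] by force
  qed
  have "is_dual_basis A M (n, e, f)"
    unfolding is_dual_basis_def using e f sum by simp
  then show ?thesis ..
qed

lemma locally_projective_separates:
  assumes "module A M" "locally_projective A M" and xy: "x \<in> carrier M" "y \<in> carrier M"
    and eq: "\<And>f. f \<in> Hom A M (reg_left A) \<Longrightarrow> f x = f y"
  shows "x = y"
proof -
  interpret module A M by fact
  obtain n :: nat and \<phi> c where \<phi>: "\<forall>i<n. \<phi> i \<in> Hom A M (reg_left A) \<and> c i \<in> carrier M"
    and sum: "x = (\<Oplus>\<^bsub>M\<^esub>i\<in>{..<n}. \<phi> i x \<odot>\<^bsub>M\<^esub> c i)" "y = (\<Oplus>\<^bsub>M\<^esub>i\<in>{..<n}. \<phi> i y \<odot>\<^bsub>M\<^esub> c i)"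
    using assms(2)[unfolded locally_projective_def, rule_format, of "{x, y}"] xy by auto
  have "\<phi> i x = \<phi> i y" if "i < n" for i using \<phi> that by (intro eq) simp
  moreover have "\<phi> i y \<in> carrier A" if "i < n" for i
    using HomD(1)[of "\<phi> i" A M "reg_left A" y] \<phi> that xy by simp
  ultimately have "(\<Oplus>\<^bsub>M\<^esub>i\<in>{..<n}. \<phi> i x \<odot>\<^bsub>M\<^esub> c i) = (\<Oplus>\<^bsub>M\<^esub>i\<in>{..<n}. \<phi> i y \<odot>\<^bsub>M\<^esub> c i)"
    using \<phi> by (intro M.finsum_cong') auto
  then show ?thesis using sum by simp
qed

lemma Q_simps [simp]:
  "carrier (Q_A A C S) = Q_set A C S" "carrier (Q_B A C S) = Q_set A C S" "carrier (Q_T A C S) = Q_set A C S"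
  "ring.add (Q_A A C S) = (\<lambda>f g. \<lambda>c\<in>carrier C. f c \<oplus>\<^bsub>dual A S\<^esub> g c)"
  "ring.add (Q_B A C S) = (\<lambda>f g. \<lambda>c\<in>carrier C. f c \<oplus>\<^bsub>dual A S\<^esub> g c)"
  "ring.add (Q_T A C S) = (\<lambda>f g. \<lambda>c\<in>carrier C. f c \<oplus>\<^bsub>dual A S\<^esub> g c)"
  "smult (Q_A A C S) = (\<lambda>a q. \<lambda>c\<in>carrier C. q (a \<odot>\<^bsub>C\<^esub> c))"
  "smult (Q_B A C S) = (\<lambda>b q. \<lambda>c\<in>carrier C. \<lambda>u\<in>carrier S. q c (lact S b u))"
  "smult (Q_T A C S) = (\<lambda>t q. \<lambda>c\<in>carrier C. compose (carrier S) (q c) t)"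
  by (simp_all add: Q_A_def Q_B_def Q_T_def Q_ab_def)

lemma dual_B_simps [simp]:
  "carrier (dual_B A S) = Hom A S (reg_left A)" "ring.add (dual_B A S) = ring.add (dual A S)"
  "smult (dual_B A S) = (\<lambda>b f. \<lambda>u\<in>carrier S. f (lact S b u))"
  by (simp_all add: dual_B_def)

lemma End_ring_simps [simp]:
  "carrier (End_ring A C S) = Hom_C A C S S"
  "ring.add (End_ring A C S) = (\<lambda>f g. \<lambda>x\<in>carrier S. f x \<oplus>\<^bsub>S\<^esub> g x)"
  by (simp_all add: End_ring_def)


section \<open>Coalgebras and finitely generated projective comodules\<close>


locale fgp_comodule =
  fixes A :: "'a ring" and B :: "'b ring" and C :: "('a, 'c) coalgebra"
    and S :: "('a, 'b, 'c, 's) bicomodule"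
  assumes cring_A: "cring A" and coalgebra_C: "is_coalgebra A C" and ring_B: "ring B"
    and bicomodule_S: "is_fgp_bicomodule A B C S"
begin

lemma module_C: "module A C"
  using coalgebra_C by (simp add: is_coalgebra_def)

lemma comodule_S: "is_comodule A C S"
  using bicomodule_S by (simp add: is_fgp_bicomodule_def)

lemma module_S: "module A S"
  using comodule_S by (simp add: is_comodule_def)

interpretation R: cring A by (rule cring_A)
interpretation C: module A C by (rule module_C)
interpretation S: module A S by (rule module_S)

lemma comult_hom: "comult C \<in> mod_hom A C (tensor A C C)"
  using coalgebra_C by (simp add: is_coalgebra_def)

lemma coact_hom: "coact S \<in> mod_hom A S (tensor A S C)"
  using comodule_S by (simp add: is_comodule_def)

lemma comult_closed: "c \<in> carrier C \<Longrightarrow> comult C c \<in> carrier (tensor_ab A C C)"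
  using mod_homD(1)[OF comult_hom] by simp

lemma coact_closed: "u \<in> carrier S \<Longrightarrow> coact S u \<in> carrier (tensor_ab A S C)"
  using mod_homD(1)[OF coact_hom] by simp

lemma counit_functional: "counit C \<in> functionals A C"
  using coalgebra_C by (simp add: is_coalgebra_def)

text \<open>The carriers of \<open>\<Sigma>\<^sup>*\<close>, \<open>\<^sup>*C\<close> and \<open>C\<^sup>*\<close>.\<close>

abbreviation "S_dual \<equiv> Hom A S (reg_left A)"
abbreviation "C_dual \<equiv> Hom A C (reg_left A)"

abbreviation "ract \<equiv> ract_C A C"
abbreviation "lact_f \<equiv> lact_C A C"

text \<open>\<open>u \<cdot> f = u\<^sub>[\<^sub>0\<^sub>] f(u\<^sub>[\<^sub>1\<^sub>])\<close>.\<close>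

definition sact :: "('c \<Rightarrow> 'a) \<Rightarrow> 's \<Rightarrow> 's" where
  "sact f u = contr_r A S C f (coact S u)"

text \<open>The matrix coefficient \<open>\<phi>(u\<^sub>[\<^sub>0\<^sub>]) u\<^sub>[\<^sub>1\<^sub>]\<close>.\<close>

definition coeff :: "('s \<Rightarrow> 'a) \<Rightarrow> 's \<Rightarrow> 'c" where
  "coeff \<phi> u = contr_l A S C \<phi> (coact S u)"

lemma ract_eq: "ract f c = contr_r A C C f (comult C c)"
  by (simp add: ract_C_def contr_r_def)

lemma lact_eq: "lact_f f c = contr_l A C C f (comult C c)"
  by (simp add: lact_C_def contr_l_def)

lemma sact_hom: "f \<in> functionals A C \<Longrightarrow> sact f \<in> mod_hom A S S"
  unfolding sact_def
  by (rule mod_hom_compose[OF coact_hom contr_r_hom[OF module_S module_C]])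

lemma coeff_hom: "\<phi> \<in> functionals A S \<Longrightarrow> coeff \<phi> \<in> mod_hom A S C"
  unfolding coeff_def
  by (rule mod_hom_compose[OF coact_hom contr_l_hom[OF module_S module_C]])

lemma ract_hom: "f \<in> functionals A C \<Longrightarrow> ract f \<in> mod_hom A C C"
  unfolding ract_eq
  by (rule mod_hom_compose[OF comult_hom contr_r_hom[OF module_C module_C]])

lemma lact_hom: "f \<in> functionals A C \<Longrightarrow> lact_f f \<in> mod_hom A C C"
  unfolding lact_eq
  by (rule mod_hom_compose[OF comult_hom contr_l_hom[OF module_C module_C]])

lemma functional_coeff:
  assumes "f \<in> functionals A C" "\<phi> \<in> functionals A S" "u \<in> carrier S"
  shows "f (coeff \<phi> u) = \<phi> (sact f u)"
  unfolding coeff_def sact_def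
  by (rule contr_fubini[OF module_S module_C assms(2,1) coact_closed[OF assms(3)]])

lemma functional_ract:
  assumes "f \<in> functionals A C" "g \<in> functionals A C" "c \<in> carrier C"
  shows "f (ract g c) = g (lact_f f c)"
  unfolding lact_eq ract_eq
  by (rule contr_fubini[OF module_C module_C assms(1,2) comult_closed[OF assms(3)], symmetric])

lemma sact_counit: "u \<in> carrier S \<Longrightarrow> sact (counit C) u = u"
  using comodule_S by (simp add: is_comodule_def sact_def contr_r_def)

lemma ract_counit: "c \<in> carrier C \<Longrightarrow> ract (counit C) c = c"
  using coalgebra_C by (simp add: is_coalgebra_def ract_C_def)

lemma counit_coeff: "\<lbrakk>\<phi> \<in> functionals A S; u \<in> carrier S\<rbrakk> \<Longrightarrow> counit C (coeff \<phi> u) = \<phi> u"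
  by (simp add: functional_coeff counit_functional sact_counit)

lemma ract_cong:
  assumes "f \<in> functionals A C" "\<And>d. d \<in> carrier C \<Longrightarrow> f d = g d" "c \<in> carrier C"
  shows "ract f c = ract g c"
  unfolding ract_eq by (rule contr_r_cong[OF module_C module_C assms(1,2) comult_closed[OF assms(3)]])

lemma coeff_cong:
  assumes "\<phi> \<in> functionals A S" "\<And>v. v \<in> carrier S \<Longrightarrow> \<phi> v = \<psi> v" "u \<in> carrier S"
  shows "coeff \<phi> u = coeff \<psi> u"
  unfolding coeff_def by (rule contr_l_cong[OF module_S module_C assms(1,2) coact_closed[OF assms(3)]])

lemma coeff_plus:
  assumes "\<phi> \<in> functionals A S" "\<psi> \<in> functionals A S" "u \<in> carrier S"
  shows "coeff (\<lambda>v\<in>carrier S. \<phi> v \<oplus>\<^bsub>A\<^esub> \<psi> v) u = coeff \<phi> u \<oplus>\<^bsub>C\<^esub> coeff \<psi> u"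
  unfolding coeff_def
  by (rule contr_l_plus[OF module_S module_C assms(1,2) coact_closed[OF assms(3)]]) simp

lemma coeff_smult:
  assumes "\<phi> \<in> functionals A S" "a \<in> carrier A" "u \<in> carrier S"
  shows "coeff (\<lambda>v\<in>carrier S. a \<otimes>\<^bsub>A\<^esub> \<phi> v) u = a \<odot>\<^bsub>C\<^esub> coeff \<phi> u"
  unfolding coeff_def
  by (rule contr_l_smult[OF module_S module_C assms(1,2) coact_closed[OF assms(3)]]) simp

lemma ract_plus:
  assumes "f \<in> functionals A C" "g \<in> functionals A C" "c \<in> carrier C"
  shows "ract (\<lambda>d\<in>carrier C. f d \<oplus>\<^bsub>A\<^esub> g d) c = ract f c \<oplus>\<^bsub>C\<^esub> ract g c"
  unfolding ract_eq
  by (rule contr_r_plus[OF module_C module_C assms(1,2) comult_closed[OF assms(3)]]) simp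

text \<open>Coassociativity of the coaction, contracted against \<open>f\<close> in the last factor.\<close>

lemma coact_sact:
  assumes f: "f \<in> functionals A C" and u: "u \<in> carrier S"
  shows "coact S (sact f u) = tensor_map A S C S C (\<lambda>x. x) (ract f) (coact S u)"
proof -
  note cS = closed_mod_module[OF module_S] and cC = closed_mod_module[OF module_C]
  note SC = module_tensor[OF module_S module_C] and CC = module_tensor[OF module_C module_C]
  note cSC = closed_mod_module[OF SC] and cCC = closed_mod_module[OF CC]
  note t = coact_closed[OF u]
  define X where "X = tensor_map A S C (tensor A S C) C (coact S) (\<lambda>x. x) (coact S u)"
  have X: "X \<in> carrier (tensor_ab A (tensor A S C) C)"
    unfolding X_def using add_homs_closed[OF tensor_map_hom[OF cS cC cSC cC coact_hom id_mod_hom] t] .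
  have "coact S (sact f u) = tensor_lift A S C (tensor A S C) (\<lambda>v c. coact S (f c \<odot>\<^bsub>S\<^esub> v)) (coact S u)"
    unfolding sact_def contr_r_def
    by (rule add_homs_tensor_lift[OF cS cC module_abelian_group[OF module_S] module_abelian_group[OF SC]
          balanced_r[OF module_S module_C f] mod_hom_add_homs[OF coact_hom] t])
  also have "\<dots> = tensor_lift A S C (tensor A S C) (\<lambda>v c. f c \<odot>\<^bsub>tensor A S C\<^esub> coact S v) (coact S u)"
    by (rule tensor_lift_cong[OF cS cC module_abelian_group[OF SC]
          balanced_compose[OF balanced_r[OF module_S module_C f] mod_hom_add_homs[OF coact_hom]] _ t])
      (use mod_homD(3)[OF coact_hom] functionalD(1)[OF f] in simp)
  also have "\<dots> = contr_r A (tensor A S C) C f X"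
    unfolding X_def contr_r_def
    by (rule tensor_lift_map[OF cS cC cSC cC coact_hom id_mod_hom module_abelian_group[OF SC]
          balanced_r[OF SC module_C f] t, symmetric])
  also have "\<dots> = tensor_map A S (tensor A C C) S C (\<lambda>x. x) (contr_r A C C f) (tensor_assoc A S C C X)"
    by (rule contr_tensor_assoc[OF module_S module_C module_C f X, symmetric])
  also have "tensor_assoc A S C C X = tensor_map A S C S (tensor A C C) (\<lambda>x. x) (comult C) (coact S u)"
    unfolding X_def using comodule_S u by (simp add: is_comodule_def)
  also have "tensor_map A S (tensor A C C) S C (\<lambda>x. x) (contr_r A C C f) \<dots> =
      tensor_map A S C S C (\<lambda>x. x) (\<lambda>c. contr_r A C C f (comult C c)) (coact S u)"
    by (rule tensor_map_compose[OF cS cC cS cCC cS cC id_mod_hom id_mod_hom comult_hom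
          contr_r_hom[OF module_C module_C f] t])
  finally show ?thesis by (simp add: ract_eq[abs_def])
qed

lemma contr_l_tensor_map_id:
  assumes \<phi>: "\<phi> \<in> functionals A S" and h: "h \<in> mod_hom A C C" and t: "t \<in> carrier (tensor_ab A S C)"
  shows "contr_l A S C \<phi> (tensor_map A S C S C (\<lambda>x. x) h t) = h (contr_l A S C \<phi> t)"
proof -
  note cS = closed_mod_module[OF module_S] and cC = closed_mod_module[OF module_C]
  note ab = module_abelian_group[OF module_C]
  have "contr_l A S C \<phi> (tensor_map A S C S C (\<lambda>x. x) h t) = tensor_lift A S C C (\<lambda>v c. \<phi> v \<odot>\<^bsub>C\<^esub> h c) t"
    unfolding contr_l_def
    by (rule tensor_lift_map[OF cS cC cS cC id_mod_hom h ab balanced_l[OF module_S module_C \<phi>] t])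
  also have "\<dots> = tensor_lift A S C C (\<lambda>v c. h (\<phi> v \<odot>\<^bsub>C\<^esub> c)) t"
    by (rule tensor_lift_cong[OF cS cC ab, symmetric])
      (use balanced_compose[OF balanced_l[OF module_S module_C \<phi>] mod_hom_add_homs[OF h]] t
        mod_homD(3)[OF h] functionalD(1)[OF \<phi>] in auto)
  also have "\<dots> = h (contr_l A S C \<phi> t)"
    unfolding contr_l_def
    by (rule add_homs_tensor_lift[OF cS cC ab ab balanced_l[OF module_S module_C \<phi>] mod_hom_add_homs[OF h] t, symmetric])
  finally show ?thesis .
qed

lemma coeff_sact:
  assumes "f \<in> functionals A C" "\<phi> \<in> functionals A S" "u \<in> carrier S"
  shows "coeff \<phi> (sact f u) = ract f (coeff \<phi> u)"
  unfolding coeff_def coact_sact[OF assms(1,3)]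
  by (rule contr_l_tensor_map_id[OF assms(2) ract_hom[OF assms(1)] coact_closed[OF assms(3)]])

lemma contr_l_tensor_map:
  assumes \<phi>: "\<phi> \<in> functionals A S" and h: "h \<in> mod_hom A S S" and t: "t \<in> carrier (tensor_ab A S C)"
  shows "contr_l A S C \<phi> (tensor_map A S C S C h (\<lambda>x. x) t) = contr_l A S C (\<lambda>v. \<phi> (h v)) t"
proof -
  note cS = closed_mod_module[OF module_S] and cC = closed_mod_module[OF module_C]
  show ?thesis
    unfolding contr_l_def
    by (rule tensor_lift_map[OF cS cC cS cC h id_mod_hom module_abelian_group[OF module_C]
          balanced_l[OF module_S module_C \<phi>] t])
qed

lemma coeff_comod_hom:
  assumes "\<phi> \<in> functionals A S" "t \<in> comod_hom A C S S" "u \<in> carrier S"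
  shows "coeff \<phi> (t u) = coeff (\<lambda>v\<in>carrier S. \<phi> (t v)) u"
proof -
  have t: "t \<in> mod_hom A S S" and co: "tensor_map A S C S C t (\<lambda>x. x) (coact S u) = coact S (t u)"
    using assms(2,3) by (auto simp: comod_hom_def)
  have "coeff \<phi> (t u) = coeff (\<lambda>v. \<phi> (t v)) u"
    unfolding coeff_def co[symmetric] by (rule contr_l_tensor_map[OF assms(1) t coact_closed[OF assms(3)]])
  also have "\<dots> = coeff (\<lambda>v\<in>carrier S. \<phi> (t v)) u"
    by (rule coeff_cong[OF mod_hom_compose[OF t assms(1)] _ assms(3)]) simp
  finally show ?thesis .
qed

lemma lact_comod_hom: "b \<in> carrier B \<Longrightarrow> lact S b \<in> comod_hom A C S S"
  using bicomodule_S left_module.act_closed[of B "B_mod S" b] left_module.act_r_distr[of B "B_mod S" b]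
  by (auto simp: is_fgp_bicomodule_def comod_hom_def B_mod_def intro!: mod_homI)

lemma HomC: "f \<in> C_dual \<Longrightarrow> f \<in> functionals A C"
  and HomS: "\<phi> \<in> S_dual \<Longrightarrow> \<phi> \<in> functionals A S"
  by (simp_all add: Hom_def)

lemma ract_closed: "\<lbrakk>f \<in> functionals A C; c \<in> carrier C\<rbrakk> \<Longrightarrow> ract f c \<in> carrier C"
  using mod_homD(1)[OF ract_hom] .

lemma lact_closed: "\<lbrakk>f \<in> functionals A C; c \<in> carrier C\<rbrakk> \<Longrightarrow> lact_f f c \<in> carrier C"
  using mod_homD(1)[OF lact_hom] .

lemma sact_closed: "\<lbrakk>f \<in> functionals A C; u \<in> carrier S\<rbrakk> \<Longrightarrow> sact f u \<in> carrier S"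
  using mod_homD(1)[OF sact_hom] .

lemma coeff_closed: "\<lbrakk>\<phi> \<in> functionals A S; u \<in> carrier S\<rbrakk> \<Longrightarrow> coeff \<phi> u \<in> carrier C"
  using mod_homD(1)[OF coeff_hom] .

lemma Hom_closedS: "\<lbrakk>f \<in> S_dual; c \<in> carrier S\<rbrakk> \<Longrightarrow> f c \<in> carrier A"
  using functionalD(1)[OF HomS] .

text \<open>\<open>A\<close>-linear maps \<open>C \<rightarrow> C\<^sup>*\<close> are bilinear forms.\<close>

lemma form_transpose:
  assumes p: "p \<in> mod_hom A C (dual A C)"
  shows "(\<lambda>c. \<lambda>d\<in>carrier C. p d c) \<in> mod_hom A C (dual A C)"
proof (rule mod_homI)
  have pD: "p c \<in> C_dual" if "c \<in> carrier C" for c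
    using mod_homD(1)[OF p that] by simp
  fix c assume c: "c \<in> carrier C"
  show "(\<lambda>d\<in>carrier C. p d c) \<in> carrier (dual A C)"
    using c functionalD[OF HomC[OF pD]] mod_homD(2,3)[OF p]
    by (simp, intro HomI) auto
  show "(\<lambda>d\<in>carrier C. p d (c \<oplus>\<^bsub>C\<^esub> c')) =
      (\<lambda>d\<in>carrier C. p d c) \<oplus>\<^bsub>dual A C\<^esub> (\<lambda>d\<in>carrier C. p d c')" if "c' \<in> carrier C" for c'
    using c that functionalD(2)[OF HomC[OF pD]] by (auto intro!: restrict_ext)
  show "(\<lambda>d\<in>carrier C. p d (a \<odot>\<^bsub>C\<^esub> c)) = a \<odot>\<^bsub>dual A C\<^esub> (\<lambda>d\<in>carrier C. p d c)"
    if "a \<in> carrier A" for a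
    using c that functionalD(3)[OF HomC[OF pD]] by (auto intro!: restrict_ext)
qed

lemma form_closed:
  assumes "p \<in> mod_hom A C (dual A C)" "c \<in> carrier C"
  shows "p c \<in> C_dual"
  using mod_homD(1)[OF assms] by simp

lemma right_to_left_linear:
  assumes "right_linear A C p"
  shows "left_linear A C (\<lambda>c. \<lambda>d\<in>carrier C. p d c)"
  unfolding left_linear_def
proof (intro conjI ballI)
  have p: "p \<in> mod_hom A C (dual A C)" and
    lin: "\<And>f c d. \<lbrakk>f \<in> C_dual; c \<in> carrier C; d \<in> carrier C\<rbrakk> \<Longrightarrow> p (ract f c) d = f (ract (p c) d)"
    using assms by (auto simp: right_linear_def)
  show q: "(\<lambda>c. \<lambda>d\<in>carrier C. p d c) \<in> mod_hom A C (dual A C)" by (rule form_transpose[OF p])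
  fix f c d assume f: "f \<in> C_dual" and c: "c \<in> carrier C" and d: "d \<in> carrier C"
  note pd = HomC[OF form_closed[OF p d]] and f' = HomC[OF f]
  have qc: "(\<lambda>d\<in>carrier C. p d c) \<in> functionals A C"
    using HomC[OF form_closed[OF q c]] .
  have "p d (lact_f f c) = p (ract f d) c"
    using functional_ract[OF f' pd c] lin[OF f d c] by simp
  also have "\<dots> = (\<lambda>d\<in>carrier C. p d c) (ract f d)"
    using ract_closed[OF f' d] by simp
  also have "\<dots> = f (lact_f (\<lambda>d\<in>carrier C. p d c) d)"
    by (rule functional_ract[OF qc f' d])
  finally show "(\<lambda>d\<in>carrier C. p d (lact_f f c)) d = f (lact_f (\<lambda>d\<in>carrier C. p d c) d)"
    using d by simp
qed

lemma left_to_right_linear: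
  assumes "left_linear A C j"
  shows "right_linear A C (\<lambda>c. \<lambda>d\<in>carrier C. j d c)"
  unfolding right_linear_def
proof (intro conjI ballI)
  have j: "j \<in> mod_hom A C (dual A C)" and
    lin: "\<And>f c d. \<lbrakk>f \<in> C_dual; c \<in> carrier C; d \<in> carrier C\<rbrakk> \<Longrightarrow> j (lact_f f c) d = f (lact_f (j c) d)"
    using assms by (auto simp: left_linear_def)
  show q: "(\<lambda>c. \<lambda>d\<in>carrier C. j d c) \<in> mod_hom A C (dual A C)" by (rule form_transpose[OF j])
  fix f c d assume f: "f \<in> C_dual" and c: "c \<in> carrier C" and d: "d \<in> carrier C"
  note jd = HomC[OF form_closed[OF j d]] and f' = HomC[OF f]
  have qc: "(\<lambda>d\<in>carrier C. j d c) \<in> functionals A C"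
    using HomC[OF form_closed[OF q c]] .
  have "j d (ract f c) = j (lact_f f d) c"
    using functional_ract[OF jd f' c] lin[OF f d c] by simp
  also have "\<dots> = (\<lambda>d\<in>carrier C. j d c) (lact_f f d)"
    using lact_closed[OF f' d] by simp
  also have "\<dots> = f (ract (\<lambda>d\<in>carrier C. j d c) d)"
    by (rule functional_ract[OF f' qc d, symmetric])
  finally show "(\<lambda>d\<in>carrier C. j d (ract f c)) d = f (ract (\<lambda>d\<in>carrier C. j d c) d)"
    using d by simp
qed

lemma mod_hom_ldual_eq: "mod_hom A C (ldual A C) = mod_hom A C (dual A C)"
  and mod_hom_rdual_eq: "mod_hom A C (rdual A C) = mod_hom A C (dual A C)"
  by (simp_all add: mod_hom_def)

lemma right_coFrobenius_iff:
  "right_coFrobenius A C \<longleftrightarrow> locally_projective A C \<and> (\<exists>p. right_linear A C p \<and> inj_on p (carrier C))"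
proof -
  have "p \<in> mod_hom (ldual A C) (with_action C ract) (reg_right (ldual A C)) \<longleftrightarrow>
      (\<forall>f\<in>C_dual. \<forall>c\<in>carrier C. \<forall>d\<in>carrier C. p (ract f c) d = f (ract (p c) d))"
    if p: "p \<in> mod_hom A C (dual A C)" for p
  proof -
    have "p (ract f c) = (\<lambda>d\<in>carrier C. f (ract (p c) d)) \<longleftrightarrow>
        (\<forall>d\<in>carrier C. p (ract f c) d = f (ract (p c) d))"
      if "f \<in> C_dual" "c \<in> carrier C" for f c
      using HomD(4)[OF form_closed[OF p ract_closed[OF HomC[OF that(1)] that(2)]]]
      by (auto intro!: extensionalityI[of _ "carrier C"])
    then show ?thesis
      using p form_closed[OF p] by (auto simp: mod_hom_def)
  qed
  then show ?thesis
    unfolding right_coFrobenius_def right_linear_def mod_hom_ldual_eq by blast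
qed

lemma left_coFrobenius_iff:
  "left_coFrobenius A C \<longleftrightarrow> locally_projective A C \<and> (\<exists>p. left_linear A C p \<and> inj_on p (carrier C))"
proof -
  have "p \<in> mod_hom (rdual A C) (with_action C lact_f) (reg_left (rdual A C)) \<longleftrightarrow>
      (\<forall>f\<in>C_dual. \<forall>c\<in>carrier C. \<forall>d\<in>carrier C. p (lact_f f c) d = f (lact_f (p c) d))"
    if p: "p \<in> mod_hom A C (dual A C)" for p
  proof -
    have "p (lact_f f c) = (\<lambda>d\<in>carrier C. f (lact_f (p c) d)) \<longleftrightarrow>
        (\<forall>d\<in>carrier C. p (lact_f f c) d = f (lact_f (p c) d))"
      if "f \<in> C_dual" "c \<in> carrier C" for f c
      using HomD(4)[OF form_closed[OF p lact_closed[OF HomC[OF that(1)] that(2)]]]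
      by (auto intro!: extensionalityI[of _ "carrier C"])
    then show ?thesis
      using p form_closed[OF p] by (auto simp: mod_hom_def)
  qed
  then show ?thesis
    unfolding left_coFrobenius_def left_linear_def mod_hom_rdual_eq by blast
qed


section \<open>The bimodule \<open>Q\<close>\<close>

lemma module_dual_S: "module A (dual A S)"
  by (rule module_dual[OF module_S])

lemma eval_functional: "u \<in> carrier S \<Longrightarrow> (\<lambda>\<phi>. \<phi> u) \<in> functionals A (dual A S)"
  by (intro mod_homI) (auto simp: Hom_closedS)

lemma obtain_dual_basis:
  obtains n :: nat and e f where "\<And>i. i < n \<Longrightarrow> e i \<in> carrier S"
    and "\<And>i. i < n \<Longrightarrow> f i \<in> S_dual"
    and "\<And>u. u \<in> carrier S \<Longrightarrow> u = (\<Oplus>\<^bsub>S\<^esub>i\<in>{..<n}. f i u \<odot>\<^bsub>S\<^esub> e i)"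
    and "\<And>\<phi>. dual_coact A C S \<phi> =
      (\<Oplus>\<^bsub>tensor_ab A C (dual A S)\<^esub>i\<in>{..<n}. pure A C (dual A S) (coeff \<phi> (e i)) (f i))"
proof -
  define d where "d = (SOME d. is_dual_basis A S d)"
  have "\<exists>d. is_dual_basis A S d"
    using is_dual_basis_exists[OF module_S] bicomodule_S by (simp add: is_fgp_bicomodule_def)
  then have d: "is_dual_basis A S d" unfolding d_def by (rule someI_ex)
  obtain n e f where def: "d = (n, e, f)" by (cases d) auto
  show ?thesis
  proof (rule that[where n = n and e = e and f = f])
    show "dual_coact A C S \<phi> =
      (\<Oplus>\<^bsub>tensor_ab A C (dual A S)\<^esub>i\<in>{..<n}. pure A C (dual A S) (coeff \<phi> (e i)) (f i))" for \<phi>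
      unfolding dual_coact_def d_def[symmetric] by (simp add: def coeff_def contr_l_def)
  qed (use d in \<open>auto simp: def is_dual_basis_def\<close>)
qed

text \<open>Since \<open>\<Sigma>\<close> has a dual basis, the evaluations \<open>C \<otimes> \<Sigma>\<^sup>* \<rightarrow> C\<close> at the elements of \<open>\<Sigma>\<close> are
  jointly injective.\<close>

lemma tensor_dual_eqI:
  assumes x: "x \<in> carrier (tensor_ab A C (dual A S))" and y: "y \<in> carrier (tensor_ab A C (dual A S))"
    and eq: "\<And>u. u \<in> carrier S \<Longrightarrow>
      contr_r A C (dual A S) (\<lambda>\<phi>. \<phi> u) x = contr_r A C (dual A S) (\<lambda>\<phi>. \<phi> u) y"
  shows "x = y"
proof -
  let ?D = "dual A S"
  interpret D: module A ?D by (rule module_dual_S)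
  note cC = closed_mod_module[OF module_C] and cD = closed_mod_module[OF module_dual_S]
  interpret T: tensor_pair A C ?D using tensor_pairI[OF cC cD] .
  interpret AB: abelian_group "tensor_ab A C ?D" by (rule T.abelian_group_tensor_ab)
  obtain n :: nat and e f where e: "\<And>i. i < n \<Longrightarrow> e i \<in> carrier S"
    and f: "\<And>i. i < n \<Longrightarrow> f i \<in> S_dual"
    and sum: "\<And>u. u \<in> carrier S \<Longrightarrow> u = (\<Oplus>\<^bsub>S\<^esub>i\<in>{..<n}. f i u \<odot>\<^bsub>S\<^esub> e i)"
    by (rule obtain_dual_basis) blast
  have \<phi>_sum: "(\<Oplus>\<^bsub>?D\<^esub>i\<in>{..<n}. \<phi> (e i) \<odot>\<^bsub>?D\<^esub> f i) = \<phi>" if \<phi>: "\<phi> \<in> S_dual" for \<phi>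
  proof (rule Hom_eqI[where R = A and M = S and N = "reg_left A", OF _ \<phi>])
    have cl: "\<phi> (e i) \<odot>\<^bsub>?D\<^esub> f i \<in> carrier ?D" if "i < n" for i
      using that e f \<phi> Hom_closedS by (intro D.smult_closed) auto
    then have "(\<Oplus>\<^bsub>?D\<^esub>i\<in>{..<n}. \<phi> (e i) \<odot>\<^bsub>?D\<^esub> f i) \<in> carrier ?D"
      by (intro D.M.finsum_closed) auto
    then show "(\<Oplus>\<^bsub>?D\<^esub>i\<in>{..<n}. \<phi> (e i) \<odot>\<^bsub>?D\<^esub> f i) \<in> S_dual" by simp
    fix u assume u: "u \<in> carrier S"
    have "(\<Oplus>\<^bsub>?D\<^esub>i\<in>{..<n}. \<phi> (e i) \<odot>\<^bsub>?D\<^esub> f i) u = (\<Oplus>\<^bsub>A\<^esub>i\<in>{..<n}. (\<phi> (e i) \<odot>\<^bsub>?D\<^esub> f i) u)"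
      by (rule add_homs_finsum[OF module_abelian_group[OF module_dual_S] R.is_abelian_group eval_add_homs[OF u] _ cl])
        auto
    also have "\<dots> = (\<Oplus>\<^bsub>A\<^esub>i\<in>{..<n}. \<phi> (f i u \<odot>\<^bsub>S\<^esub> e i))"
      using u e f Hom_closedS[OF \<phi>] Hom_closedS[OF f u] functionalD(3)[OF HomS[OF \<phi>]]
      by (intro R.finsum_cong') (auto simp: R.m_comm)
    also have "\<dots> = \<phi> (\<Oplus>\<^bsub>S\<^esub>i\<in>{..<n}. f i u \<odot>\<^bsub>S\<^esub> e i)"
      by (rule add_homs_finsum[OF module_abelian_group[OF module_S] R.is_abelian_group, symmetric])
        (use mod_hom_add_homs[OF HomS[OF \<phi>]] e Hom_closedS[OF f u] in auto)
    also have "\<dots> = \<phi> u" using sum[OF u] by simp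
    finally show "(\<Oplus>\<^bsub>?D\<^esub>i\<in>{..<n}. \<phi> (e i) \<odot>\<^bsub>?D\<^esub> f i) u = \<phi> u" .
  qed
  define E where "E = (\<lambda>u. contr_r A C ?D (\<lambda>\<phi>. \<phi> u))"
  have E_hom: "E u \<in> add_homs (tensor_ab A C ?D) C" if "u \<in> carrier S" for u
    using mod_hom_add_homs[OF contr_r_hom[OF module_C module_dual_S eval_functional[OF that]]]
    by (simp add: E_def)
  have E_pure: "E u (pure A C ?D c \<phi>) = \<phi> u \<odot>\<^bsub>C\<^esub> c"
    if "u \<in> carrier S" "c \<in> carrier C" "\<phi> \<in> S_dual" for u c \<phi>
    using contr_r_pure[OF module_C module_dual_S eval_functional] that by (simp add: E_def)
  let ?k = "\<lambda>x. \<Oplus>\<^bsub>tensor_ab A C ?D\<^esub>i\<in>{..<n}. pure A C ?D (E (e i) x) (f i)"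
  have rec: "x = ?k x" if x: "x \<in> carrier (tensor_ab A C ?D)" for x
  proof (rule T.add_homs_eqI[where h = "\<lambda>x. x" and k = ?k, OF T.abelian_group_tensor_ab _ _ _ x])
    show "(\<lambda>x. x) \<in> add_homs (tensor_ab A C ?D) (tensor_ab A C ?D)" by (simp add: add_homs_def)
    show "?k \<in> add_homs (tensor_ab A C ?D) (tensor_ab A C ?D)"
    proof (rule add_homs_sum[OF T.abelian_group_tensor_ab])
      fix i assume "i \<in> {..<n}"
      then have i: "i < n" by simp
      have "(\<lambda>c. pure A C ?D c (f i)) \<in> add_homs C (tensor_ab A C ?D)"
        using T.balanced_pure f[OF i] by (simp add: balanced_def)
      then show "(\<lambda>x. pure A C ?D (E (e i) x) (f i)) \<in> add_homs (tensor_ab A C ?D) (tensor_ab A C ?D)"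
        by (rule add_homs_compose[OF E_hom[OF e[OF i]]])
    qed simp
    fix c \<phi> assume c: "c \<in> carrier C" and "\<phi> \<in> carrier ?D"
    then have \<phi>: "\<phi> \<in> S_dual" by simp
    have cl: "\<phi> (e i) \<odot>\<^bsub>?D\<^esub> f i \<in> carrier ?D" if "i < n" for i
      using that e f \<phi> Hom_closedS by (intro D.smult_closed) auto
    have pc: "pure A C ?D c \<in> add_homs ?D (tensor_ab A C ?D)"
      using T.balanced_pure c by (simp add: balanced_def)
    have "?k (pure A C ?D c \<phi>) = (\<Oplus>\<^bsub>tensor_ab A C ?D\<^esub>i\<in>{..<n}. pure A C ?D c (\<phi> (e i) \<odot>\<^bsub>?D\<^esub> f i))"
    proof (rule AB.finsum_cong')
      show "(\<lambda>i. pure A C ?D c (\<phi> (e i) \<odot>\<^bsub>?D\<^esub> f i)) \<in> {..<n} \<rightarrow> carrier (tensor_ab A C ?D)"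
        using cl c T.pure_closed by auto
      fix i assume "i \<in> {..<n}"
      then have i: "i < n" by simp
      have "pure A C ?D (\<phi> (e i) \<odot>\<^bsub>C\<^esub> c) (f i) = pure A C ?D c (\<phi> (e i) \<odot>\<^bsub>?D\<^esub> f i)"
        by (rule T.pure_act) (use c f[OF i] Hom_closedS[OF \<phi> e[OF i]] in auto)
      then show "pure A C ?D (E (e i) (pure A C ?D c \<phi>)) (f i) = pure A C ?D c (\<phi> (e i) \<odot>\<^bsub>?D\<^esub> f i)"
        using E_pure[OF e[OF i] c \<phi>] by simp
    qed simp
    also have "\<dots> = pure A C ?D c (\<Oplus>\<^bsub>?D\<^esub>i\<in>{..<n}. \<phi> (e i) \<odot>\<^bsub>?D\<^esub> f i)"
      by (rule add_homs_finsum[OF module_abelian_group[OF module_dual_S] T.abelian_group_tensor_ab pc, symmetric])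
        (use cl in auto)
    finally show "pure A C ?D c \<phi> = ?k (pure A C ?D c \<phi>)" using \<phi>_sum[OF \<phi>] by simp
  qed
  have "pure A C ?D (E (e i) x) (f i) = pure A C ?D (E (e i) y) (f i)" if "i < n" for i
    using eq[OF e[OF that]] by (simp add: E_def)
  moreover have "pure A C ?D (E (e i) y) (f i) \<in> carrier (tensor_ab A C ?D)" if "i < n" for i
    using T.pure_closed[OF add_homs_closed[OF E_hom[OF e[OF that]] y]] f[OF that] by simp
  ultimately have "?k x = ?k y" by (intro AB.finsum_cong') auto
  then show ?thesis using rec[OF x] rec[OF y] by simp
qed

text \<open>Left \<open>C\<close>-colinearity of \<open>q : C \<rightarrow> \<Sigma>\<^sup>*\<close>, evaluated at the elements of \<open>\<Sigma>\<close>: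
  \<open>c\<^sub>(\<^sub>1\<^sub>) q(c\<^sub>(\<^sub>2\<^sub>))(u) = q(c)(u\<^sub>[\<^sub>0\<^sub>]) u\<^sub>[\<^sub>1\<^sub>]\<close>.\<close>

lemma Q_set_iff:
  "q \<in> Q_set A C S \<longleftrightarrow> q \<in> Hom A C (dual A S) \<and>
    (\<forall>c\<in>carrier C. \<forall>u\<in>carrier S. ract (\<lambda>d\<in>carrier C. q d u) c = coeff (q c) u)"
proof -
  let ?D = "dual A S"
  interpret D: module A ?D by (rule module_dual_S)
  note cC = closed_mod_module[OF module_C] and cD = closed_mod_module[OF module_dual_S]
  interpret T: tensor_pair A C ?D using tensor_pairI[OF cC cD] .
  interpret AB: abelian_group "tensor_ab A C ?D" by (rule T.abelian_group_tensor_ab)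
  obtain n :: nat and e f where e: "\<And>i. i < n \<Longrightarrow> e i \<in> carrier S"
    and f: "\<And>i. i < n \<Longrightarrow> f i \<in> S_dual"
    and sum: "\<And>u. u \<in> carrier S \<Longrightarrow> u = (\<Oplus>\<^bsub>S\<^esub>i\<in>{..<n}. f i u \<odot>\<^bsub>S\<^esub> e i)"
    and dc: "\<And>\<phi>. dual_coact A C S \<phi> =
      (\<Oplus>\<^bsub>tensor_ab A C ?D\<^esub>i\<in>{..<n}. pure A C ?D (coeff \<phi> (e i)) (f i))"
    by (rule obtain_dual_basis) blast
  define E where "E = (\<lambda>u. contr_r A C ?D (\<lambda>\<phi>. \<phi> u))"
  have E_hom: "E u \<in> add_homs (tensor_ab A C ?D) C" if "u \<in> carrier S" for u
    using mod_hom_add_homs[OF contr_r_hom[OF module_C module_dual_S eval_functional[OF that]]]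
    by (simp add: E_def)
  have E_pure: "E u (pure A C ?D c \<phi>) = \<phi> u \<odot>\<^bsub>C\<^esub> c"
    if "u \<in> carrier S" "c \<in> carrier C" "\<phi> \<in> S_dual" for u c \<phi>
    using contr_r_pure[OF module_C module_dual_S eval_functional] that by (simp add: E_def)
  have dc_pure: "pure A C ?D (coeff \<phi> (e i)) (f i) \<in> carrier (tensor_ab A C ?D)"
    if "\<phi> \<in> S_dual" "i < n" for \<phi> i
    using that e f coeff_closed[OF HomS] by (intro T.pure_closed) auto
  have dc_closed: "dual_coact A C S \<phi> \<in> carrier (tensor_ab A C ?D)" if "\<phi> \<in> S_dual" for \<phi>
    unfolding dc using dc_pure[OF that] by (intro AB.finsum_closed) auto
  have E_dc: "E u (dual_coact A C S \<phi>) = coeff \<phi> u"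
    if u: "u \<in> carrier S" and \<phi>: "\<phi> \<in> S_dual" for u \<phi>
  proof -
    note co = coeff_hom[OF HomS[OF \<phi>]]
    have "E u (dual_coact A C S \<phi>) = (\<Oplus>\<^bsub>C\<^esub>i\<in>{..<n}. E u (pure A C ?D (coeff \<phi> (e i)) (f i)))"
      unfolding dc by (rule add_homs_finsum[OF T.abelian_group_tensor_ab module_abelian_group[OF module_C] E_hom[OF u]])
        (use dc_pure[OF \<phi>] in auto)
    also have "\<dots> = (\<Oplus>\<^bsub>C\<^esub>i\<in>{..<n}. coeff \<phi> (f i u \<odot>\<^bsub>S\<^esub> e i))"
      using e f mod_homD[OF co] Hom_closedS[OF f u]
      by (intro C.M.finsum_cong') (auto simp: E_pure[OF u])
    also have "\<dots> = coeff \<phi> (\<Oplus>\<^bsub>S\<^esub>i\<in>{..<n}. f i u \<odot>\<^bsub>S\<^esub> e i)"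
      by (rule add_homs_finsum[OF module_abelian_group[OF module_S] module_abelian_group[OF module_C]
            mod_hom_add_homs[OF co], symmetric]) (use e Hom_closedS[OF f u] in auto)
    finally show ?thesis using sum[OF u] by simp
  qed
  have "tensor_map A C C C ?D (\<lambda>x. x) q (comult C c) = dual_coact A C S (q c) \<longleftrightarrow>
      (\<forall>u\<in>carrier S. ract (\<lambda>d\<in>carrier C. q d u) c = coeff (q c) u)"
    if q: "q \<in> Hom A C ?D" and c: "c \<in> carrier C" for c
  proof -
    note qh = HomD(5)[OF q]
    have qc: "q c \<in> S_dual" using HomD(1)[OF q c] by simp
    let ?x = "tensor_map A C C C ?D (\<lambda>x. x) q (comult C c)"
    have x: "?x \<in> carrier (tensor_ab A C ?D)"
      by (rule add_homs_closed[OF tensor_map_hom[OF cC cC cC cD id_mod_hom qh] comult_closed[OF c]])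
    have Ex: "E u ?x = ract (\<lambda>d\<in>carrier C. q d u) c" if u: "u \<in> carrier S" for u
    proof -
      have "E u ?x = tensor_lift A C C C (\<lambda>x y. q y u \<odot>\<^bsub>C\<^esub> x) (comult C c)"
        unfolding E_def contr_r_def
        by (rule tensor_lift_map[OF cC cC cC cD id_mod_hom qh module_abelian_group[OF module_C]
              balanced_r[OF module_C module_dual_S eval_functional[OF u]] comult_closed[OF c]])
      also have "\<dots> = ract (\<lambda>d. q d u) c" by (simp add: ract_C_def)
      also have "\<dots> = ract (\<lambda>d\<in>carrier C. q d u) c"
        by (rule ract_cong[OF mod_hom_compose[OF qh eval_functional[OF u]] _ c]) simp
      finally show ?thesis .
    qed
    show ?thesis
    proof
      assume "?x = dual_coact A C S (q c)"
      then show "\<forall>u\<in>carrier S. ract (\<lambda>d\<in>carrier C. q d u) c = coeff (q c) u"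
        using Ex E_dc[OF _ qc] by metis
    next
      assume "\<forall>u\<in>carrier S. ract (\<lambda>d\<in>carrier C. q d u) c = coeff (q c) u"
      then show "?x = dual_coact A C S (q c)"
        using Ex E_dc[OF _ qc] by (intro tensor_dual_eqI[OF x dc_closed[OF qc]]) (simp add: E_def)
    qed
  qed
  then show ?thesis by (auto simp: Q_set_def)
qed

lemma Q_setD:
  assumes "q \<in> Q_set A C S"
  shows "q \<in> Hom A C (dual A S)" and "c \<in> carrier C \<Longrightarrow> q c \<in> S_dual"
    and "u \<in> carrier S \<Longrightarrow> (\<lambda>c\<in>carrier C. q c u) \<in> C_dual"
    and "\<lbrakk>c \<in> carrier C; u \<in> carrier S\<rbrakk> \<Longrightarrow> ract (\<lambda>d\<in>carrier C. q d u) c = coeff (q c) u"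
proof -
  show q: "q \<in> Hom A C (dual A S)" using assms by (simp add: Q_set_iff)
  show "c \<in> carrier C \<Longrightarrow> q c \<in> S_dual" using HomD(1)[OF q] by simp
  show "u \<in> carrier S \<Longrightarrow> (\<lambda>c\<in>carrier C. q c u) \<in> C_dual"
    using Hom_restrictI[OF closed_mod_module[OF module_C] mod_hom_compose[OF HomD(5)[OF q] eval_functional]] .
  show "\<lbrakk>c \<in> carrier C; u \<in> carrier S\<rbrakk> \<Longrightarrow> ract (\<lambda>d\<in>carrier C. q d u) c = coeff (q c) u"
    using assms by (simp add: Q_set_iff)
qed

section \<open>Maps from \<open>\<Sigma>\<^sup>*\<close> to \<open>Q\<close> given by bilinear forms\<close>

text \<open>A map \<open>p : C \<rightarrow> \<^sup>*C\<close> gives \<open>\<phi> \<mapsto> (c \<mapsto> (u \<mapsto> p(\<phi>(u\<^sub>[\<^sub>0\<^sub>]) u\<^sub>[\<^sub>1\<^sub>])(c)))\<close>.\<close>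

definition coeff_map :: "('c \<Rightarrow> 'c \<Rightarrow> 'a) \<Rightarrow> ('s \<Rightarrow> 'a) \<Rightarrow> 'c \<Rightarrow> 's \<Rightarrow> 'a" where
  "coeff_map p \<phi> = (\<lambda>c\<in>carrier C. \<lambda>u\<in>carrier S. p (coeff \<phi> u) c)"

lemma coeff_map_apply:
  "\<lbrakk>c \<in> carrier C; u \<in> carrier S\<rbrakk> \<Longrightarrow> coeff_map p \<phi> c u = p (coeff \<phi> u) c"
  by (simp add: coeff_map_def)

lemma coeff_map_Hom:
  assumes p: "p \<in> mod_hom A C (dual A C)" and \<phi>: "\<phi> \<in> S_dual"
  shows "coeff_map p \<phi> \<in> Hom A C (dual A S)"
proof -
  note co = coeff_hom[OF HomS[OF \<phi>]]
  have pD: "p c \<in> functionals A C" if "c \<in> carrier C" for c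
    using HomC[OF form_closed[OF p that]] .
  have "coeff_map p \<phi> c \<in> S_dual" if c: "c \<in> carrier C" for c
    using c mod_homD[OF co] mod_homD(2,3)[OF p] functionalD(1)[OF pD]
    by (intro HomI) (simp_all add: coeff_map_def)
  then show ?thesis
    using mod_homD(1)[OF co] functionalD[OF pD]
    by (intro HomI) (auto simp: coeff_map_def intro!: restrict_ext)
qed

lemma coeff_map_Q:
  assumes lp: "locally_projective A C" and p: "right_linear A C p" and \<phi>: "\<phi> \<in> S_dual"
  shows "coeff_map p \<phi> \<in> Q_set A C S"
  unfolding Q_set_iff
proof (intro conjI ballI)
  have pm: "p \<in> mod_hom A C (dual A C)"
    and lin: "\<And>f c d. \<lbrakk>f \<in> C_dual; c \<in> carrier C; d \<in> carrier C\<rbrakk> \<Longrightarrow> p (ract f c) d = f (ract (p c) d)"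
    using p by (auto simp: right_linear_def)
  show h: "coeff_map p \<phi> \<in> Hom A C (dual A S)" by (rule coeff_map_Hom[OF pm \<phi>])
  fix c u assume c: "c \<in> carrier C" and u: "u \<in> carrier S"
  note cl = coeff_closed[OF HomS[OF \<phi>] u]
  have qc: "coeff_map p \<phi> c \<in> functionals A S" using HomD(1)[OF h c] by (simp add: HomS)
  have pf: "p (coeff \<phi> u) \<in> functionals A C" by (rule HomC[OF form_closed[OF pm cl]])
  have r: "ract (\<lambda>d\<in>carrier C. coeff_map p \<phi> d u) c = ract (p (coeff \<phi> u)) c"
    by (rule ract_cong[OF pf _ c, symmetric]) (simp add: coeff_map_def u)
  show "ract (\<lambda>d\<in>carrier C. coeff_map p \<phi> d u) c = coeff (coeff_map p \<phi> c) u"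
    unfolding r
  proof (rule locally_projective_separates[OF module_C lp])
    fix f assume f: "f \<in> C_dual"
    have "f (ract (p (coeff \<phi> u)) c) = p (coeff \<phi> (sact f u)) c"
      using lin[OF f cl c] coeff_sact[OF HomC[OF f] HomS[OF \<phi>] u] by simp
    also have "\<dots> = f (coeff (coeff_map p \<phi> c) u)"
      using functional_coeff[OF HomC[OF f] qc u] coeff_map_apply[OF c sact_closed[OF HomC[OF f] u]] by simp
    finally show "f (ract (p (coeff \<phi> u)) c) = f (coeff (coeff_map p \<phi> c) u)" .
  qed (use ract_closed[OF pf c] coeff_closed[OF qc u] in auto)
qed

lemma coeff_map_bimod_hom:
  assumes lp: "locally_projective A C" and p: "right_linear A C p"
  shows "coeff_map p \<in> bimod_homs A B C S"
proof -
  have pm: "p \<in> mod_hom A C (dual A C)" using p by (simp add: right_linear_def)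
  have pD: "p c \<in> functionals A C" if "c \<in> carrier C" for c
    using HomC[OF form_closed[OF pm that]] .
  note Q = coeff_map_Q[OF lp p]
  have add: "coeff_map p (\<phi> \<oplus>\<^bsub>dual A S\<^esub> \<psi>) = (\<lambda>c\<in>carrier C. coeff_map p \<phi> c \<oplus>\<^bsub>dual A S\<^esub> coeff_map p \<psi> c)"
    if "\<phi> \<in> S_dual" "\<psi> \<in> S_dual" for \<phi> \<psi>
    unfolding coeff_map_def
    using that coeff_plus[OF HomS HomS] coeff_closed[OF HomS] mod_homD(2)[OF pm]
    by (auto intro!: restrict_ext)
  have "coeff_map p \<in> mod_hom A (dual A S) (Q_A A C S)"
  proof (rule mod_homI)
    fix a \<phi> assume a: "a \<in> carrier A" and "\<phi> \<in> carrier (dual A S)"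
    then have \<phi>: "\<phi> \<in> S_dual" by simp
    show "coeff_map p (a \<odot>\<^bsub>dual A S\<^esub> \<phi>) = a \<odot>\<^bsub>Q_A A C S\<^esub> coeff_map p \<phi>"
      using a \<phi> coeff_smult[OF HomS[OF \<phi>] a] coeff_closed[OF HomS[OF \<phi>]] mod_homD(3)[OF pm a]
        functionalD(3)[OF pD]
      by (auto simp: coeff_map_def intro!: restrict_ext)
  qed (use Q add in auto)
  moreover have "coeff_map p \<in> mod_hom B (dual_B A S) (Q_B A C S)"
  proof (rule mod_homI)
    fix b \<phi> assume b: "b \<in> carrier B" and "\<phi> \<in> carrier (dual_B A S)"
    then have \<phi>: "\<phi> \<in> S_dual" by simp
    have "lact S b u \<in> carrier S" if "u \<in> carrier S" for u
      using lact_comod_hom[OF b] that by (auto simp: comod_hom_def mod_hom_def)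
    then show "coeff_map p (b \<odot>\<^bsub>dual_B A S\<^esub> \<phi>) = b \<odot>\<^bsub>Q_B A C S\<^esub> coeff_map p \<phi>"
      using coeff_comod_hom[OF HomS[OF \<phi>] lact_comod_hom[OF b]]
      by (auto simp: coeff_map_def intro!: restrict_ext)
  qed (use Q add in auto)
  ultimately show ?thesis by (simp add: bimod_homs_def)
qed

lemma coeff_map_inj:
  assumes p: "right_linear A C p" and inj: "inj_on p (carrier C)"
  shows "inj_on (coeff_map p) (S_dual)"
proof (rule inj_onI)
  have pm: "p \<in> mod_hom A C (dual A C)" using p by (simp add: right_linear_def)
  fix \<phi> \<psi> assume \<phi>: "\<phi> \<in> S_dual" and \<psi>: "\<psi> \<in> S_dual"
    and eq: "coeff_map p \<phi> = coeff_map p \<psi>"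
  show "\<phi> = \<psi>"
  proof (rule Hom_eqI[OF \<phi> \<psi>])
    fix u assume u: "u \<in> carrier S"
    note cl = coeff_closed[OF HomS[OF \<phi>] u] coeff_closed[OF HomS[OF \<psi>] u]
    have "p (coeff \<phi> u) = p (coeff \<psi> u)"
    proof (rule Hom_eqI[OF form_closed[OF pm cl(1)] form_closed[OF pm cl(2)]])
      fix c assume "c \<in> carrier C"
      then show "p (coeff \<phi> u) c = p (coeff \<psi> u) c" using eq u coeff_map_apply by metis
    qed
    then have "coeff \<phi> u = coeff \<psi> u" using inj cl by (meson inj_onD)
    then show "\<phi> u = \<psi> u" using counit_coeff[OF HomS[OF \<phi>] u] counit_coeff[OF HomS[OF \<psi>] u] by simp
  qed
qed

text \<open>If the form \<open>p\<close> is nondegenerate in its second argument, then the functionals \<open>p(d)\<close>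
  take the values of the counit on any given finite set, for suitable \<open>d\<close>.\<close>

lemma counit_interpolation:
  assumes cog: "cogenerator_mod TYPE(('a, 'b, 'c, 's) univ) A (reg_right A)"
    and p: "p \<in> mod_hom A C (dual A C)" and inj: "inj_on (\<lambda>c. \<lambda>d\<in>carrier C. p d c) (carrier C)"
    and F: "finite F" "F \<subseteq> carrier C"
  shows "\<exists>d\<in>carrier C. \<forall>x\<in>F. p d x = counit C x"
proof -
  let ?AF = "with_action (fun_group (F \<rightarrow>\<^sub>E carrier A) F A) (\<lambda>r y. \<lambda>i\<in>F. r \<otimes>\<^bsub>A\<^esub> y i)"
  interpret AF: module A ?AF by (rule module_functions[OF cring_A])
  have pD: "p c \<in> functionals A C" if "c \<in> carrier C" for c
    using HomC[OF form_closed[OF p that]] .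
  define b where "b = (\<lambda>d. \<lambda>x\<in>F. p d x)"
  have b: "b \<in> mod_hom A C ?AF"
    using F mod_homD(2,3)[OF p] functionalD(1)[OF pD]
    by (intro mod_homI) (auto simp: b_def subset_iff intro!: restrict_ext)
  define L where "L = b ` carrier C"
  have L: "submodule L A ?AF"
    unfolding L_def by (rule submodule_image[OF module_C AF.module_axioms b])
  define v where "v = (\<lambda>x\<in>F. counit C x)"
  have v: "v \<in> F \<rightarrow>\<^sub>E carrier A"
    using F functionalD(1)[OF counit_functional] by (auto simp: v_def)
  \<comment> \<open>A function on \<open>F\<close> is coded by its graph.\<close>
  define e :: "('c \<Rightarrow> 'a) \<Rightarrow> ('a, 'b, 'c, 's) univ" where
    "e = (\<lambda>y. (\<lambda>x. (0, y x, undefined, x, undefined)) ` F)"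
  have e: "inj_on e (F \<rightarrow>\<^sub>E carrier A)"
  proof (rule inj_onI)
    fix y y' assume y: "y \<in> F \<rightarrow>\<^sub>E carrier A" "y' \<in> F \<rightarrow>\<^sub>E carrier A" and eq: "e y = e y'"
    have "y x = y' x" if "x \<in> F" for x
    proof -
      have "(0, y x, undefined, x, undefined) \<in> e y'"
        unfolding eq[symmetric] unfolding e_def using that by blast
      then show ?thesis by (auto simp: e_def)
    qed
    then show "y = y'" using y by (intro PiE_ext)
  qed
  have "v \<in> L"
  proof (rule cogenerator_interpolate[OF cring_A cog F(1) e L v])
    fix a assume a: "a \<in> F \<rightarrow> carrier A" and rel: "\<And>y. y \<in> L \<Longrightarrow> (\<Oplus>\<^bsub>A\<^esub>i\<in>F. y i \<otimes>\<^bsub>A\<^esub> a i) = \<zero>\<^bsub>A\<^esub>"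
    have a': "a i \<in> carrier A" "i \<in> carrier C" if "i \<in> F" for i using a F that by auto
    define z where "z = (\<Oplus>\<^bsub>C\<^esub>i\<in>F. a i \<odot>\<^bsub>C\<^esub> i)"
    have z: "z \<in> carrier C" unfolding z_def using a' by (intro C.M.finsum_closed) auto
    have fz: "f z = (\<Oplus>\<^bsub>A\<^esub>i\<in>F. f i \<otimes>\<^bsub>A\<^esub> a i)" if f: "f \<in> functionals A C" for f
    proof -
      have "f z = (\<Oplus>\<^bsub>A\<^esub>i\<in>F. f (a i \<odot>\<^bsub>C\<^esub> i))"
        unfolding z_def
        by (rule add_homs_finsum[OF module_abelian_group[OF module_C] R.is_abelian_group _ F(1)])
          (use mod_hom_add_homs[OF f] a' in auto)
      also have "\<dots> = (\<Oplus>\<^bsub>A\<^esub>i\<in>F. f i \<otimes>\<^bsub>A\<^esub> a i)"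
        using a' functionalD[OF f] by (intro R.finsum_cong') (auto simp: R.m_comm)
      finally show ?thesis .
    qed
    have f0: "f \<zero>\<^bsub>C\<^esub> = \<zero>\<^bsub>A\<^esub>" if "f \<in> functionals A C" for f
      using mod_hom_zero[OF module_C module_reg_left[OF cring_A] that] by simp
    have "p d z = \<zero>\<^bsub>A\<^esub>" if d: "d \<in> carrier C" for d
    proof -
      have "(\<Oplus>\<^bsub>A\<^esub>i\<in>F. b d i \<otimes>\<^bsub>A\<^esub> a i) = (\<Oplus>\<^bsub>A\<^esub>i\<in>F. p d i \<otimes>\<^bsub>A\<^esub> a i)"
        using a' functionalD(1)[OF pD[OF d]] by (intro R.finsum_cong') (auto simp: b_def)
      then show ?thesis using fz[OF pD[OF d]] rel[of "b d"] d by (simp add: L_def)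
    qed
    then have "(\<lambda>d\<in>carrier C. p d z) = (\<lambda>d\<in>carrier C. p d \<zero>\<^bsub>C\<^esub>)"
      using f0[OF pD] by (auto intro!: restrict_ext)
    then have "z = \<zero>\<^bsub>C\<^esub>" using inj_onD[OF inj, of z "\<zero>\<^bsub>C\<^esub>"] z by simp
    then have "(\<Oplus>\<^bsub>A\<^esub>i\<in>F. counit C i \<otimes>\<^bsub>A\<^esub> a i) = \<zero>\<^bsub>A\<^esub>"
      using fz[OF counit_functional] f0[OF counit_functional] by simp
    moreover have "(\<Oplus>\<^bsub>A\<^esub>i\<in>F. v i \<otimes>\<^bsub>A\<^esub> a i) = (\<Oplus>\<^bsub>A\<^esub>i\<in>F. counit C i \<otimes>\<^bsub>A\<^esub> a i)"
      using a' functionalD(1)[OF counit_functional] by (intro R.finsum_cong') (auto simp: v_def)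
    ultimately show "(\<Oplus>\<^bsub>A\<^esub>i\<in>F. v i \<otimes>\<^bsub>A\<^esub> a i) = \<zero>\<^bsub>A\<^esub>" by simp
  qed
  then obtain d where d: "d \<in> carrier C" "v = b d" by (auto simp: L_def)
  have "p d x = counit C x" if "x \<in> F" for x
    using fun_cong[OF d(2), of x] that by (simp add: v_def b_def)
  then show ?thesis using d(1) by blast
qed

text \<open>In \<open>c = c\<^sub>(\<^sub>1\<^sub>) \<epsilon>(c\<^sub>(\<^sub>2\<^sub>))\<close> only finitely many values of the counit matter, and \<open>p(d)\<close> can be made to
  take them.\<close>

lemma local_unit:
  assumes cog: "cogenerator_mod TYPE(('a, 'b, 'c, 's) univ) A (reg_right A)"
    and p: "p \<in> mod_hom A C (dual A C)" and inj: "inj_on (\<lambda>c. \<lambda>d\<in>carrier C. p d c) (carrier C)"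
    and F: "finite F" "F \<subseteq> carrier C"
  shows "\<exists>d\<in>carrier C. \<forall>c\<in>F. ract (p d) c = c"
proof -
  have pD: "p c \<in> functionals A C" if "c \<in> carrier C" for c
    using HomC[OF form_closed[OF p that]] .
  define P where "P c X \<longleftrightarrow> finite X \<and> X \<subseteq> carrier C \<and> (\<forall>f\<in>functionals A C. \<forall>g\<in>functionals A C.
      (\<forall>n\<in>X. f n = g n) \<longrightarrow> ract f c = ract g c)" for c X
  have "\<forall>c\<in>F. \<exists>X. P c X"
    unfolding ract_eq P_def
    using contr_r_finite_support[OF module_C module_C comult_closed] F(2) by blast
  then obtain X where X': "\<forall>c\<in>F. P c (X c)" using bchoice by metis
  have X: "finite (X c)" "X c \<subseteq> carrier C" if "c \<in> F" for c
    using X' that by (auto simp: P_def)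
  have X_eq: "ract f c = ract g c"
    if "c \<in> F" "f \<in> functionals A C" "g \<in> functionals A C" "\<forall>n\<in>X c. f n = g n" for c f g
    using X' that unfolding P_def by blast
  have "finite (\<Union>c\<in>F. X c)" "(\<Union>c\<in>F. X c) \<subseteq> carrier C" using F X by auto
  then obtain d where d: "d \<in> carrier C" "\<forall>x\<in>(\<Union>c\<in>F. X c). p d x = counit C x"
    using counit_interpolation[OF cog p inj] by blast
  have "ract (p d) c = c" if "c \<in> F" for c
    using X_eq[OF that pD[OF d(1)] counit_functional] d(2) that ract_counit F(2) by auto
  then show ?thesis using d(1) by blast
qed

text \<open>If \<open>p(d)\<close> fixes the elements of a finite set \<open>F\<close>, then \<open>q\<close> agrees on \<open>F\<close> with the image of
  \<open>q(d)\<close>. Hence the value at \<open>u \<cdot> p(-)(c)\<close> that a preimage of \<open>q\<close> must have is that of \<open>q(d)\<close>, for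
  all \<open>d\<close> far enough out. These eventual values form a functional on a submodule of \<open>\<Sigma>\<close>, which
  injectivity of \<open>A\<close> extends.\<close>

lemma coeff_map_surj:
  assumes inj_A: "injective_mod TYPE(('a, 'b, 'c, 's) univ) A (reg_right A)"
    and cog: "cogenerator_mod TYPE(('a, 'b, 'c, 's) univ) A (reg_right A)"
    and p: "right_linear A C p" and inj: "inj_on (\<lambda>c. \<lambda>d\<in>carrier C. p d c) (carrier C)"
    and q: "q \<in> Q_set A C S"
  shows "\<exists>\<phi>\<in>S_dual. coeff_map p \<phi> = q"
proof -
  have pm: "p \<in> mod_hom A C (dual A C)"
    and lin: "\<And>f c d. \<lbrakk>f \<in> C_dual; c \<in> carrier C; d \<in> carrier C\<rbrakk> \<Longrightarrow> p (ract f c) d = f (ract (p c) d)"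
    using p by (auto simp: right_linear_def)
  define j where "j = (\<lambda>c. \<lambda>d\<in>carrier C. p d c)"
  have j: "j c \<in> functionals A C" if "c \<in> carrier C" for c
    using HomC[OF form_closed[OF form_transpose[OF pm] that]] by (simp add: j_def)
  have qf: "q d \<in> functionals A S" if "d \<in> carrier C" for d using HomS[OF Q_setD(2)[OF q that]] .
  note qD = functionalD[OF qf]
  \<comment> \<open>\<open>p(d)\<close> fixes the elements of \<open>F\<close>.\<close>
  define good where "good = (\<lambda>F d. d \<in> carrier C \<and> (\<forall>c\<in>F. ract (p d) c = c))"
  have good: "\<exists>d. good F d" if "finite F" "F \<subseteq> carrier C" for F
    using local_unit[OF cog pm inj that] by (auto simp: good_def)
  have good_q: "q d (sact (j c) u) = q c u"
    if "good {c} d" and c: "c \<in> carrier C" and u: "u \<in> carrier S" for c d u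
  proof -
    have d: "d \<in> carrier C" and dc: "ract (p d) c = c" using that(1) by (auto simp: good_def)
    have "q c u = (\<lambda>x\<in>carrier C. q x u) (ract (p d) c)" using dc c by simp
    also have "\<dots> = p (ract (\<lambda>x\<in>carrier C. q x u) d) c"
      by (rule lin[OF Q_setD(3)[OF q u] d c, symmetric])
    also have "\<dots> = j c (coeff (q d) u)"
      using Q_setD(4)[OF q d u] coeff_closed[OF qf[OF d] u] by (simp add: j_def)
    also have "\<dots> = q d (sact (j c) u)" by (rule functional_coeff[OF j[OF c] qf[OF d] u])
    finally show ?thesis ..
  qed
  \<comment> \<open>\<open>a\<close> is the eventual value at \<open>x\<close> of the functionals \<open>q(d)\<close>.\<close>
  define ev_on where "ev_on = (\<lambda>F x a. finite F \<and> F \<subseteq> carrier C \<and> (\<forall>d. good F d \<longrightarrow> q d x = a))"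
  define ev where "ev = (\<lambda>x a. \<exists>F. ev_on F x a)"
  have ev_onD: "finite F" "F \<subseteq> carrier C" "\<And>d. good F d \<Longrightarrow> q d x = a" if "ev_on F x a" for F x a
    using that by (simp_all add: ev_on_def)
  have good_Un: "good (F \<union> G) d \<longleftrightarrow> good F d \<and> good G d" for F G d by (auto simp: good_def)
  have ev2: "\<exists>d\<in>carrier C. q d x = a \<and> q d y = b" if "ev x a" "ev y b" for x y a b
  proof -
    from that(1) obtain F where F: "ev_on F x a" unfolding ev_def ..
    from that(2) obtain G where G: "ev_on G y b" unfolding ev_def ..
    obtain d where "good (F \<union> G) d"
      using good[of "F \<union> G"] ev_onD(1,2)[OF F] ev_onD(1,2)[OF G] by auto
    then show ?thesis using ev_onD(3)[OF F] ev_onD(3)[OF G] good_Un by (auto simp: good_def)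
  qed
  have ev_unique: "a = b" if "ev x a" "ev x b" for x a b using ev2[OF that] by auto
  have ev_carrier: "a \<in> carrier A" if "ev x a" "x \<in> carrier S" for x a
    using ev2[OF that(1) that(1)] qD(1) that(2) by auto
  have ev_add: "ev (x \<oplus>\<^bsub>S\<^esub> y) (a \<oplus>\<^bsub>A\<^esub> b)"
    if "ev x a" "ev y b" and xy: "x \<in> carrier S" "y \<in> carrier S" for x y a b
  proof -
    from that(1) obtain F where F: "ev_on F x a" unfolding ev_def ..
    from that(2) obtain G where G: "ev_on G y b" unfolding ev_def ..
    have "q d (x \<oplus>\<^bsub>S\<^esub> y) = a \<oplus>\<^bsub>A\<^esub> b" if "good (F \<union> G) d" for d
      using ev_onD(3)[OF F, of d] ev_onD(3)[OF G, of d] that qD(2)[of d x y] xy good_Un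
      by (auto simp: good_def)
    then have "ev_on (F \<union> G) (x \<oplus>\<^bsub>S\<^esub> y) (a \<oplus>\<^bsub>A\<^esub> b)"
      using ev_onD(1,2)[OF F] ev_onD(1,2)[OF G] by (simp add: ev_on_def)
    then show ?thesis unfolding ev_def ..
  qed
  have ev_act: "ev (r \<odot>\<^bsub>S\<^esub> x) (r \<otimes>\<^bsub>A\<^esub> a)" if "ev x a" "x \<in> carrier S" "r \<in> carrier A" for x a r
  proof -
    from that(1) obtain F where F: "ev_on F x a" unfolding ev_def ..
    have "q d (r \<odot>\<^bsub>S\<^esub> x) = r \<otimes>\<^bsub>A\<^esub> a" if "good F d" for d
      using ev_onD(3)[OF F that] qD(3)[of d r x] that \<open>x \<in> carrier S\<close> \<open>r \<in> carrier A\<close>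
      by (simp add: good_def)
    then have "ev_on F (r \<odot>\<^bsub>S\<^esub> x) (r \<otimes>\<^bsub>A\<^esub> a)"
      using ev_onD(1,2)[OF F] by (simp add: ev_on_def)
    then show ?thesis unfolding ev_def ..
  qed
  have "ev_on {} \<zero>\<^bsub>S\<^esub> \<zero>\<^bsub>A\<^esub>"
    using mod_hom_zero[OF module_S module_reg_left[OF cring_A] qf] by (simp add: ev_on_def good_def)
  then have ev_zero: "ev \<zero>\<^bsub>S\<^esub> \<zero>\<^bsub>A\<^esub>" unfolding ev_def ..
  define L where "L = {x \<in> carrier S. \<exists>a. ev x a}"
  define h where "h = (\<lambda>x. THE a. ev x a)"
  have h_eq: "h x = a" if "ev x a" for x a
    unfolding h_def using that ev_unique by blast
  have L_ev: "ev x (h x)" "x \<in> carrier S" if "x \<in> L" for x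
    using that h_eq by (auto simp: L_def)
  have L: "submodule L A S"
  proof (rule S.submoduleI)
    show act: "r \<odot>\<^bsub>S\<^esub> x \<in> L" if "r \<in> carrier A" "x \<in> L" for r x
      using ev_act[OF L_ev[OF that(2)] that(1)] L_ev(2)[OF that(2)] that(1) by (auto simp: L_def)
    show "\<ominus>\<^bsub>S\<^esub> x \<in> L" if "x \<in> L" for x
      using act[OF _ that, of "\<ominus>\<^bsub>A\<^esub> \<one>\<^bsub>A\<^esub>"] S.smult_l_minus[of "\<one>\<^bsub>A\<^esub>" x] L_ev(2)[OF that] by simp
    show "x \<oplus>\<^bsub>S\<^esub> y \<in> L" if "x \<in> L" "y \<in> L" for x y
      using ev_add[OF L_ev(1)[OF that(1)] L_ev(1)[OF that(2)]] L_ev(2)[OF that(1)] L_ev(2)[OF that(2)]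
      by (auto simp: L_def)
  qed (use ev_zero in \<open>auto simp: L_def\<close>)
  have h: "h \<in> mod_hom A (S\<lparr>carrier := L\<rparr>) (reg_left A)"
  proof (rule mod_homI)
    fix x assume "x \<in> carrier (S\<lparr>carrier := L\<rparr>)"
    then have x: "x \<in> L" by simp
    show "h x \<in> carrier (reg_left A)" using ev_carrier[OF L_ev[OF x]] by simp
    show "h (r \<odot>\<^bsub>S\<lparr>carrier := L\<rparr>\<^esub> x) = r \<odot>\<^bsub>reg_left A\<^esub> h x" if "r \<in> carrier A" for r
      using h_eq[OF ev_act[OF L_ev[OF x] that]] by simp
    show "h (x \<oplus>\<^bsub>S\<lparr>carrier := L\<rparr>\<^esub> y) = h x \<oplus>\<^bsub>reg_left A\<^esub> h y" if "y \<in> carrier (S\<lparr>carrier := L\<rparr>)" for y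
      using h_eq[OF ev_add[OF L_ev(1)[OF x] L_ev(1)]] L_ev(2)[OF x] L_ev(2)[of y] that by simp
  qed
  define e :: "'s \<Rightarrow> ('a, 'b, 'c, 's) univ" where "e = (\<lambda>x. {(0, undefined, undefined, undefined, x)})"
  have "inj_on e (carrier S)" by (auto simp: e_def inj_on_def)
  then obtain g where g: "g \<in> functionals A S" "\<And>x. x \<in> L \<Longrightarrow> g x = h x"
    using injective_extend[OF inj_A module_S _ L h] by blast
  define \<phi> where "\<phi> = (\<lambda>u\<in>carrier S. g u)"
  have \<phi>: "\<phi> \<in> S_dual"
    unfolding \<phi>_def by (rule Hom_restrictI[OF closed_mod_module[OF module_S] g(1)])
  have \<phi>_val: "coeff_map p \<phi> c u = q c u" if c: "c \<in> carrier C" and u: "u \<in> carrier S" for c u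
  proof -
    note sc = sact_closed[OF j[OF c] u]
    have "ev_on {c} (sact (j c) u) (q c u)" by (simp add: ev_on_def good_q c u)
    then have ev: "ev (sact (j c) u) (q c u)" unfolding ev_def ..
    have "coeff_map p \<phi> c u = j c (coeff \<phi> u)"
      using c u coeff_closed[OF HomS[OF \<phi>] u] by (simp add: coeff_map_def j_def)
    also have "\<dots> = \<phi> (sact (j c) u)" by (rule functional_coeff[OF j[OF c] HomS[OF \<phi>] u])
    also have "\<dots> = h (sact (j c) u)" using g(2)[of "sact (j c) u"] ev sc by (auto simp: \<phi>_def L_def)
    also have "\<dots> = q c u" by (rule h_eq[OF ev])
    finally show ?thesis .
  qed
  note cm = coeff_map_Hom[OF pm \<phi>]
  have "coeff_map p \<phi> = q"
  proof (rule Hom_eqI[OF cm Q_setD(1)[OF q]])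
    fix c assume c: "c \<in> carrier C"
    show "coeff_map p \<phi> c = q c"
      by (rule Hom_eqI[OF HomD(1)[OF cm c, simplified] Q_setD(2)[OF q c]]) (rule \<phi>_val[OF c])
  qed
  then show ?thesis using \<phi> by blast
qed

section \<open>From maps \<open>\<Sigma>\<^sup>* \<rightarrow> Q\<close> to bilinear forms\<close>

lemma lact_S_mod_hom: "b \<in> carrier B \<Longrightarrow> lact S b \<in> mod_hom A S S"
  using lact_comod_hom by (simp add: comod_hom_def)

lemma closed_B_mod: "closed_mod B (B_mod S)"
  using mod_homD(1)[OF lact_S_mod_hom] by (simp add: closed_mod_def B_mod_def)

lemma closed_dual_B: "closed_mod B (dual_B A S)"
proof -
  interpret D: module A "dual A S" by (rule module_dual_S)
  have "(\<lambda>u\<in>carrier S. g (lact S b u)) \<in> S_dual"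
    if "b \<in> carrier B" "g \<in> S_dual" for b g
    by (rule Hom_restrictI[OF closed_mod_module[OF module_S]
          mod_hom_compose[OF lact_S_mod_hom[OF that(1)] HomS[OF that(2)]]])
  then show ?thesis using D.a_closed by (simp add: closed_mod_def)
qed

lemma B_mod_simps: "carrier (B_mod S) = carrier S" "ring.add (B_mod S) = ring.add S" "smult (B_mod S) = lact S"
  by (simp_all add: B_mod_def)

lemma balanced_coeff: "balanced B (dual_B A S) (B_mod S) C coeff"
proof (rule balancedI)
  fix b g u assume *: "b \<in> carrier B" "g \<in> carrier (dual_B A S)" "u \<in> carrier (B_mod S)"
  show "coeff (b \<odot>\<^bsub>dual_B A S\<^esub> g) u = coeff g (b \<odot>\<^bsub>B_mod S\<^esub> u)"
    using * coeff_comod_hom[OF HomS lact_comod_hom] by (simp add: B_mod_simps)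
qed (use coeff_closed[OF HomS] coeff_plus[OF HomS HomS] mod_homD(2)[OF coeff_hom[OF HomS]] in
    \<open>simp_all add: B_mod_simps\<close>)

lemma can_eq:
  "tensor_lift B (dual_B A S) (B_mod S) C (\<lambda>g u. tensor_lift A S C C (\<lambda>v c. g v \<odot>\<^bsub>C\<^esub> c) (coact S u)) =
    tensor_lift B (dual_B A S) (B_mod S) C coeff"
  by (simp add: coeff_def[abs_def] contr_l_def)

text \<open>As the canonical map is onto, the matrix coefficients generate \<open>C\<close> additively.\<close>

lemma coeff_generates:
  assumes can: "can_iso A B C S" and X: "abelian_group X"
    and h: "h \<in> add_homs C X" and k: "k \<in> add_homs C X"
    and eq: "\<And>g u. \<lbrakk>g \<in> S_dual; u \<in> carrier S\<rbrakk> \<Longrightarrow> h (coeff g u) = k (coeff g u)"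
    and c: "c \<in> carrier C"
  shows "h c = k c"
proof -
  interpret T: tensor_pair B "dual_B A S" "B_mod S" using tensor_pairI[OF closed_dual_B closed_B_mod] .
  let ?can = "tensor_lift B (dual_B A S) (B_mod S) C coeff"
  note ab = module_abelian_group[OF module_C]
  note can_hom = T.tensor_lift_hom[OF ab balanced_coeff]
  obtain t where t: "t \<in> carrier (tensor_ab B (dual_B A S) (B_mod S))" "c = ?can t"
    using can c unfolding can_iso_def can_eq bij_betw_def by blast
  have "h (?can t) = k (?can t)"
  proof (rule T.add_homs_eqI[where h = "\<lambda>t. h (?can t)" and k = "\<lambda>t. k (?can t)", OF X _ _ _ t(1)])
    show "(\<lambda>t. h (?can t)) \<in> add_homs (tensor_ab B (dual_B A S) (B_mod S)) X"
      by (rule add_homs_compose[OF can_hom h])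
    show "(\<lambda>t. k (?can t)) \<in> add_homs (tensor_ab B (dual_B A S) (B_mod S)) X"
      by (rule add_homs_compose[OF can_hom k])
  qed (use eq T.tensor_lift_pure[OF ab balanced_coeff] in \<open>simp add: B_mod_simps\<close>)
  then show ?thesis using t(2) by simp
qed

lemma bimod_homD:
  assumes J: "J \<in> bimod_homs A B C S"
  shows "g \<in> S_dual \<Longrightarrow> J g \<in> Q_set A C S"
    and "\<lbrakk>g \<in> S_dual; g' \<in> S_dual; c \<in> carrier C; u \<in> carrier S\<rbrakk> \<Longrightarrow>
      J (\<lambda>v\<in>carrier S. g v \<oplus>\<^bsub>A\<^esub> g' v) c u = J g c u \<oplus>\<^bsub>A\<^esub> J g' c u"
    and "\<lbrakk>a \<in> carrier A; g \<in> S_dual; c \<in> carrier C; u \<in> carrier S\<rbrakk> \<Longrightarrow>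
      J (\<lambda>v\<in>carrier S. a \<otimes>\<^bsub>A\<^esub> g v) c u = a \<otimes>\<^bsub>A\<^esub> J g c u"
    and "\<lbrakk>b \<in> carrier B; g \<in> S_dual; c \<in> carrier C; u \<in> carrier S\<rbrakk> \<Longrightarrow>
      J (\<lambda>v\<in>carrier S. g (lact S b v)) c u = J g c (lact S b u)"
proof -
  have JA: "J \<in> mod_hom A (dual A S) (Q_A A C S)" and JB: "J \<in> mod_hom B (dual_B A S) (Q_B A C S)"
    using J by (auto simp: bimod_homs_def)
  show Q: "g \<in> S_dual \<Longrightarrow> J g \<in> Q_set A C S" for g
    using mod_homD(1)[OF JA, of g] by simp
  show "\<lbrakk>g \<in> S_dual; g' \<in> S_dual; c \<in> carrier C; u \<in> carrier S\<rbrakk> \<Longrightarrow>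
      J (\<lambda>v\<in>carrier S. g v \<oplus>\<^bsub>A\<^esub> g' v) c u = J g c u \<oplus>\<^bsub>A\<^esub> J g' c u"
    using mod_homD(2)[OF JA, of g g'] by simp
  show "\<lbrakk>b \<in> carrier B; g \<in> S_dual; c \<in> carrier C; u \<in> carrier S\<rbrakk> \<Longrightarrow>
      J (\<lambda>v\<in>carrier S. g (lact S b v)) c u = J g c (lact S b u)"
    using mod_homD(3)[OF JB, of b g] by simp
  assume a: "a \<in> carrier A" and g: "g \<in> S_dual" and c: "c \<in> carrier C" and u: "u \<in> carrier S"
  have "J (\<lambda>v\<in>carrier S. a \<otimes>\<^bsub>A\<^esub> g v) c u = J g (a \<odot>\<^bsub>C\<^esub> c) u"
    using mod_homD(3)[OF JA, of a g] a g c by simp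
  also have "\<dots> = a \<otimes>\<^bsub>A\<^esub> J g c u"
    using functionalD(3)[OF HomC[OF Q_setD(3)[OF Q[OF g] u]] a c] c a by simp
  finally show "J (\<lambda>v\<in>carrier S. a \<otimes>\<^bsub>A\<^esub> g v) c u = a \<otimes>\<^bsub>A\<^esub> J g c u" .
qed

lemma abelian_group_dual_C: "abelian_group (dual A C)"
  by (rule module_abelian_group[OF module_dual[OF module_C]])

text \<open>When the canonical map is an isomorphism, every bimodule map \<open>\<Sigma>\<^sup>* \<rightarrow> Q\<close> comes from a right
  \<open>\<^sup>*C\<close>-linear map: \<open>p\<close> is \<open>C \<cong> \<Sigma>\<^sup>* \<otimes>\<^sub>B \<Sigma> \<rightarrow> \<^sup>*C\<close>, \<open>g \<otimes> u \<mapsto> J(g)(-)(u)\<close>.\<close>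

lemma bimod_hom_form:
  assumes can: "can_iso A B C S" and J: "J \<in> bimod_homs A B C S"
  obtains p where "right_linear A C p"
    and "\<And>g u. \<lbrakk>g \<in> S_dual; u \<in> carrier S\<rbrakk> \<Longrightarrow> p (coeff g u) = (\<lambda>c\<in>carrier C. J g c u)"
proof -
  interpret T: tensor_pair B "dual_B A S" "B_mod S" using tensor_pairI[OF closed_dual_B closed_B_mod] .
  interpret TG: abelian_group "tensor_ab B (dual_B A S) (B_mod S)" by (rule T.abelian_group_tensor_ab)
  let ?T = "tensor_ab B (dual_B A S) (B_mod S)"
  define can where "can = tensor_lift B (dual_B A S) (B_mod S) C coeff"
  note abC = module_abelian_group[OF module_C]
  note abD = abelian_group_dual_C
  note JD = bimod_homD[OF J]
  interpret D: module A "dual A C" by (rule module_dual[OF module_C])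
  have can_hom: "can \<in> add_homs ?T C" unfolding can_def by (rule T.tensor_lift_hom[OF abC balanced_coeff])
  have can_pure: "can (pure B (dual_B A S) (B_mod S) g u) = coeff g u"
    if "g \<in> S_dual" "u \<in> carrier S" for g u
    unfolding can_def using T.tensor_lift_pure[OF abC balanced_coeff] that by (simp add: B_mod_simps)
  have bij: "bij_betw can (carrier ?T) (carrier C)"
    using can unfolding can_iso_def can_eq can_def .
  define \<theta> where "\<theta> = (\<lambda>g u. \<lambda>c\<in>carrier C. J g c u)"
  have \<theta>: "\<theta> g u \<in> C_dual" if "g \<in> S_dual" "u \<in> carrier S" for g u
    unfolding \<theta>_def by (rule Q_setD(3)[OF JD(1)[OF that(1)] that(2)])
  have bal: "balanced B (dual_B A S) (B_mod S) (dual A C) \<theta>"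
  proof (rule balancedI)
    fix g u v assume "g \<in> carrier (dual_B A S)" and uv: "u \<in> carrier (B_mod S)" "v \<in> carrier (B_mod S)"
    then have g: "g \<in> S_dual" by simp
    show "\<theta> g (u \<oplus>\<^bsub>B_mod S\<^esub> v) = \<theta> g u \<oplus>\<^bsub>dual A C\<^esub> \<theta> g v"
      using uv functionalD(2)[OF HomS[OF Q_setD(2)[OF JD(1)[OF g]]]]
      by (auto simp: \<theta>_def B_mod_simps intro!: restrict_ext)
  next
    fix b g u assume "b \<in> carrier B" "g \<in> carrier (dual_B A S)" "u \<in> carrier (B_mod S)"
    then show "\<theta> (b \<odot>\<^bsub>dual_B A S\<^esub> g) u = \<theta> g (b \<odot>\<^bsub>B_mod S\<^esub> u)"
      using JD(4) by (auto simp: \<theta>_def B_mod_simps intro!: restrict_ext)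
  next
    fix g g' u assume "g \<in> carrier (dual_B A S)" "g' \<in> carrier (dual_B A S)" "u \<in> carrier (B_mod S)"
    then show "\<theta> (g \<oplus>\<^bsub>dual_B A S\<^esub> g') u = \<theta> g u \<oplus>\<^bsub>dual A C\<^esub> \<theta> g' u"
      using JD(2) by (auto simp: \<theta>_def B_mod_simps intro!: restrict_ext)
  qed (use \<theta> in \<open>simp add: B_mod_simps\<close>)
  define G where "G = tensor_lift B (dual_B A S) (B_mod S) (dual A C) \<theta>"
  have G_hom: "G \<in> add_homs ?T (dual A C)" unfolding G_def by (rule T.tensor_lift_hom[OF abD bal])
  have G_pure: "G (pure B (dual_B A S) (B_mod S) g u) = \<theta> g u"
    if "g \<in> S_dual" "u \<in> carrier S" for g u
    unfolding G_def using T.tensor_lift_pure[OF abD bal] that by (simp add: B_mod_simps)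
  define p where "p = (\<lambda>c. G (inv_into (carrier ?T) can c))"
  have inv: "inv_into (carrier ?T) can c \<in> carrier ?T" "can (inv_into (carrier ?T) can c) = c"
    if "c \<in> carrier C" for c
    using bij that by (auto simp: bij_betw_def inv_into_into f_inv_into_f)
  have p_can: "p (can t) = G t" if "t \<in> carrier ?T" for t
    using bij that by (simp add: p_def bij_betw_def)
  have p_coeff: "p (coeff g u) = \<theta> g u" if "g \<in> S_dual" "u \<in> carrier S" for g u
    using p_can[OF T.pure_closed, of g u] can_pure[OF that] G_pure[OF that] that by (simp add: B_mod_simps)
  have p_add: "p \<in> add_homs C (dual A C)"
  proof (rule add_homsI)
    fix c d assume c: "c \<in> carrier C" and d: "d \<in> carrier C"
    show "p c \<in> carrier (dual A C)" unfolding p_def by (rule add_homs_closed[OF G_hom inv(1)[OF c]])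
    have "p (c \<oplus>\<^bsub>C\<^esub> d) = p (can (inv_into (carrier ?T) can c \<oplus>\<^bsub>?T\<^esub> inv_into (carrier ?T) can d))"
      using add_homs_add[OF can_hom inv(1)[OF c] inv(1)[OF d]] inv(2)[OF c] inv(2)[OF d] by simp
    also have "\<dots> = G (inv_into (carrier ?T) can c \<oplus>\<^bsub>?T\<^esub> inv_into (carrier ?T) can d)"
      by (rule p_can) (use inv c d in simp)
    also have "\<dots> = p c \<oplus>\<^bsub>dual A C\<^esub> p d"
      unfolding p_def by (rule add_homs_add[OF G_hom inv(1)[OF c] inv(1)[OF d]])
    finally show "p (c \<oplus>\<^bsub>C\<^esub> d) = p c \<oplus>\<^bsub>dual A C\<^esub> p d" .
  qed
  have pm: "p \<in> mod_hom A C (dual A C)"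
  proof (rule mod_homI)
    fix a c assume a: "a \<in> carrier A" and c: "c \<in> carrier C"
    show "p (a \<odot>\<^bsub>C\<^esub> c) = a \<odot>\<^bsub>dual A C\<^esub> p c"
    proof (rule coeff_generates[where h = "\<lambda>c. p (a \<odot>\<^bsub>C\<^esub> c)" and k = "\<lambda>c. a \<odot>\<^bsub>dual A C\<^esub> p c", OF assms(1) abD _ _ _ c])
      show "(\<lambda>c. p (a \<odot>\<^bsub>C\<^esub> c)) \<in> add_homs C (dual A C)"
        by (rule add_homs_compose[OF mod_hom_add_homs[OF smult_mod_hom[OF module_C a]] p_add])
      show "(\<lambda>c. a \<odot>\<^bsub>dual A C\<^esub> p c) \<in> add_homs C (dual A C)"
        by (rule add_homs_compose[OF p_add mod_hom_add_homs[OF smult_mod_hom[OF module_dual[OF module_C] a]]])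
      fix g u assume g: "g \<in> S_dual" and u: "u \<in> carrier S"
      have ag: "(\<lambda>v\<in>carrier S. a \<otimes>\<^bsub>A\<^esub> g v) \<in> S_dual"
        using module.smult_closed[OF module_dual_S a, of g] g by simp
      have "p (a \<odot>\<^bsub>C\<^esub> coeff g u) = \<theta> (\<lambda>v\<in>carrier S. a \<otimes>\<^bsub>A\<^esub> g v) u"
        using coeff_smult[OF HomS[OF g] a u] p_coeff[OF ag u] by simp
      then show "p (a \<odot>\<^bsub>C\<^esub> coeff g u) = a \<odot>\<^bsub>dual A C\<^esub> p (coeff g u)"
        using JD(3)[OF a g _ u] p_coeff[OF g u] by (auto simp: \<theta>_def intro!: restrict_ext)
    qed
  qed (use add_homs_closed[OF p_add] add_homs_add[OF p_add] in auto)
  have "right_linear A C p"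
    unfolding right_linear_def
  proof (intro conjI ballI pm)
    fix f c d assume f: "f \<in> C_dual" and c: "c \<in> carrier C" and d: "d \<in> carrier C"
    note f' = HomC[OF f]
    show "p (ract f c) d = f (ract (p c) d)"
    proof (rule coeff_generates[where h = "\<lambda>c. p (ract f c) d" and k = "\<lambda>c. f (ract (p c) d)", OF assms(1) R.is_abelian_group _ _ _ c])
      show "(\<lambda>c. p (ract f c) d) \<in> add_homs C A"
        by (rule add_homs_compose[OF mod_hom_add_homs[OF ract_hom[OF f']]
              add_homs_compose[OF p_add eval_add_homs[OF d]]])
      show "(\<lambda>c. f (ract (p c) d)) \<in> add_homs C A"
      proof (rule add_homsI)
        fix c c' assume c: "c \<in> carrier C" "c' \<in> carrier C"
        note pc = HomC[OF form_closed[OF pm c(1)]] HomC[OF form_closed[OF pm c(2)]]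
        show "f (ract (p c) d) \<in> carrier A" using functionalD(1)[OF f' ract_closed[OF pc(1) d]] .
        have "ract (p (c \<oplus>\<^bsub>C\<^esub> c')) d = ract (p c) d \<oplus>\<^bsub>C\<^esub> ract (p c') d"
          using ract_plus[OF pc d] add_homs_add[OF p_add c] by simp
        then show "f (ract (p (c \<oplus>\<^bsub>C\<^esub> c')) d) = f (ract (p c) d) \<oplus>\<^bsub>A\<^esub> f (ract (p c') d)"
          using functionalD(2)[OF f' ract_closed[OF pc(1) d] ract_closed[OF pc(2) d]] by simp
      qed
      fix g u assume g: "g \<in> S_dual" and u: "u \<in> carrier S"
      note su = sact_closed[OF f' u]
      have "p (ract f (coeff g u)) d = J g d (sact f u)"
        using coeff_sact[OF f' HomS[OF g] u] p_coeff[OF g su] d by (simp add: \<theta>_def)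
      also have "\<dots> = f (coeff (J g d) u)"
        by (rule functional_coeff[OF f' HomS[OF Q_setD(2)[OF JD(1)[OF g] d]] u, symmetric])
      also have "\<dots> = f (ract (p (coeff g u)) d)"
        using Q_setD(4)[OF JD(1)[OF g] d u] p_coeff[OF g u] by (simp add: \<theta>_def)
      finally show "p (ract f (coeff g u)) d = f (ract (p (coeff g u)) d)" .
    qed
  qed
  then show ?thesis using p_coeff that unfolding \<theta>_def by blast
qed


section \<open>The elements of \<open>Q\<close> separate the points of \<open>C\<close>\<close>

lemma closed_Q_T: "closed_mod (End_ring A C S) (Q_T A C S)"
proof -
  interpret D: module A "dual A S" by (rule module_dual_S)
  note cC = closed_mod_module[OF module_C]
  let ?s = "\<lambda>q q'. \<lambda>c\<in>carrier C. q c \<oplus>\<^bsub>dual A S\<^esub> q' c"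
  have "?s q q' \<in> Q_set A C S"
    if q: "q \<in> Q_set A C S" and q': "q' \<in> Q_set A C S" for q q'
    unfolding Q_set_iff
  proof (intro conjI ballI)
    note qm = HomD(5)[OF Q_setD(1)[OF q]] and q'm = HomD(5)[OF Q_setD(1)[OF q']]
    have "(\<lambda>c. q c \<oplus>\<^bsub>dual A S\<^esub> q' c) \<in> mod_hom A C (dual A S)"
      using mod_homD[OF qm] mod_homD[OF q'm]
      by (intro mod_homI) (simp_all only: D.a_closed D.smult_closed D.a_ac D.smult_r_distr)
    then show "?s q q' \<in> Hom A C (dual A S)"
      by (rule Hom_restrictI[OF cC])
    fix c u assume c: "c \<in> carrier C" and u: "u \<in> carrier S"
    note \<theta> = HomC[OF Q_setD(3)[OF q u]] HomC[OF Q_setD(3)[OF q' u]]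
    have "(\<lambda>d\<in>carrier C. ?s q q' d u) =
        (\<lambda>d\<in>carrier C. (\<lambda>c\<in>carrier C. q c u) d \<oplus>\<^bsub>A\<^esub> (\<lambda>c\<in>carrier C. q' c u) d)"
      using u by (auto intro!: restrict_ext)
    then have "ract (\<lambda>d\<in>carrier C. ?s q q' d u) c =
        coeff (q c) u \<oplus>\<^bsub>C\<^esub> coeff (q' c) u"
      using ract_plus[OF \<theta> c] Q_setD(4)[OF q c u] Q_setD(4)[OF q' c u] by simp
    also have "\<dots> = coeff (?s q q' c) u"
      using coeff_plus[OF HomS[OF Q_setD(2)[OF q c]] HomS[OF Q_setD(2)[OF q' c]] u] c by simp
    finally show "ract (\<lambda>d\<in>carrier C. ?s q q' d u) c =
        coeff (?s q q' c) u" .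
  qed
  moreover have "(\<lambda>c\<in>carrier C. compose (carrier S) (q c) t) \<in> Q_set A C S"
    if q: "q \<in> Q_set A C S" and t: "t \<in> Hom_C A C S S" for q t
    unfolding Q_set_iff
  proof (intro conjI ballI)
    have t': "t \<in> comod_hom A C S S" using t by (simp add: Hom_C_def)
    then have tm: "t \<in> mod_hom A S S" by (simp add: comod_hom_def)
    have cmp: "compose (carrier S) \<phi> t = (\<lambda>u\<in>carrier S. \<phi> (t u))" for \<phi> :: "'s \<Rightarrow> 'a"
      by (simp add: compose_def)
    note qm = HomD(5)[OF Q_setD(1)[OF q]]
    have "(\<lambda>c. compose (carrier S) (q c) t) \<in> mod_hom A C (dual A S)"
    proof (rule mod_homI)
      fix c assume c: "c \<in> carrier C"
      show "compose (carrier S) (q c) t \<in> carrier (dual A S)"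
        unfolding cmp using Hom_restrictI[OF closed_mod_module[OF module_S]
            mod_hom_compose[OF tm HomS[OF Q_setD(2)[OF q c]]]] by simp
      show "compose (carrier S) (q (c \<oplus>\<^bsub>C\<^esub> d)) t =
          compose (carrier S) (q c) t \<oplus>\<^bsub>dual A S\<^esub> compose (carrier S) (q d) t"
        if "d \<in> carrier C" for d
        using mod_homD(2)[OF qm c that] mod_homD(1)[OF tm] by (auto simp: cmp intro!: restrict_ext)
      show "compose (carrier S) (q (a \<odot>\<^bsub>C\<^esub> c)) t = a \<odot>\<^bsub>dual A S\<^esub> compose (carrier S) (q c) t"
        if "a \<in> carrier A" for a
        using mod_homD(3)[OF qm that c] mod_homD(1)[OF tm] by (auto simp: cmp intro!: restrict_ext)
    qed
    then show "(\<lambda>c\<in>carrier C. compose (carrier S) (q c) t) \<in> Hom A C (dual A S)"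
      by (rule Hom_restrictI[OF cC])
    fix c u assume c: "c \<in> carrier C" and u: "u \<in> carrier S"
    have "(\<lambda>d\<in>carrier C. (\<lambda>c\<in>carrier C. compose (carrier S) (q c) t) d u) = (\<lambda>d\<in>carrier C. q d (t u))"
      using u by (auto simp: cmp intro!: restrict_ext)
    then show "ract (\<lambda>d\<in>carrier C. (\<lambda>c\<in>carrier C. compose (carrier S) (q c) t) d u) c =
        coeff ((\<lambda>c\<in>carrier C. compose (carrier S) (q c) t) c) u"
      using Q_setD(4)[OF q c mod_homD(1)[OF tm u]] coeff_comod_hom[OF HomS[OF Q_setD(2)[OF q c]] t' u] c
      by (simp add: cmp)
  qed
  ultimately show ?thesis by (simp add: closed_mod_def)
qed

lemma closed_S_T: "closed_mod (End_ring A C S) (S_T S)"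
  by (auto simp: closed_mod_def S_T_def Hom_C_def comod_hom_def mod_hom_def)

lemma Q_separates:
  assumes lp: "locally_projective A C" and dense: "rational_dense A C" and mu: "cond_vi A C S"
    and c: "c \<in> carrier C" "c' \<in> carrier C"
    and eq: "\<And>q u. \<lbrakk>q \<in> Q_set A C S; u \<in> carrier S\<rbrakk> \<Longrightarrow> q c u = q c' u"
  shows "c = c'"
proof (rule locally_projective_separates[OF module_C lp c])
  interpret T: tensor_pair "End_ring A C S" "Q_T A C S" "S_T S"
    using tensor_pairI[OF closed_Q_T closed_S_T] .
  define \<theta> :: "('c \<Rightarrow> 's \<Rightarrow> 'a) \<Rightarrow> 's \<Rightarrow> 'c \<Rightarrow> 'a" where "\<theta> = (\<lambda>q u. \<lambda>c\<in>carrier C. q c u)"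
  have S_T: "carrier (S_T S) = carrier S" "ring.add (S_T S) = ring.add S" "smult (S_T S) = (\<lambda>t u. t u)"
    by (simp_all add: S_T_def)
  have bal: "balanced (End_ring A C S) (Q_T A C S) (S_T S) (ldual A C) \<theta>"
  proof (rule balancedI)
    fix q u v assume q: "q \<in> carrier (Q_T A C S)" and uv: "u \<in> carrier (S_T S)" "v \<in> carrier (S_T S)"
    then show "\<theta> q (u \<oplus>\<^bsub>S_T S\<^esub> v) = \<theta> q u \<oplus>\<^bsub>ldual A C\<^esub> \<theta> q v"
      using functionalD(2)[OF HomS[OF Q_setD(2)]] by (auto simp: \<theta>_def S_T intro!: restrict_ext)
  next
    fix q u assume "q \<in> carrier (Q_T A C S)" "u \<in> carrier (S_T S)"
    then show "\<theta> q u \<in> carrier (ldual A C)" using Q_setD(3) by (simp add: \<theta>_def S_T)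
  qed (auto simp: \<theta>_def S_T compose_def intro!: restrict_ext)
  let ?mu = "Defs.mu A C S" and ?T = "tensor_ab (End_ring A C S) (Q_T A C S) (S_T S)"
  have mu_eq: "?mu = tensor_lift (End_ring A C S) (Q_T A C S) (S_T S) (ldual A C) \<theta>"
    by (simp add: mu_def \<theta>_def)
  have ab: "abelian_group (ldual A C)"
    by (rule abelian_group_cong[OF abelian_group_dual_C]) (simp_all add: ldual_def)
  have mu_hom: "?mu \<in> add_homs (?T) (dual A C)"
    using T.tensor_lift_hom[OF ab bal] by (simp add: mu_eq add_homs_def)
  have rat: "f c = f c'" if f: "f \<in> rational A C" for f
  proof -
    obtain t where t: "t \<in> carrier (?T)" "f = ?mu t"
      using f mu unfolding cond_vi_def by blast
    have "?mu t c = ?mu t c'"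
    proof (rule T.add_homs_eqI[where h = "\<lambda>t. ?mu t c" and k = "\<lambda>t. ?mu t c'",
          OF R.is_abelian_group _ _ _ t(1)])
      show "(\<lambda>t. ?mu t c) \<in> add_homs (?T) A"
        by (rule add_homs_compose[OF mu_hom eval_add_homs[OF c(1)]])
      show "(\<lambda>t. ?mu t c') \<in> add_homs (?T) A"
        by (rule add_homs_compose[OF mu_hom eval_add_homs[OF c(2)]])
    qed (use eq c T.tensor_lift_pure[OF ab bal] in \<open>simp add: mu_eq \<theta>_def S_T\<close>)
    then show ?thesis using t(2) by simp
  qed
  fix f assume "f \<in> C_dual"
  then obtain g where g: "g \<in> rational A C" "g c = f c" "g c' = f c'"
    using dense[unfolded rational_dense_def, rule_format, of f "{c, c'}"] c by auto
  then show "f c = f c'" using rat[OF g(1)] by metis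
qed

section \<open>Epimorphisms and monomorphisms\<close>

lemma surjective_left_coFrobenius:
  assumes lp: "locally_projective A C" and dense: "rational_dense A C" and mu: "cond_vi A C S"
    and can: "can_iso A B C S" and J: "J \<in> bimod_homs A B C S"
    and surj: "J ` S_dual = Q_set A C S"
  shows "left_coFrobenius A C"
proof -
  obtain p where p: "right_linear A C p"
    and p_coeff: "\<And>g u. \<lbrakk>g \<in> S_dual; u \<in> carrier S\<rbrakk> \<Longrightarrow> p (coeff g u) = (\<lambda>c\<in>carrier C. J g c u)"
    using bimod_hom_form[OF can J] by blast
  have "inj_on (\<lambda>c. \<lambda>d\<in>carrier C. p d c) (carrier C)"
  proof (rule inj_onI)
    fix c c' assume c: "c \<in> carrier C" "c' \<in> carrier C"
      and eq: "(\<lambda>d\<in>carrier C. p d c) = (\<lambda>d\<in>carrier C. p d c')"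
    have pd: "p d c = p d c'" if "d \<in> carrier C" for d
      using fun_cong[OF eq, of d] that by simp
    show "c = c'"
    proof (rule Q_separates[OF lp dense mu c])
      fix q u assume "q \<in> Q_set A C S" and u: "u \<in> carrier S"
      then obtain g where g: "g \<in> S_dual" "q = J g" using surj by blast
      then show "q c u = q c' u"
        using pd[OF coeff_closed[OF HomS[OF g(1)] u]] p_coeff[OF g(1) u] c by simp
    qed
  qed
  then show ?thesis
    using right_to_left_linear[OF p] lp left_coFrobenius_iff by blast
qed

text \<open>The endomorphism \<open>\<tau>(u \<otimes> q)\<close> of \<open>\<Sigma>\<close>, \<open>v \<mapsto> u\<^sub>[\<^sub>0\<^sub>] q(u\<^sub>[\<^sub>1\<^sub>])(v)\<close>.\<close>

definition tau_pure :: "'s \<Rightarrow> ('c \<Rightarrow> 's \<Rightarrow> 'a) \<Rightarrow> 's \<Rightarrow> 's" where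
  "tau_pure u q = (\<lambda>v\<in>carrier S. sact (\<lambda>c\<in>carrier C. q c v) u)"

lemma tau_pure_Hom_C:
  assumes q: "q \<in> Q_set A C S" and u: "u \<in> carrier S"
  shows "tau_pure u q \<in> Hom_C A C S S"
proof -
  let ?t = "tau_pure u q" and ?T = "tensor_ab A S C"
  let ?k = "\<lambda>X. tensor_map A S C S C (\<lambda>x. x) (\<lambda>c. contr_l A S C (q c) X) (coact S u)"
  note cS = closed_mod_module[OF module_S] and cC = closed_mod_module[OF module_C]
  interpret T: tensor_pair A S C using tensor_pairI[OF cS cC] .
  define \<theta> where "\<theta> = (\<lambda>v. \<lambda>c\<in>carrier C. q c v)"
  have \<theta>: "\<theta> v \<in> functionals A C" if "v \<in> carrier S" for v
    unfolding \<theta>_def by (rule HomC[OF Q_setD(3)[OF q that]])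
  have qf: "q c \<in> functionals A S" if "c \<in> carrier C" for c by (rule HomS[OF Q_setD(2)[OF q that]])
  note qm = HomD(5)[OF Q_setD(1)[OF q]]
  have t_eq: "?t v = contr_r A S C (\<theta> v) (coact S u)" if "v \<in> carrier S" for v
    using that by (simp add: tau_pure_def sact_def \<theta>_def)
  note cu = coact_closed[OF u]
  have t: "?t \<in> mod_hom A S S"
  proof (rule mod_homI)
    fix v assume v: "v \<in> carrier S"
    show "?t v \<in> carrier S" using sact_closed[OF \<theta>[OF v] u] v by (simp add: tau_pure_def \<theta>_def)
    show "?t (v \<oplus>\<^bsub>S\<^esub> w) = ?t v \<oplus>\<^bsub>S\<^esub> ?t w" if w: "w \<in> carrier S" for w
    proof -
      have "contr_r A S C (\<theta> (v \<oplus>\<^bsub>S\<^esub> w)) (coact S u) =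
          contr_r A S C (\<theta> v) (coact S u) \<oplus>\<^bsub>S\<^esub> contr_r A S C (\<theta> w) (coact S u)"
        by (rule contr_r_plus[OF module_S module_C \<theta>[OF v] \<theta>[OF w] cu])
          (simp add: \<theta>_def functionalD(2)[OF qf] v w)
      then show ?thesis using v w t_eq by simp
    qed
    show "?t (a \<odot>\<^bsub>S\<^esub> v) = a \<odot>\<^bsub>S\<^esub> ?t v" if a: "a \<in> carrier A" for a
    proof -
      have "contr_r A S C (\<theta> (a \<odot>\<^bsub>S\<^esub> v)) (coact S u) = a \<odot>\<^bsub>S\<^esub> contr_r A S C (\<theta> v) (coact S u)"
        by (rule contr_r_smult[OF module_S module_C \<theta>[OF v] a cu])
          (simp add: \<theta>_def functionalD(3)[OF qf] v a)
      then show ?thesis using a v t_eq by simp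
    qed
  qed
  have contr_q: "(\<lambda>c. contr_l A S C (q c) X) \<in> mod_hom A C C" if X: "X \<in> carrier ?T" for X
  proof (rule mod_homI)
    fix c assume c: "c \<in> carrier C"
    show "contr_l A S C (q c) X \<in> carrier C"
      using mod_homD(1)[OF contr_l_hom[OF module_S module_C qf[OF c]]] X by simp
    show "contr_l A S C (q (c \<oplus>\<^bsub>C\<^esub> d)) X = contr_l A S C (q c) X \<oplus>\<^bsub>C\<^esub> contr_l A S C (q d) X"
      if d: "d \<in> carrier C" for d
      by (rule contr_l_plus[OF module_S module_C qf[OF c] qf[OF d] X])
        (simp add: mod_homD(2)[OF qm c d])
    show "contr_l A S C (q (a \<odot>\<^bsub>C\<^esub> c)) X = a \<odot>\<^bsub>C\<^esub> contr_l A S C (q c) X" if a: "a \<in> carrier A" for a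
      by (rule contr_l_smult[OF module_S module_C qf[OF c] a X]) (simp add: mod_homD(3)[OF qm a c])
  qed
  \<comment> \<open>Both sides are \<open>u\<^sub>[\<^sub>0\<^sub>] \<otimes> q(u\<^sub>[\<^sub>1\<^sub>])(v) y\<close> on \<open>X = v \<otimes> y\<close>.\<close>
  have key: "tensor_map A S C S C ?t (\<lambda>x. x) X =
      ?k X"
    if X: "X \<in> carrier ?T" for X
  proof (rule T.add_homs_eqI[where h = "tensor_map A S C S C ?t (\<lambda>x. x)"
        and k = ?k,
        OF T.abelian_group_tensor_ab _ _ _ X])
    show "tensor_map A S C S C ?t (\<lambda>x. x) \<in> add_homs ?T ?T"
      by (rule tensor_map_hom[OF cS cC cS cC t id_mod_hom])
    show "?k \<in> add_homs ?T ?T"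
    proof (rule add_homsI)
      fix X Y assume X: "X \<in> carrier ?T" and Y: "Y \<in> carrier ?T"
      show "?k X \<in> carrier ?T"
        by (rule add_homs_closed[OF tensor_map_hom[OF cS cC cS cC id_mod_hom contr_q[OF X]] cu])
      note bX = balanced_map[OF cS cC id_mod_hom contr_q[OF X] T.balanced_pure]
        and bY = balanced_map[OF cS cC id_mod_hom contr_q[OF Y] T.balanced_pure]
      note ab = T.abelian_group_tensor_ab
      have "tensor_lift A S C ?T (\<lambda>s c. pure A S C s (contr_l A S C (q c) X) \<oplus>\<^bsub>?T\<^esub>
            pure A S C s (contr_l A S C (q c) Y)) (coact S u) =
          tensor_lift A S C ?T (\<lambda>s c. pure A S C s (contr_l A S C (q c) (X \<oplus>\<^bsub>?T\<^esub> Y))) (coact S u)"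
      proof (rule tensor_lift_cong[OF cS cC ab balanced_plus[OF ab bX bY] _ cu])
        fix s c assume s: "s \<in> carrier S" and c: "c \<in> carrier C"
        have "contr_l A S C (q c) (X \<oplus>\<^bsub>?T\<^esub> Y) = contr_l A S C (q c) X \<oplus>\<^bsub>C\<^esub> contr_l A S C (q c) Y"
          using mod_homD(2)[OF contr_l_hom[OF module_S module_C qf[OF c]], of X Y] X Y by simp
        then show "pure A S C s (contr_l A S C (q c) X) \<oplus>\<^bsub>?T\<^esub> pure A S C s (contr_l A S C (q c) Y) =
            pure A S C s (contr_l A S C (q c) (X \<oplus>\<^bsub>?T\<^esub> Y))"
          using T.pure_add_r[OF s] mod_homD(1)[OF contr_q[OF X] c] mod_homD(1)[OF contr_q[OF Y] c] by simp
      qed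
      then show "?k (X \<oplus>\<^bsub>?T\<^esub> Y) =
          ?k X \<oplus>\<^bsub>?T\<^esub>
          ?k Y"
        unfolding tensor_map_def using tensor_lift_plus[OF cS cC ab bX bY cu] by simp
    qed
    fix v y assume v: "v \<in> carrier S" and y: "y \<in> carrier C"
    have py: "(\<lambda>s. pure A S C s y) \<in> add_homs S ?T"
      using T.balanced_pure y by (simp add: balanced_def)
    note b = balanced_r[OF module_S module_C \<theta>[OF v]]
    have "tensor_map A S C S C ?t (\<lambda>x. x) (pure A S C v y) = pure A S C (contr_r A S C (\<theta> v) (coact S u)) y"
      using tensor_map_pure[OF cS cC cS cC t id_mod_hom v y] t_eq[OF v] by simp
    also have "\<dots> = tensor_lift A S C ?T (\<lambda>s c. pure A S C (\<theta> v c \<odot>\<^bsub>S\<^esub> s) y) (coact S u)"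
      unfolding contr_r_def
      by (rule add_homs_tensor_lift[OF cS cC module_abelian_group[OF module_S] T.abelian_group_tensor_ab b py cu])
    also have "\<dots> = tensor_lift A S C ?T (\<lambda>s c. pure A S C s (contr_l A S C (q c) (pure A S C v y))) (coact S u)"
    proof (rule tensor_lift_cong[OF cS cC T.abelian_group_tensor_ab balanced_compose[OF b py] _ cu])
      fix s c assume s: "s \<in> carrier S" and c: "c \<in> carrier C"
      then show "pure A S C (\<theta> v c \<odot>\<^bsub>S\<^esub> s) y = pure A S C s (contr_l A S C (q c) (pure A S C v y))"
        using T.pure_act[of "q c v" s y] y contr_l_pure[OF module_S module_C qf[OF c] v y]
          functionalD(1)[OF qf[OF c] v] by (simp add: \<theta>_def)
    qed
    finally show "tensor_map A S C S C ?t (\<lambda>x. x) (pure A S C v y) =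
        ?k (pure A S C v y)"
      by (simp add: tensor_map_def)
  qed
  have "tensor_map A S C S C ?t (\<lambda>x. x) (coact S v) = coact S (?t v)" if v: "v \<in> carrier S" for v
  proof -
    note cv = coact_closed[OF v]
    have "tensor_map A S C S C ?t (\<lambda>x. x) (coact S v) =
        ?k (coact S v)"
      by (rule key[OF cv])
    also have "\<dots> = tensor_map A S C S C (\<lambda>x. x) (ract (\<theta> v)) (coact S u)"
      unfolding tensor_map_def
      by (rule tensor_lift_cong[OF cS cC T.abelian_group_tensor_ab
            balanced_map[OF cS cC id_mod_hom contr_q[OF cv] T.balanced_pure] _ cu])
        (use Q_setD(4)[OF q _ v] in \<open>simp add: coeff_def \<theta>_def\<close>)
    also have "\<dots> = coact S (sact (\<theta> v) u)" by (rule coact_sact[OF \<theta>[OF v] u, symmetric])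
    finally show ?thesis using t_eq[OF v] by (simp add: sact_def)
  qed
  then show ?thesis using t by (simp add: Hom_C_def comod_hom_def tau_pure_def)
qed

text \<open>The form \<open>p\<close> of \<open>J\<close> satisfies \<open>J(q(c))(d) = q(d \<cdot> p(c))\<close> for all \<open>q \<in> Q\<close>: on a matrix
  coefficient \<open>c = g(u\<^sub>[\<^sub>0\<^sub>]) u\<^sub>[\<^sub>1\<^sub>]\<close>, \<open>q(c)\<close> is \<open>g \<circ> \<tau>(u \<otimes> q)\<close>, and \<open>J\<close> commutes with
  \<open>\<tau>(u \<otimes> q)\<close>, which is the action of an element of \<open>B\<close>. So \<open>p\<close> is injective if \<open>J\<close> is.\<close>

lemma injective_right_coFrobenius:
  assumes lp: "locally_projective A C" and dense: "rational_dense A C" and mu: "cond_vi A C S"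
    and can: "can_iso A B C S" and l: "l_map S ` carrier B = Hom_C A C S S"
    and J: "J \<in> bimod_homs A B C S" and inj: "inj_on J (S_dual)"
  shows "right_coFrobenius A C"
proof -
  obtain p where p: "right_linear A C p"
    and p_coeff: "\<And>g u. \<lbrakk>g \<in> S_dual; u \<in> carrier S\<rbrakk> \<Longrightarrow> p (coeff g u) = (\<lambda>c\<in>carrier C. J g c u)"
    using bimod_hom_form[OF can J] by blast
  have pm: "p \<in> mod_hom A C (dual A C)" using p by (simp add: right_linear_def)
  have pf: "p c \<in> functionals A C" if "c \<in> carrier C" for c by (rule HomC[OF form_closed[OF pm that]])
  note JD = bimod_homD[OF J]
  have key: "J (q c) d v = q (ract (p c) d) v"
    if q: "q \<in> Q_set A C S" and c: "c \<in> carrier C" and d: "d \<in> carrier C" and v: "v \<in> carrier S" for q c d v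
  proof (rule coeff_generates[where h = "\<lambda>c. J (q c) d v" and k = "\<lambda>c. q (ract (p c) d) v",
        OF can R.is_abelian_group _ _ _ c])
    note qm = HomD(5)[OF Q_setD(1)[OF q]]
    note qc = Q_setD(2)[OF q]
    have \<theta>: "(\<lambda>c\<in>carrier C. q c v) \<in> functionals A C" by (rule HomC[OF Q_setD(3)[OF q v]])
    show "(\<lambda>c. J (q c) d v) \<in> add_homs C A"
    proof (rule add_homsI)
      fix c c' assume c: "c \<in> carrier C" "c' \<in> carrier C"
      show "J (q c) d v \<in> carrier A"
        using Hom_closedS[OF Q_setD(2)[OF JD(1)[OF qc[OF c(1)]] d] v] .
      show "J (q (c \<oplus>\<^bsub>C\<^esub> c')) d v = J (q c) d v \<oplus>\<^bsub>A\<^esub> J (q c') d v"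
        using JD(2)[OF qc[OF c(1)] qc[OF c(2)] d v] mod_homD(2)[OF qm c] by simp
    qed
    show "(\<lambda>c. q (ract (p c) d) v) \<in> add_homs C A"
    proof (rule add_homsI)
      fix c c' assume c: "c \<in> carrier C" "c' \<in> carrier C"
      note r = ract_closed[OF pf[OF c(1)] d] ract_closed[OF pf[OF c(2)] d]
      show "q (ract (p c) d) v \<in> carrier A" using Hom_closedS[OF qc[OF r(1)] v] .
      have "ract (p (c \<oplus>\<^bsub>C\<^esub> c')) d = ract (p c) d \<oplus>\<^bsub>C\<^esub> ract (p c') d"
        using ract_plus[OF pf[OF c(1)] pf[OF c(2)] d] mod_homD(2)[OF pm c] by simp
      then show "q (ract (p (c \<oplus>\<^bsub>C\<^esub> c')) d) v = q (ract (p c) d) v \<oplus>\<^bsub>A\<^esub> q (ract (p c') d) v"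
        using mod_homD(2)[OF qm r] v by simp
    qed
    fix g u assume g: "g \<in> S_dual" and u: "u \<in> carrier S"
    note cgu = coeff_closed[OF HomS[OF g] u]
    obtain b where b: "b \<in> carrier B" "tau_pure u q = l_map S b"
      using tau_pure_Hom_C[OF q u] l by blast
    have t_eq: "lact S b w = sact (\<lambda>c\<in>carrier C. q c w) u" if "w \<in> carrier S" for w
      using fun_cong[OF b(2), of w] that by (simp add: tau_pure_def l_map_def)
    have "q (coeff g u) w = g (lact S b w)" if w: "w \<in> carrier S" for w
      using functional_coeff[OF HomC[OF Q_setD(3)[OF q w]] HomS[OF g] u] cgu t_eq[OF w] by simp
    then have "q (coeff g u) = (\<lambda>w\<in>carrier S. g (lact S b w))"
      using HomD(4)[OF qc[OF cgu]] by (intro extensionalityI[of _ "carrier S"]) auto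
    then have "J (q (coeff g u)) d v = J g d (sact (\<lambda>c\<in>carrier C. q c v) u)"
      using JD(4)[OF b(1) g d v] t_eq[OF v] by simp
    also have "\<dots> = (\<lambda>c\<in>carrier C. q c v) (coeff (J g d) u)"
      by (rule functional_coeff[OF \<theta> HomS[OF Q_setD(2)[OF JD(1)[OF g] d]] u, symmetric])
    also have "\<dots> = q (ract (p (coeff g u)) d) v"
      using Q_setD(4)[OF JD(1)[OF g] d u] p_coeff[OF g u] ract_closed[OF pf[OF cgu] d] by simp
    finally show "J (q (coeff g u)) d v = q (ract (p (coeff g u)) d) v" .
  qed
  have "inj_on p (carrier C)"
  proof (rule inj_onI)
    fix c c' assume c: "c \<in> carrier C" "c' \<in> carrier C" and eq: "p c = p c'"
    show "c = c'"
    proof (rule Q_separates[OF lp dense mu c])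
      fix q u assume q: "q \<in> Q_set A C S"
      note qc = Q_setD(2)[OF q c(1)] and qc' = Q_setD(2)[OF q c(2)]
      note Jc = Q_setD[OF JD(1)[OF qc]] and Jc' = Q_setD[OF JD(1)[OF qc']]
      have "J (q c) = J (q c')"
      proof (rule Hom_eqI[OF Jc(1) Jc'(1)])
        fix d assume d: "d \<in> carrier C"
        show "J (q c) d = J (q c') d"
          by (rule Hom_eqI[OF Jc(2)[OF d] Jc'(2)[OF d]]) (simp add: key[OF q] c d eq)
      qed
      then show "q c u = q c' u" using inj_onD[OF inj _ qc qc'] by simp
    qed
  qed
  then show ?thesis using p lp right_coFrobenius_iff by blast
qed

end


theorem proposition6p6:
  fixes A :: "'a ring" and B :: "'b ring"
    and C :: "('a, 'c) coalgebra" and S :: "('a, 'b, 'c, 's) bicomodule"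
  assumes "cring A" and "is_coalgebra A C" and "ring B" and "is_fgp_bicomodule A B C S"
  shows
    "(PF_ring TYPE(('a, 'b, 'c, 's) univ) A \<and> left_coFrobenius A C \<and> right_coFrobenius A C
        \<longrightarrow> (\<exists>J\<in>bimod_homs A B C S. inj_on J (carrier (dual A S))) \<and>
            (\<exists>J'\<in>bimod_homs A B C S. J' ` carrier (dual A S) = carrier (Q_A A C S))) \<and>
     (PF_ring TYPE(('a, 'b, 'c, 's) univ) A \<and> locally_projective A C \<and> rational_dense A C \<and>
        l_map S \<in> ring_iso B (End_ring A C S) \<and> tau_surjective A C S \<and>
        cond_i TYPE(('a, 'b, 'c, 's) univ) A B C S \<and>
        cond_ii TYPE(('a, 'b, 'c, 's) univ) A B C S \<and>
        cond_iii TYPE(('a, 'b, 'c, 's) univ) A C S \<and>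
        cond_iv TYPE(('a, 'b, 'c, 's) univ) A C S \<and>
        cond_v TYPE(('a, 'b, 'c, 's) univ) A C S \<and>
        cond_vi A C S \<and> cond_vii A C S \<and>
        cond_viii TYPE(('a, 'b, 'c, 's) univ) A B C S \<and>
        cond_ix TYPE(('a, 'b, 'c, 's) univ) A B C S
        \<longrightarrow> (\<exists>J\<in>bimod_homs A B C S. inj_on J (carrier (dual A S))) \<and>
            (\<exists>J'\<in>bimod_homs A B C S. J' ` carrier (dual A S) = carrier (Q_A A C S))
        \<longrightarrow> left_coFrobenius A C \<and> right_coFrobenius A C)"
proof -
  interpret fgp_comodule A B C S using assms by (rule fgp_comodule.intro)
  show ?thesis
  proof (intro conjI impI; elim conjE bexE)
    assume "right_coFrobenius A C"
    then obtain p where p: "locally_projective A C" "right_linear A C p" "inj_on p (carrier C)"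
      unfolding right_coFrobenius_iff by blast
    show "\<exists>J\<in>bimod_homs A B C S. inj_on J (carrier (dual A S))"
      using coeff_map_bimod_hom[OF p(1,2)] coeff_map_inj[OF p(2,3)] by auto
  next
    assume PF: "PF_ring TYPE(('a, 'b, 'c, 's) univ) A" and "left_coFrobenius A C"
    then obtain j where lp: "locally_projective A C" and j: "left_linear A C j" and inj: "inj_on j (carrier C)"
      unfolding left_coFrobenius_iff by blast
    define p where "p = (\<lambda>c. \<lambda>d\<in>carrier C. j d c)"
    have p: "right_linear A C p" unfolding p_def by (rule left_to_right_linear[OF j])
    have "(\<lambda>d\<in>carrier C. p d c) = j c" if "c \<in> carrier C" for c
      using HomD(4)[OF form_closed[OF _ that]] j that
      by (intro extensionalityI[of _ "carrier C"]) (auto simp: left_linear_def p_def)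
    then have inj': "inj_on (\<lambda>c. \<lambda>d\<in>carrier C. p d c) (carrier C)"
      using inj by (simp cong: inj_on_cong)
    have "coeff_map p ` Hom A S (reg_left A) = Q_set A C S"
      using coeff_map_surj[OF _ _ p inj'] PF coeff_map_Q[OF lp p] by (force simp: PF_ring_def)
    then show "\<exists>J'\<in>bimod_homs A B C S. J' ` carrier (dual A S) = carrier (Q_A A C S)"
      using coeff_map_bimod_hom[OF lp p] by auto
  next
    fix J' assume "J' \<in> bimod_homs A B C S" "J' ` carrier (dual A S) = carrier (Q_A A C S)"
      "locally_projective A C" "rational_dense A C" "cond_vi A C S"
      "cond_i TYPE(('a, 'b, 'c, 's) univ) A B C S"
    then show "left_coFrobenius A C"
      by (intro surjective_left_coFrobenius[of J']) (simp_all add: cond_i_def)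
  next
    fix J assume "J \<in> bimod_homs A B C S" "inj_on J (carrier (dual A S))"
      "locally_projective A C" "rational_dense A C" "cond_vi A C S"
      "cond_i TYPE(('a, 'b, 'c, 's) univ) A B C S" "l_map S \<in> ring_iso B (End_ring A C S)"
    then show "right_coFrobenius A C"
      by (intro injective_right_coFrobenius[of J])
        (simp_all add: cond_i_def ring_iso_def bij_betw_def)
  qed
qed

end
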